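(* Let $\beta\in\{1,2,4\}$. For each $d\ge 1$, let $A_1^{(d)},A_2^{(d)},\ldots$ be independent $d\times d$ Gaussian matrices (real, complex or quaternion according to whether $\beta=1,2,4$) with covariance matrix $\Sigma_d$, and let the eigenvalues of $\Sigma_d$ be $\theta_i^{(d)}/d$, $i=1,\ldots,d$. Assume that there is a constant $L$, independent of $d$ and $i$, such that $1\le\theta_i^{(d)}\le L$ for all $d$ and $i$, and that $$\lim_{d\to\infty}\mathrm{Tr}(\Sigma_d)=\lim_{d\to\infty}\frac1d\sum_{i=1}^d\theta_i^{(d)}=\lambda .$$ Then the largest Lyapunov exponent $\mu_1^{(d)}$ of the matrices $A_i^{(d)}$ satisfies $$\lim_{d\to\infty}\mu_1^{(d)}=\frac12\log\lambda .$$
   Context: Gaussian matrices: let $\beta=1,2,4$ correspond to real, complex, quaternion scalars respectively, and let $\Sigma$ be a $d\times d$ positive definite self-adjoint matrix over these scalars (real symmetric, complex Hermitian, or quaternion self-adjoint). A $d\times d$ Gaussian matrix with covariance matrix $\Sigma$ is a random matrix distributed as $\Sigma^{1/2}G$, where $G$ is a $d\times d$ matrix with independent real, complex or quaternion entries, the $\beta$ real components of each entry being independent centered real Gaussian variables with variance $1/\beta$ (so each entry $g$ of $G$ has $\mathbb E|g|^2=1$). For each $d$ the $A_i^{(d)}$ are independent and identically distributed. Largest Lyapunov exponent: for independent and identically distributed $d\times d$ Gaussian matrices $A_1,A_2,\ldots$ with covariance matrix $\Sigma$ (each distributed as $\Sigma^{1/2}G$), with $P_n:=A_nA_{n-1}\cdots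 A_1$, it is the (almost sure, deterministic) limit $\mu_1=\lim_{n\to\infty}n^{-1}\log\|P_n\|$, where $\|\cdot\|$ is the operator norm. The exponent $\mu_1^{(d)}$ is this limit for the sequence $A_1^{(d)},A_2^{(d)},\ldots$ with $d$ fixed and $\Sigma=\Sigma_d$. *)

theory Defs
  imports "HOL-Probability.Probability" "Jordan_Normal_Form.Matrix"
begin

section \<open>Quaternions\<close>

datatype quat = Quat (qRe: real) (qIm1: real) (qIm2: real) (qIm3: real)

lemma quat_eq_iff:
  "x = y \<longleftrightarrow> qRe x = qRe y \<and> qIm1 x = qIm1 y \<and> qIm2 x = qIm2 y \<and> qIm3 x = qIm3 y"
  by (cases x; cases y) simp

instantiation quat :: ab_group_add
begin

definition zero_quat :: quat where "0 = Quat 0 0 0 0"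

definition plus_quat :: "quat \<Rightarrow> quat \<Rightarrow> quat" where
  "x + y = Quat (qRe x + qRe y) (qIm1 x + qIm1 y) (qIm2 x + qIm2 y) (qIm3 x + qIm3 y)"

definition uminus_quat :: "quat \<Rightarrow> quat" where
  "- x = Quat (- qRe x) (- qIm1 x) (- qIm2 x) (- qIm3 x)"

definition minus_quat :: "quat \<Rightarrow> quat \<Rightarrow> quat" where
  "x - y = Quat (qRe x - qRe y) (qIm1 x - qIm1 y) (qIm2 x - qIm2 y) (qIm3 x - qIm3 y)"

instance
  by standard (simp_all add: quat_eq_iff zero_quat_def plus_quat_def uminus_quat_def minus_quat_def)

end

lemma quat_add_sel [simp]:
  "qRe (x + y) = qRe x + qRe y" "qIm1 (x + y) = qIm1 x + qIm1 y"
  "qIm2 (x + y) = qIm2 x + qIm2 y" "qIm3 (x + y) = qIm3 x + qIm3 y"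
  by (simp_all add: plus_quat_def)

lemma quat_zero_sel [simp]:
  "qRe 0 = 0" "qIm1 0 = 0" "qIm2 0 = 0" "qIm3 0 = 0"
  by (simp_all add: zero_quat_def)

lemma quat_uminus_sel [simp]:
  "qRe (- x) = - qRe x" "qIm1 (- x) = - qIm1 x" "qIm2 (- x) = - qIm2 x" "qIm3 (- x) = - qIm3 x"
  by (simp_all add: uminus_quat_def)

lemma quat_minus_sel [simp]:
  "qRe (x - y) = qRe x - qRe y" "qIm1 (x - y) = qIm1 x - qIm1 y"
  "qIm2 (x - y) = qIm2 x - qIm2 y" "qIm3 (x - y) = qIm3 x - qIm3 y"
  by (simp_all add: minus_quat_def)

instantiation quat :: real_algebra_1
begin

definition one_quat :: quat where "1 = Quat 1 0 0 0"

definition times_quat :: "quat \<Rightarrow> quat \<Rightarrow> quat" where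
  "x * y = Quat
    (qRe x * qRe y - qIm1 x * qIm1 y - qIm2 x * qIm2 y - qIm3 x * qIm3 y)
    (qRe x * qIm1 y + qIm1 x * qRe y + qIm2 x * qIm3 y - qIm3 x * qIm2 y)
    (qRe x * qIm2 y - qIm1 x * qIm3 y + qIm2 x * qRe y + qIm3 x * qIm1 y)
    (qRe x * qIm3 y + qIm1 x * qIm2 y - qIm2 x * qIm1 y + qIm3 x * qRe y)"

definition scaleR_quat :: "real \<Rightarrow> quat \<Rightarrow> quat" where
  "r *\<^sub>R x = Quat (r * qRe x) (r * qIm1 x) (r * qIm2 x) (r * qIm3 x)"

lemma quat_sel [simp]:
  "qRe 1 = 1" "qIm1 1 = 0" "qIm2 1 = 0" "qIm3 1 = 0"
  "qRe (r *\<^sub>R x) = r * qRe x" "qIm1 (r *\<^sub>R x) = r * qIm1 x"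
  "qIm2 (r *\<^sub>R x) = r * qIm2 x" "qIm3 (r *\<^sub>R x) = r * qIm3 x"
  "qRe (x * y) = qRe x * qRe y - qIm1 x * qIm1 y - qIm2 x * qIm2 y - qIm3 x * qIm3 y"
  "qIm1 (x * y) = qRe x * qIm1 y + qIm1 x * qRe y + qIm2 x * qIm3 y - qIm3 x * qIm2 y"
  "qIm2 (x * y) = qRe x * qIm2 y - qIm1 x * qIm3 y + qIm2 x * qRe y + qIm3 x * qIm1 y"
  "qIm3 (x * y) = qRe x * qIm3 y + qIm1 x * qIm2 y - qIm2 x * qIm1 y + qIm3 x * qRe y"
  by (simp_all add: one_quat_def scaleR_quat_def times_quat_def)

instance
proof
  fix x y z :: quat and a b :: real
  show "a *\<^sub>R (x + y) = a *\<^sub>R x + a *\<^sub>R y"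
    unfolding quat_eq_iff quat_sel quat_add_sel by (intro conjI; simp add: algebra_simps)
  show "(a + b) *\<^sub>R x = a *\<^sub>R x + b *\<^sub>R x"
    unfolding quat_eq_iff quat_sel quat_add_sel by (intro conjI; simp add: algebra_simps)
  show "a *\<^sub>R b *\<^sub>R x = (a * b) *\<^sub>R x"
    unfolding quat_eq_iff quat_sel quat_add_sel by (intro conjI; simp add: algebra_simps)
  show "1 *\<^sub>R x = x"
    unfolding quat_eq_iff quat_sel quat_add_sel by (intro conjI; simp add: algebra_simps)
  show "a *\<^sub>R x * y = a *\<^sub>R (x * y)"
    unfolding quat_eq_iff quat_sel quat_add_sel by (intro conjI; simp add: algebra_simps)
  show "x * a *\<^sub>R y = a *\<^sub>R (x * y)"
    unfolding quat_eq_iff quat_sel quat_add_sel by (intro conjI; simp add: algebra_simps)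
  show "x * y * z = x * (y * z)"
    unfolding quat_eq_iff quat_sel quat_add_sel by (intro conjI; simp add: algebra_simps)
  show "1 * x = x"
    unfolding quat_eq_iff quat_sel quat_add_sel by (intro conjI; simp add: algebra_simps)
  show "x * 1 = x"
    unfolding quat_eq_iff quat_sel quat_add_sel by (intro conjI; simp add: algebra_simps)
  show "(x + y) * z = x * z + y * z"
    unfolding quat_eq_iff quat_sel quat_add_sel by (intro conjI; simp add: algebra_simps)
  show "x * (y + z) = x * y + x * z"
    unfolding quat_eq_iff quat_sel quat_add_sel by (intro conjI; simp add: algebra_simps)
  show "(0::quat) \<noteq> 1" by (simp add: quat_eq_iff one_quat_def)
qed

end

instantiation quat :: real_normed_div_algebra
begin

definition norm_quat :: "quat \<Rightarrow> real" where
  "norm x = sqrt ((qRe x)\<^sup>2 + (qIm1 x)\<^sup>2 + (qIm2 x)\<^sup>2 + (qIm3 x)\<^sup>2)"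

definition sgn_quat :: "quat \<Rightarrow> quat" where "sgn (x::quat) = x /\<^sub>R norm x"

definition dist_quat :: "quat \<Rightarrow> quat \<Rightarrow> real" where "dist x y = norm (x - y :: quat)"

definition uniformity_quat :: "(quat \<times> quat) filter" where
  "uniformity = (INF e\<in>{0 <..}. principal {(x :: quat, y). dist x y < e})"

definition open_quat :: "quat set \<Rightarrow> bool" where
  "open (U :: quat set) \<longleftrightarrow> (\<forall>x\<in>U. eventually (\<lambda>(x', y). x' = x \<longrightarrow> y \<in> U) uniformity)"

definition inverse_quat :: "quat \<Rightarrow> quat" where
  "inverse x = inverse ((norm x)\<^sup>2) *\<^sub>R Quat (qRe x) (- qIm1 x) (- qIm2 x) (- qIm3 x)"

definition divide_quat :: "quat \<Rightarrow> quat \<Rightarrow> quat" where "x div y = x * inverse (y :: quat)"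

lemma norm_quat_sq: "(norm (x::quat))\<^sup>2 = (qRe x)\<^sup>2 + (qIm1 x)\<^sup>2 + (qIm2 x)\<^sup>2 + (qIm3 x)\<^sup>2"
  unfolding norm_quat_def by (rule real_sqrt_pow2) (intro add_nonneg_nonneg zero_le_power2)

lemma norm_quat_eq_0: "norm (x::quat) = 0 \<longleftrightarrow> x = 0"
proof -
  have "norm x = 0 \<longleftrightarrow> (norm x)\<^sup>2 = 0" by simp
  also have "\<dots> \<longleftrightarrow> x = 0"
    unfolding norm_quat_sq by (auto simp: quat_eq_iff add_nonneg_eq_0_iff)
  finally show ?thesis .
qed

lemma norm_quat_L2: "norm (x::quat) = L2_set (\<lambda>i. [qRe x, qIm1 x, qIm2 x, qIm3 x] ! i) {..<4}"
  by (simp add: norm_quat_def L2_set_def numeral_eq_Suc lessThan_Suc ac_simps)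

instance
proof
  fix x y :: quat and a :: real
  show "sgn x = x /\<^sub>R norm x" "dist x y = norm (x - y)" "x div y = x * inverse y"
    by (simp_all add: sgn_quat_def dist_quat_def divide_quat_def)
  show "uniformity = (INF e\<in>{0 <..}. principal {(x :: quat, y). dist x y < e})"
    by (rule uniformity_quat_def)
  fix U :: "quat set"
  show "open U = (\<forall>x\<in>U. \<forall>\<^sub>F (x', y) in uniformity. x' = x \<longrightarrow> y \<in> U)"
    by (rule open_quat_def)
  show "inverse (0::quat) = 0" by (simp add: inverse_quat_def quat_eq_iff)
  show "norm x = 0 \<longleftrightarrow> x = 0" by (rule norm_quat_eq_0)
  show "norm (a *\<^sub>R x) = \<bar>a\<bar> * norm x"
    by (simp add: norm_quat_def power_mult_distrib real_sqrt_mult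
        flip: distrib_left)
  show "norm (x + y) \<le> norm x + norm y"
  proof -
    have "norm (x + y) =
      L2_set (\<lambda>i. [qRe x, qIm1 x, qIm2 x, qIm3 x] ! i + [qRe y, qIm1 y, qIm2 y, qIm3 y] ! i) {..<4}"
      by (simp add: norm_quat_def L2_set_def numeral_eq_Suc lessThan_Suc ac_simps)
    also have "\<dots> \<le> norm x + norm y"
      unfolding norm_quat_L2[of x] norm_quat_L2[of y] by (rule L2_set_triangle_ineq)
    finally show ?thesis .
  qed
  show "norm (x * y) = norm x * norm y"
  proof (rule power2_eq_imp_eq)
    show "(norm (x * y))\<^sup>2 = (norm x * norm y)\<^sup>2"
      unfolding power_mult_distrib norm_quat_sq quat_sel
      by (simp add: power2_eq_square algebra_simps)
  qed (simp_all add: norm_quat_def)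
  assume "x \<noteq> 0"
  then have "norm x \<noteq> 0" by (simp add: norm_quat_eq_0)
  define m where "m = inverse ((norm x)\<^sup>2)"
  have *: "m * (qRe x)\<^sup>2 + m * (qIm1 x)\<^sup>2 + m * (qIm2 x)\<^sup>2 + m * (qIm3 x)\<^sup>2 = 1"
    using \<open>norm x \<noteq> 0\<close> unfolding distrib_left[symmetric] m_def norm_quat_sq[symmetric] by simp
  have inv: "inverse x = Quat (m * qRe x) (- m * qIm1 x) (- m * qIm2 x) (- m * qIm3 x)"
    by (simp add: inverse_quat_def m_def quat_eq_iff)
  have left: "m * qRe x * qRe x + m * qIm1 x * qIm1 x + m * qIm2 x * qIm2 x + m * qIm3 x * qIm3 x = 1"
    using * by (simp only: power2_eq_square mult.assoc)
  then have right: "qRe x * (m * qRe x) + qIm1 x * (m * qIm1 x) + qIm2 x * (m * qIm2 x)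
      + qIm3 x * (m * qIm3 x) = 1"
    by (simp only: mult_ac)
  show "inverse x * x = 1"
    unfolding inv quat_eq_iff quat_sel quat.sel by (intro conjI) (simp add: left, simp_all add: algebra_simps)
  show "x * inverse x = 1"
    unfolding inv quat_eq_iff quat_sel quat.sel by (intro conjI) (simp add: right, simp_all add: algebra_simps)
qed

end

instantiation quat :: euclidean_space
begin

definition inner_quat :: "quat \<Rightarrow> quat \<Rightarrow> real" where
  "inner_quat x y = qRe x * qRe y + qIm1 x * qIm1 y + qIm2 x * qIm2 y + qIm3 x * qIm3 y"

definition Basis_quat :: "quat set" where
  "Basis_quat = {Quat 1 0 0 0, Quat 0 1 0 0, Quat 0 0 1 0, Quat 0 0 0 1}"

instance
proof
  fix x y z u v :: quat and r :: real
  show "inner x y = inner y x" "inner (x + y) z = inner x z + inner y z"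
    "inner (r *\<^sub>R x) y = r * inner x y" "0 \<le> inner x x"
    by (simp_all add: inner_quat_def algebra_simps)
  show "norm x = sqrt (inner x x)"
    by (simp add: inner_quat_def norm_quat_def power2_eq_square)
  then show "inner x x = 0 \<longleftrightarrow> x = 0"
    using norm_quat_eq_0[of x] by simp
  show "Basis \<noteq> ({} :: quat set)" "finite (Basis :: quat set)"
    by (simp_all add: Basis_quat_def)
  show "u \<in> Basis \<Longrightarrow> v \<in> Basis \<Longrightarrow> inner u v = (if u = v then 1 else 0)"
    unfolding Basis_quat_def inner_quat_def by (elim insertE emptyE; simp)
  show "(\<forall>u\<in>Basis. inner x u = 0) \<longleftrightarrow> x = 0"
    unfolding quat_eq_iff[of x] by (simp add: Basis_quat_def inner_quat_def)
qed

end

lemma DIM_quat [simp]: "DIM(quat) = 4"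
  by (simp add: Basis_quat_def)

instantiation quat :: conjugate
begin

definition conjugate_quat :: "quat \<Rightarrow> quat" where
  "conjugate x = Quat (qRe x) (- qIm1 x) (- qIm2 x) (- qIm3 x)"

instance
proof
  fix x y :: quat
  show "conjugate (conjugate x) = x"
    unfolding conjugate_quat_def quat_eq_iff quat.sel by simp
  show "conjugate x = conjugate y \<longleftrightarrow> x = y"
    unfolding conjugate_quat_def quat_eq_iff quat.sel by simp
qed

end

section \<open>Scalars\<close>

text \<open>The common interface of the three scalar types \<^typ>\<open>real\<close>, \<^typ>\<open>complex\<close> and \<^typ>\<open>quat\<close>.
  The real components of a scalar are its coordinates with respect to \<^const>\<open>Basis\<close>, and the
  parameter $\beta$ is \<open>DIM('k)\<close>, that is, 1, 2 and 4 respectively.\<close>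

class gaussian_scalar = conjugate + real_normed_div_algebra + euclidean_space +
  assumes conjugate_mult_self: "conjugate x * x = (norm x)\<^sup>2 *\<^sub>R 1"

instance real :: gaussian_scalar
  by standard (simp add: power2_eq_square)

instance complex :: gaussian_scalar
proof
  fix x :: complex
  show "conjugate x * x = (norm x)\<^sup>2 *\<^sub>R 1"
    by (simp add: complex_eq_iff cmod_power2) (simp add: power2_eq_square)
qed

instance quat :: gaussian_scalar
proof
  fix x :: quat
  show "conjugate x * x = (norm x)\<^sup>2 *\<^sub>R 1"
    unfolding norm_quat_sq quat_eq_iff quat_sel conjugate_quat_def quat.sel
    by (simp add: power2_eq_square algebra_simps)
qed

section \<open>Self-adjoint matrices over the scalars\<close>

text \<open>Matrices act from the left on column vectors, which form a right vector space over the
  scalars (this only matters for quaternions).\<close>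

definition pos_def_self_adjoint :: "nat \<Rightarrow> 'k::gaussian_scalar mat \<Rightarrow> bool" where
  "pos_def_self_adjoint d S \<longleftrightarrow>
     S \<in> carrier_mat d d \<and> map_mat conjugate (transpose_mat S) = S \<and>
     (\<forall>v\<in>carrier_vec d. v \<noteq> 0\<^sub>v d \<longrightarrow>
        (\<exists>r::real. r > 0 \<and> scalar_prod (conjugate v) (S *\<^sub>v v) = of_real r))"

definition mat_sqrt :: "nat \<Rightarrow> 'k::gaussian_scalar mat \<Rightarrow> 'k mat" where
  "mat_sqrt d \<Sigma> = (THE S. pos_def_self_adjoint d S \<and> S * S = \<Sigma>)"

definition mat_trace :: "'k::gaussian_scalar mat \<Rightarrow> 'k" where
  "mat_trace A = (\<Sum>i<dim_row A. A $$ (i, i))"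

definition eigenspace :: "nat \<Rightarrow> 'k::gaussian_scalar mat \<Rightarrow> real \<Rightarrow> 'k vec set" where
  "eigenspace d S t = {v \<in> carrier_vec d. S *\<^sub>v v = of_real t \<cdot>\<^sub>v v}"

text \<open>A subspace has dimension \<open>m\<close> if it has a basis of size \<open>m\<close>: the columns of \<open>B\<close> are such a
  basis iff every vector of the subspace is \<open>B *\<^sub>v c\<close>, a right linear combination of the columns,
  for exactly one coefficient vector \<open>c\<close>.\<close>

definition has_dimension :: "nat \<Rightarrow> 'k::gaussian_scalar vec set \<Rightarrow> nat \<Rightarrow> bool" where
  "has_dimension d V m \<longleftrightarrow>
     (\<exists>B\<in>carrier_mat d m. bij_betw (\<lambda>c. B *\<^sub>v c) (carrier_vec m) V)"

text \<open>The eigenvalues of a self-adjoint matrix, listed with multiplicity as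
  \<open>\<theta> 1, \<dots>, \<theta> d\<close>. Self-adjoint matrices have only real eigenvalues, and
  the multiplicity is the dimension of the eigenspace.\<close>

definition eigenvalues_are :: "nat \<Rightarrow> 'k::gaussian_scalar mat \<Rightarrow> (nat \<Rightarrow> real) \<Rightarrow> bool" where
  "eigenvalues_are d S \<theta> \<longleftrightarrow>
     (\<forall>t. has_dimension d (eigenspace d S t) (card {i\<in>{1..d}. \<theta> i = t}))"

section \<open>Gaussian matrices\<close>

definition mat_borel :: "nat \<Rightarrow> 'k::gaussian_scalar mat measure" where
  "mat_borel d = vimage_algebra (carrier_mat d d) (\<lambda>A. \<lambda>ij\<in>{..<d} \<times> {..<d}. A $$ ij)
     (PiM ({..<d} \<times> {..<d}) (\<lambda>_. borel))"

text \<open>The second argument of \<^const>\<open>normal_density\<close> is the standard deviation.\<close>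

definition gaussian_entry :: "'k::gaussian_scalar measure" where
  "gaussian_entry =
     distr (PiM Basis (\<lambda>_::'k. density lborel (normal_density 0 (1 / sqrt (real DIM('k))))))
       borel (\<lambda>x. \<Sum>b\<in>Basis. x b *\<^sub>R b)"

text \<open>The law of \<open>\<Sigma>\<^sup>1\<^sup>/\<^sup>2 G\<close>.\<close>

definition gaussian_matrix_law :: "nat \<Rightarrow> 'k::gaussian_scalar mat \<Rightarrow> 'k mat measure" where
  "gaussian_matrix_law d \<Sigma> =
     distr (PiM ({..<d} \<times> {..<d}) (\<lambda>_. gaussian_entry)) (mat_borel d)
       (\<lambda>g. mat_sqrt d \<Sigma> * mat d d g)"

definition iid_gaussian_matrices ::
  "'w measure \<Rightarrow> nat \<Rightarrow> 'k::gaussian_scalar mat \<Rightarrow> (nat \<Rightarrow> 'w \<Rightarrow> 'k mat) \<Rightarrow> bool" where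
  "iid_gaussian_matrices M d \<Sigma> A \<longleftrightarrow>
     prob_space.indep_vars M (\<lambda>_. mat_borel d) A {1..} \<and>
     (\<forall>i\<ge>1. distr M (mat_borel d) (A i) = gaussian_matrix_law d \<Sigma>)"

section \<open>The largest Lyapunov exponent\<close>

definition vec_norm :: "'k::gaussian_scalar vec \<Rightarrow> real" where
  "vec_norm v = sqrt (\<Sum>i<dim_vec v. (norm (vec_index v i))\<^sup>2)"

definition op_norm :: "'k::gaussian_scalar mat \<Rightarrow> real" where
  "op_norm A = (SUP v\<in>{v \<in> carrier_vec (dim_col A). vec_norm v \<le> 1}. vec_norm (A *\<^sub>v v))"

primrec mat_product :: "nat \<Rightarrow> (nat \<Rightarrow> 'k::gaussian_scalar mat) \<Rightarrow> nat \<Rightarrow> 'k mat" where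
  "mat_product d A 0 = 1\<^sub>m d"
| "mat_product d A (Suc n) = A (Suc n) * mat_product d A n"

definition largest_lyapunov ::
  "'w measure \<Rightarrow> nat \<Rightarrow> (nat \<Rightarrow> 'w \<Rightarrow> 'k::gaussian_scalar mat) \<Rightarrow> real" where
  "largest_lyapunov M d A =
     (THE \<mu>. AE \<omega> in M. (\<lambda>n. ln (op_norm (mat_product d (\<lambda>i. A i \<omega>) n)) / real n) \<longlonglongrightarrow> \<mu>)"

end

theory Submission
  imports Defs
begin

text \<open>A row of \<open>G\<close> times \<open>w\<close> is a sum of independent rotated Gaussian scalars, so \<open>G w\<close> has the law of
  \<open>|w| g\<close> for a standard Gaussian vector \<open>g\<close>. Hence, with \<open>S = \<Sigma>\<^sup>1\<^sup>/\<^sup>2\<close>, the factors in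
  \<open>|P\<^sub>n v| = \<Prod> |A\<^sub>k u\<^sub>k| \<close> (\<open>u\<^sub>k\<close> the normalised vector \<open>P\<^sub>k\<^sub>-\<^sub>1 v\<close>) are independent copies of
  \<open>|S g|\<close>, so that \<open>E |P\<^sub>n v|\<^sup>s = (E |S g|\<^sup>s)\<^sup>n\<close>. Taking \<open>s\<close> close to 0 on either side, Chernoff bounds give
  \<open>\<mu>\<^sub>1 = E ln |S g|\<close>. As \<open>d\<close> grows, \<open>|S g|\<^sup>2\<close> has mean \<open>tr \<Sigma>\<close>, variance \<open>O(1/d)\<close> and
  a bounded moment of order \<open>-1/4\<close>, whence \<open>2 \<mu>\<^sub>1 - ln (tr \<Sigma>) \<longlonglongrightarrow> 0\<close>.\<close>

section \<open>Linear algebra over the three kinds of scalars, carried out with real quadratic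
  forms\<close>

section \<open>Conjugation of scalars\<close>

text \<open>Quaternions do not commute, so matrices are studied through the real inner product
  \<open>rip\<close>, for which a self-adjoint matrix is a symmetric real-linear operator. The
  eigenvalue list enters through the extremes of the quadratic form,
  \<open>1/d \<le> \<Sigma> \<le> L/d\<close>. As \<open>mat_sqrt\<close> is a definite description,
  its value has to be shown to exist and be unique; a binomial series gives both without
  diagonalisation. The other obstacle is the singularity of \<open>ln\<close> at 0. The exponent 1/2
  for |S g| is safe because a single real Gaussian t already has finite E |t|^(-1/2), so it serves
  every \<beta> and d. The bound \<theta> \<ge> 1 makes |S g|^2 at least the mean of the |g_i|^2,
  and convexity then bounds the negative moment uniformly in d. This moment does not become small,
  but it enters the estimate of \<open>ln\<close> with an arbitrarily small factor \<eta>. Negative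
  powers are written as \<open>inverse\<close> in \<open>ennreal\<close>, infinite at 0, so that a
  finite integral excludes the value 0 almost surely. In passing from |P_n v| to the operator norm,
  d is fixed: the norm lies between |P_n e_0| and the sum of the |P_n e_j|, and a factor d is lost
  in (ln d)/n.\<close>

lemma inner_mult_left_cancel:
  fixes a x y :: "'k::gaussian_scalar"
  shows "inner (a * x) (a * y) = (norm a)\<^sup>2 * inner x y"
proof -
  have "(norm (a * x + a * y))\<^sup>2 = (norm a)\<^sup>2 * (norm (x + y))\<^sup>2"
    by (simp add: norm_mult power_mult_distrib flip: distrib_left)
  then show ?thesis
    unfolding dot_norm norm_mult power_mult_distrib by (simp add: algebra_simps)
qed

lemma conjugate_zero_scalar [simp]: "conjugate (0::'k::gaussian_scalar) = 0"
proof (rule ccontr)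
  assume *: "conjugate (0::'k) \<noteq> 0"
  have "conjugate (conjugate (0::'k)) * conjugate 0 = (norm (conjugate (0::'k)))\<^sup>2 *\<^sub>R 1"
    by (rule conjugate_mult_self)
  with * show False by simp
qed

text \<open>Left multiplication by \<open>a\<close> is a similarity of ratio |a|, so its adjoint is
  |a|^2 times left multiplication by \<open>inverse a\<close>; the class axiom identifies |a|^2
  \<open>inverse a\<close> with \<open>conjugate a\<close>.\<close>

lemma inner_mult_conjugate:
  fixes a x y :: "'k::gaussian_scalar"
  shows "inner (a * x) y = inner x (conjugate a * y)"
proof (cases "a = 0")
  case False
  have "conjugate a = conjugate a * a * inverse a"
    using False by (simp add: mult.assoc)
  also have "\<dots> = (norm a)\<^sup>2 *\<^sub>R inverse a"
    by (simp add: conjugate_mult_self)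
  finally have c: "conjugate a = (norm a)\<^sup>2 *\<^sub>R inverse a" .
  have "inner (a * x) y = inner (a * x) (a * (inverse a * y))"
    using False by (simp flip: mult.assoc)
  also have "\<dots> = (norm a)\<^sup>2 * inner x (inverse a * y)"
    by (rule inner_mult_left_cancel)
  finally show ?thesis by (simp add: c)
qed simp

text \<open>The adjoint identity at y = 1 determines \<open>conjugate a\<close>, since the inner
  product is nondegenerate. Additivity, reversal of products and real homogeneity of
  \<open>conjugate\<close> all follow from this, the class itself postulating only the value of
  \<open>conjugate x * x\<close>.\<close>

lemma eq_conjugateI:
  fixes a b :: "'k::gaussian_scalar"
  assumes "\<And>x. inner (a * x) 1 = inner x b"
  shows "conjugate a = b"
  by (metis assms inner_commute inner_mult_conjugate mult_1_right vector_eq_ldot)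

lemma conjugate_add_scalar: "conjugate (a + b) = conjugate a + conjugate (b::'k::gaussian_scalar)"
  by (rule eq_conjugateI) (simp add: inner_mult_conjugate inner_simps algebra_simps)

lemma conjugate_mult_scalar: "conjugate (a * b) = conjugate b * conjugate (a::'k::gaussian_scalar)"
  by (rule eq_conjugateI) (simp add: inner_mult_conjugate mult.assoc)

lemma conjugate_scaleR: "conjugate (r *\<^sub>R a) = r *\<^sub>R conjugate (a::'k::gaussian_scalar)"
  by (rule eq_conjugateI) (simp add: inner_mult_conjugate)

lemma conjugate_of_real [simp]: "conjugate (of_real r) = (of_real r :: 'k::gaussian_scalar)"
proof -
  have "conjugate (1::'k) = 1"
    using conjugate_mult_self[of "1::'k"] by simp
  then show ?thesis
    by (simp add: of_real_def conjugate_scaleR)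
qed

lemma conjugate_sum_scalar: "conjugate (sum f I) = (\<Sum>i\<in>I. conjugate (f i :: 'k::gaussian_scalar))"
  by (induction I rule: infinite_finite_induct) (auto simp: conjugate_add_scalar)

lemma norm_conjugate_scalar [simp]: "norm (conjugate (a::'k::gaussian_scalar)) = norm a"
proof (cases "a = 0")
  case False
  have "norm (conjugate a) * norm a = (norm a)\<^sup>2"
    by (metis conjugate_mult_self norm_mult norm_scaleR norm_one mult.right_neutral abs_power2)
  with False show ?thesis by (simp add: power2_eq_square)
qed simp

lemma bounded_linear_conjugate: "bounded_linear (conjugate :: 'k::gaussian_scalar \<Rightarrow> 'k)"
  by (rule bounded_linear_intro[of _ 1]) (auto simp: conjugate_add_scalar conjugate_scaleR)

lemma of_real_central: "of_real r * x = x * (of_real r :: 'k::gaussian_scalar)"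
  by (simp add: of_real_def)

lemma inner_one_of_real [simp]: "inner 1 (of_real r :: 'k::gaussian_scalar) = r"
  by (simp add: of_real_def power2_norm_eq_inner[symmetric])
text \<open>Here a^2 = |a|^2, and the real number |a| is central, so (a - |a|)(a + |a|) = 0 in a
  division algebra.\<close>

lemma self_conjugate_real:
  fixes a :: "'k::gaussian_scalar"
  assumes "conjugate a = a"
  shows "a = of_real (inner 1 a)"
proof -
  have "a * a = of_real (norm a) * of_real (norm a)"
    using conjugate_mult_self[of a] assms by (simp add: of_real_def power2_eq_square)
  then have "(a - of_real (norm a)) * (a + of_real (norm a)) = 0"
    using of_real_central[of "norm a" a] by (simp add: algebra_simps)
  then have "a = of_real (norm a) \<or> a = of_real (- norm a)"
    by (simp add: eq_neg_iff_add_eq_0)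
  then show ?thesis by (metis inner_one_of_real)
qed

unbundle no vec_syntax and no inner_syntax

section \<open>The real inner product of vectors\<close>

text \<open>The real part of the Hermitian form conj(u) v (see
  \<open>inner_one_scalar_prod_conjugate\<close>). Taking it coordinatewise from
  \<open>inner\<close> removes every concern about the order of multiplication.\<close>

definition rip :: "'k::gaussian_scalar vec \<Rightarrow> 'k vec \<Rightarrow> real" where
  "rip u v = (\<Sum>i<dim_vec u. inner (u $ i) (v $ i))"

lemma rip_commute: "dim_vec u = dim_vec v \<Longrightarrow> rip u v = rip v u"
  by (simp add: rip_def inner_commute)

lemma rip_self: "rip v v = (vec_norm v)\<^sup>2"
  by (simp add: rip_def vec_norm_def sum_nonneg power2_norm_eq_inner)

lemma vec_norm_nonneg [simp]: "0 \<le> vec_norm v"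
  by (simp add: vec_norm_def sum_nonneg)

lemma vec_norm_eq_0_iff: "vec_norm v = 0 \<longleftrightarrow> v = 0\<^sub>v (dim_vec v)"
proof -
  have "vec_norm v = 0 \<longleftrightarrow> (\<forall>i<dim_vec v. v $ i = 0)"
    by (auto simp: vec_norm_def sum_nonneg_eq_0_iff)
  also have "\<dots> \<longleftrightarrow> v = 0\<^sub>v (dim_vec v)"
    by (auto simp: vec_eq_iff)
  finally show ?thesis .
qed

lemma norm_index_le_vec_norm: "i < dim_vec v \<Longrightarrow> norm (v $ i) \<le> vec_norm v"
  unfolding vec_norm_def by (rule real_le_rsqrt) (rule member_le_sum, auto)

lemma rip_add_right:
  assumes "dim_vec u = n" "dim_vec v = n" "dim_vec w = n"
  shows "rip u (v + w) = rip u v + rip u w"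
  using assms by (simp add: rip_def inner_add_right sum.distrib)

lemma rip_add_left:
  assumes "dim_vec u = n" "dim_vec v = n" "dim_vec w = n"
  shows "rip (v + w) u = rip v u + rip w u"
  using assms by (simp add: rip_def inner_add_left sum.distrib)

lemma rip_smult_right:
  assumes "dim_vec u = n" "dim_vec v = n"
  shows "rip u (of_real r \<cdot>\<^sub>v v) = r * rip u v"
  using assms by (simp add: rip_def of_real_def sum_distrib_left)

lemma rip_smult_left:
  assumes "dim_vec u = n" "dim_vec v = n"
  shows "rip (of_real r \<cdot>\<^sub>v v) u = r * rip v u"
  using assms by (simp add: rip_def of_real_def sum_distrib_left)

lemmas rip_simps = rip_add_right rip_add_left rip_smult_right rip_smult_left

lemma vec_norm_smult: "vec_norm (of_real r \<cdot>\<^sub>v v) = \<bar>r\<bar> * vec_norm v"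
  by (simp add: vec_norm_def norm_mult power_mult_distrib real_sqrt_mult flip: sum_distrib_left)

lemma inner_one_scalar_prod_conjugate:
  fixes u v :: "'k::gaussian_scalar vec"
  assumes "dim_vec u = dim_vec v"
  shows "inner 1 (scalar_prod (conjugate u) v) = rip u v"
proof -
  have "inner 1 (conjugate (u $ i) * v $ i) = inner (u $ i) (v $ i)" for i
    using inner_mult_conjugate[of "u $ i" 1 "v $ i"] by simp
  then show ?thesis
    using assms by (simp add: scalar_prod_def rip_def inner_sum_right atLeast0LessThan)
qed

section \<open>Self-adjoint operators\<close>

text \<open>Stated for functions and only real-linear, so that combinations such as t - A and the
  identity are covered without forming matrices.\<close>

definition sym_op :: "nat \<Rightarrow> ('k::gaussian_scalar vec \<Rightarrow> 'k vec) \<Rightarrow> bool" where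
  "sym_op d f \<longleftrightarrow>
     (\<forall>u\<in>carrier_vec d. f u \<in> carrier_vec d) \<and>
     (\<forall>u\<in>carrier_vec d. \<forall>v\<in>carrier_vec d. f (u + v) = f u + f v) \<and>
     (\<forall>u\<in>carrier_vec d. \<forall>r. f (of_real r \<cdot>\<^sub>v u) = of_real r \<cdot>\<^sub>v f u) \<and>
     (\<forall>u\<in>carrier_vec d. \<forall>v\<in>carrier_vec d. rip (f u) v = rip u (f v))"

lemma square_le_of_quadratic_nonneg:
  fixes a b c :: real
  assumes c: "0 \<le> c" and nonneg: "\<And>t. 0 \<le> a + 2 * t * b + t\<^sup>2 * c"
  shows "b\<^sup>2 \<le> a * c"
proof (cases "c = 0")
  case True
  show ?thesis
  proof (cases "b = 0")
    case False
    \<comment> \<open>With c = 0 the expression is affine in t, and at this t it equals -1, a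
      contradiction.\<close>
    then show ?thesis using nonneg[of "- (a + 1) / (2 * b)"] True by (simp add: field_simps)
  qed (use True in simp)
next
  case False
  then have c: "c > 0" using c by simp
  from nonneg[of "- b / c"] have "0 \<le> a - b\<^sup>2 / c"
    using c by (simp add: power2_eq_square field_simps)
  then show ?thesis using c by (simp add: field_simps)
qed

lemma psd_cauchy_schwarz:
  assumes f: "sym_op d f" and psd: "\<And>v. v \<in> carrier_vec d \<Longrightarrow> 0 \<le> rip v (f v)"
    and u: "u \<in> carrier_vec d" and v: "v \<in> carrier_vec d"
  shows "(rip u (f v))\<^sup>2 \<le> rip u (f u) * rip v (f v)"
proof (rule square_le_of_quadratic_nonneg[OF psd[OF v]])
  fix t :: real
  let ?w = "u + of_real t \<cdot>\<^sub>v v"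
  have c: "f u \<in> carrier_vec d" "f v \<in> carrier_vec d"
    using f u v by (auto simp: sym_op_def)
  have d: "dim_vec u = d" "dim_vec v = d" "dim_vec (f u) = d" "dim_vec (f v) = d"
    using c u v by auto
  have fw: "f ?w = f u + of_real t \<cdot>\<^sub>v f v"
    using f u v by (simp add: sym_op_def)
  have "rip v (f u) = rip u (f v)"
    using f u v c by (metis d rip_commute sym_op_def)
  then have "rip ?w (f ?w) = rip u (f u) + 2 * t * rip u (f v) + t\<^sup>2 * rip v (f v)"
    unfolding fw by (simp add: rip_simps[where n=d] d algebra_simps power2_eq_square)
  then show "0 \<le> rip u (f u) + 2 * t * rip u (f v) + t\<^sup>2 * rip v (f v)"
    using psd[of ?w] u v by simp
qed

text \<open>Cauchy-Schwarz for the semidefinite form, applied to the pair f v, v, gives |f v|^4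
  \<le> 0.\<close>

lemma psd_kernel:
  assumes f: "sym_op d f" and psd: "\<And>v. v \<in> carrier_vec d \<Longrightarrow> 0 \<le> rip v (f v)"
    and v: "v \<in> carrier_vec d" and 0: "rip v (f v) = 0"
  shows "f v = 0\<^sub>v d"
proof -
  have c: "f v \<in> carrier_vec d" using f v by (auto simp: sym_op_def)
  from psd_cauchy_schwarz[OF f psd c v] have "rip (f v) (f v) = 0"
    using 0 by simp
  then show ?thesis using c by (auto simp: rip_self vec_norm_eq_0_iff)
qed

text \<open>A bound on the form becomes a bound on the operator norm: Cauchy-Schwarz for the pair f
  v, v gives |f v|^4 \<le> (r |f v|^2)(r |v|^2), and |f v|^2 cancels.\<close>

lemma psd_vec_norm_le:
  assumes f: "sym_op d f" and psd: "\<And>v. v \<in> carrier_vec d \<Longrightarrow> 0 \<le> rip v (f v)"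
    and le: "\<And>v. v \<in> carrier_vec d \<Longrightarrow> rip v (f v) \<le> r * (vec_norm v)\<^sup>2"
    and r: "0 \<le> r" and v: "v \<in> carrier_vec d"
  shows "vec_norm (f v) \<le> r * vec_norm v"
proof (cases "vec_norm (f v) = 0")
  case False
  have c: "f v \<in> carrier_vec d" using f v by (auto simp: sym_op_def)
  have "((vec_norm (f v))\<^sup>2)\<^sup>2 \<le> rip (f v) (f (f v)) * rip v (f v)"
    using psd_cauchy_schwarz[OF f psd c v] by (simp add: rip_self)
  also have "\<dots> \<le> (r * (vec_norm (f v))\<^sup>2) * (r * (vec_norm v)\<^sup>2)"
    using c v by (intro mult_mono le psd) (auto intro: r mult_nonneg_nonneg)
  also have "\<dots> = (vec_norm (f v))\<^sup>2 * (r * vec_norm v)\<^sup>2"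
    by (simp add: power_mult_distrib power2_eq_square algebra_simps)
  finally have "(vec_norm (f v))\<^sup>2 * (vec_norm (f v))\<^sup>2 \<le> (vec_norm (f v))\<^sup>2 * (r * vec_norm v)\<^sup>2"
    by (simp only: power2_eq_square[of "(vec_norm (f v))\<^sup>2"])
  then have "(vec_norm (f v))\<^sup>2 \<le> (r * vec_norm v)\<^sup>2"
    by (rule mult_left_le_imp_le) (use False in simp)
  then show ?thesis
    by (rule power2_le_imp_le) (auto simp: r)
qed (simp add: r)

lemma index_mult_mat_vec_sum:
  assumes "A \<in> carrier_mat n m" "v \<in> carrier_vec m" "i < n"
  shows "(A *\<^sub>v v) $ i = (\<Sum>j<m. A $$ (i, j) * v $ j)"
  using assms by (auto simp: scalar_prod_def atLeast0LessThan intro!: sum.cong)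

lemma index_mult_mat_sum:
  assumes "A \<in> carrier_mat n m" "B \<in> carrier_mat m k" "i < n" "j < k"
  shows "(A * B) $$ (i, j) = (\<Sum>l<m. A $$ (i, l) * B $$ (l, j))"
  using assms by (auto simp: scalar_prod_def atLeast0LessThan intro!: sum.cong)

definition self_adjoint :: "nat \<Rightarrow> 'k::gaussian_scalar mat \<Rightarrow> bool" where
  "self_adjoint d A \<longleftrightarrow> A \<in> carrier_mat d d \<and> (\<forall>i<d. \<forall>j<d. conjugate (A $$ (i, j)) = A $$ (j, i))"

lemma self_adjoint_iff:
  "self_adjoint d A \<longleftrightarrow> A \<in> carrier_mat d d \<and> map_mat conjugate (transpose_mat A) = A"
  unfolding self_adjoint_def by (auto simp: mat_eq_iff)

lemma mult_mat_vec_smult_real: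
  fixes A :: "'k::gaussian_scalar mat"
  assumes "A \<in> carrier_mat n m" "v \<in> carrier_vec m"
  shows "A *\<^sub>v (of_real r \<cdot>\<^sub>v v) = of_real r \<cdot>\<^sub>v (A *\<^sub>v v)"
proof (rule eq_vecI)
  fix i assume "i < dim_vec (of_real r \<cdot>\<^sub>v (A *\<^sub>v v))"
  then have i: "i < n" using assms by simp
  then show "(A *\<^sub>v (of_real r \<cdot>\<^sub>v v)) $ i = (of_real r \<cdot>\<^sub>v (A *\<^sub>v v)) $ i"
    using assms by (simp add: index_mult_mat_vec_sum[where m=m] sum_distrib_left of_real_def
        scaleR_sum_right del: index_mult_mat_vec)
qed (use assms in simp)

lemma self_adjoint_rip:
  assumes A: "self_adjoint d A" and u: "u \<in> carrier_vec d" and v: "v \<in> carrier_vec d"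
  shows "rip (A *\<^sub>v u) v = rip u (A *\<^sub>v v)"
proof -
  have A': "A \<in> carrier_mat d d" using A by (simp add: self_adjoint_def)
  have "rip (A *\<^sub>v u) v = (\<Sum>i<d. \<Sum>j<d. inner (A $$ (i, j) * u $ j) (v $ i))"
    using A' u v by (simp add: rip_def index_mult_mat_vec_sum[where m=d] inner_sum_left
        del: index_mult_mat_vec)
  also have "\<dots> = (\<Sum>i<d. \<Sum>j<d. inner (u $ j) (A $$ (j, i) * v $ i))"
    using A by (intro sum.cong refl) (simp add: inner_mult_conjugate self_adjoint_def)
  also have "\<dots> = (\<Sum>j<d. \<Sum>i<d. inner (u $ j) (A $$ (j, i) * v $ i))"
    by (rule sum.swap)
  also have "\<dots> = rip u (A *\<^sub>v v)"
    using A' u v by (simp add: rip_def index_mult_mat_vec_sum[where m=d] inner_sum_right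
        del: index_mult_mat_vec)
  finally show ?thesis .
qed

lemma sym_op_mult_mat_vec:
  assumes A: "self_adjoint d A"
  shows "sym_op d ((*\<^sub>v) A)"
  using A self_adjoint_rip[OF A] unfolding sym_op_def
  by (auto simp: self_adjoint_def mult_mat_vec_smult_real intro: mult_add_distrib_mat_vec)

text \<open>Conjugation reverses each product conj(v_i) A_ij v_j and thus only swaps i and j, so the
  Hermitian form is self-conjugate, hence real. It links the scalar-valued positivity in
  \<open>pos_def_self_adjoint\<close> with positivity of \<open>rip\<close>.\<close>

lemma scalar_prod_self_adjoint:
  fixes A :: "'k::gaussian_scalar mat"
  assumes A: "self_adjoint d A" and v: "v \<in> carrier_vec d"
  shows "scalar_prod (conjugate v) (A *\<^sub>v v) = of_real (rip v (A *\<^sub>v v))"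
proof -
  have A': "A \<in> carrier_mat d d" using A by (simp add: self_adjoint_def)
  have eq: "scalar_prod (conjugate v) (A *\<^sub>v v) =
      (\<Sum>i<d. \<Sum>j<d. conjugate (v $ i) * A $$ (i, j) * v $ j)"
    using A' v by (simp add: scalar_prod_def[of "conjugate v"] atLeast0LessThan
        index_mult_mat_vec_sum[where m=d] sum_distrib_left mult.assoc del: index_mult_mat_vec)
  have c2: "conjugate (conjugate a) = a" for a :: 'k
    by (rule conjugate_id)
  have "conjugate (scalar_prod (conjugate v) (A *\<^sub>v v)) =
      (\<Sum>i<d. \<Sum>j<d. conjugate (v $ j) * A $$ (j, i) * v $ i)"
    unfolding eq conjugate_sum_scalar using A
    by (intro sum.cong refl)
       (simp add: conjugate_mult_scalar c2 self_adjoint_def mult.assoc)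
  also have "\<dots> = scalar_prod (conjugate v) (A *\<^sub>v v)"
    unfolding eq by (rule sum.swap)
  finally have "scalar_prod (conjugate v) (A *\<^sub>v v) =
      of_real (inner 1 (scalar_prod (conjugate v) (A *\<^sub>v v)))"
    by (rule self_conjugate_real)
  then show ?thesis
    using A' v inner_one_scalar_prod_conjugate[of v "A *\<^sub>v v"] by simp
qed

lemma pos_def_self_adjoint_iff:
  "pos_def_self_adjoint d A \<longleftrightarrow>
     self_adjoint d A \<and> (\<forall>v\<in>carrier_vec d. v \<noteq> 0\<^sub>v d \<longrightarrow> 0 < rip v (A *\<^sub>v v))"
  unfolding pos_def_self_adjoint_def self_adjoint_iff[symmetric] conj_assoc[symmetric]
  using scalar_prod_self_adjoint[of d A] by (auto simp: of_real_eq_iff)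

lemma mult_mat_unit_vec_index:
  fixes A :: "'k::gaussian_scalar mat"
  assumes "A \<in> carrier_mat n m" "i < n" "j < m"
  shows "(A *\<^sub>v unit_vec m j) $ i = A $$ (i, j)"
proof -
  have "(A *\<^sub>v unit_vec m j) $ i = (\<Sum>l<m. A $$ (i, l) * (if l = j then 1 else 0))"
    using assms by (subst index_mult_mat_vec_sum[of _ n m])
      (auto intro!: sum.cong simp: unit_vec_def)
  also have "\<dots> = A $$ (i, j)"
    using assms by (simp add: if_distrib cong: if_cong)
  finally show ?thesis .
qed

lemma vec_norm_unit_vec [simp]:
  "j < d \<Longrightarrow> vec_norm (unit_vec d j :: 'k::gaussian_scalar vec) = 1"
proof -
  assume "j < d"
  have "(\<Sum>i<d. (norm (unit_vec d j $ i :: 'k))\<^sup>2) = (\<Sum>i<d. if i = j then 1 else 0)"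
    by (intro sum.cong) (auto simp: unit_vec_def)
  with \<open>j < d\<close> show ?thesis by (simp add: vec_norm_def)
qed

section \<open>Extremal eigenvalues\<close>

text \<open>The unit sphere of d-vectors, modelled by functions on \<open>nat\<close> supported
  below d. It is a closed subset of a product of balls and points, which is compact by Tychonoff's
  theorem.\<close>

lemma compact_unit_sphere_fun:
  "compact {x :: nat \<Rightarrow> 'k::euclidean_space. (\<forall>i\<ge>d. x i = 0) \<and> (\<Sum>i<d. (norm (x i))\<^sup>2) = 1}"
    (is "compact ?S")
proof -
  define C :: "(nat \<Rightarrow> 'k) set" where "C = PiE UNIV (\<lambda>i. if i < d then cball 0 1 else {0})"
  have "compactin (product_topology (\<lambda>_. euclidean) UNIV) C"
    unfolding C_def compactin_PiE by auto
  then have "compact C" by (simp add: euclidean_product_topology)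
  moreover have "closed {x :: nat \<Rightarrow> 'k. (\<Sum>i<d. (norm (x i))\<^sup>2) = 1}"
    by (intro closed_Collect_eq continuous_intros continuous_on_product_coordinates)
  ultimately have "compact (C \<inter> {x. (\<Sum>i<d. (norm (x i))\<^sup>2) = 1})"
    by (rule compact_Int_closed)
  also have "C \<inter> {x. (\<Sum>i<d. (norm (x i))\<^sup>2) = 1} = ?S"
  proof (intro equalityI subsetI)
    fix x assume x: "x \<in> ?S"
    have "norm (x i) \<le> 1" if "i < d" for i
    proof -
      have "(norm (x i))\<^sup>2 \<le> (\<Sum>i<d. (norm (x i))\<^sup>2)"
        using that by (intro member_le_sum) auto
      with x show ?thesis by (simp add: power_le_one_iff abs_square_le_1)
    qed
    with x show "x \<in> C \<inter> {x. (\<Sum>i<d. (norm (x i))\<^sup>2) = 1}"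
      by (auto simp: C_def)
  next
    fix x assume x: "x \<in> C \<inter> {x. (\<Sum>i<d. (norm (x i))\<^sup>2) = 1}"
    have "x i = 0" if "i \<ge> d" for i
    proof -
      have "x i \<in> (if i < d then cball 0 1 else {0})"
        using x unfolding C_def by (intro PiE_mem[of x UNIV]) auto
      with that show ?thesis by simp
    qed
    with x show "x \<in> ?S" by auto
  qed
  finally show ?thesis .
qed

text \<open>Let t be the maximum of the form on the sphere, attained at v. Then t - A is positive
  semidefinite and its form vanishes at v, so v lies in its kernel by \<open>psd_kernel\<close>.
  This replaces both differentiation of the Rayleigh quotient and the characteristic
  polynomial.\<close>

lemma exists_max_eigenvalue:
  fixes A :: "'k::gaussian_scalar mat"
  assumes A: "self_adjoint d A" and d: "d \<ge> 1"
  obtains t v where "v \<in> carrier_vec d" "v \<noteq> 0\<^sub>v d" "A *\<^sub>v v = of_real t \<cdot>\<^sub>v v"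
    "\<And>u. u \<in> carrier_vec d \<Longrightarrow> rip u (A *\<^sub>v u) \<le> t * (vec_norm u)\<^sup>2"
proof -
  have A': "A \<in> carrier_mat d d" using A by (simp add: self_adjoint_def)
  let ?S = "{x :: nat \<Rightarrow> 'k. (\<forall>i\<ge>d. x i = 0) \<and> (\<Sum>i<d. (norm (x i))\<^sup>2) = 1}"
  let ?F = "\<lambda>x :: nat \<Rightarrow> 'k. \<Sum>i<d. inner (x i) (\<Sum>j<d. A $$ (i, j) * x j)"
  have ne: "(\<lambda>i. if i = 0 then 1 else 0) \<in> ?S"
    using d by (auto simp: if_distrib if_distribR cong: if_cong)
  obtain x where x: "x \<in> ?S" and max: "\<And>y. y \<in> ?S \<Longrightarrow> ?F y \<le> ?F x"
  proof -
    have "continuous_on UNIV ?F"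
      by (intro continuous_on_sum continuous_on_inner continuous_on_mult continuous_on_const
          continuous_on_product_coordinates)
    then have cont: "continuous_on ?S ?F"
      by (rule continuous_on_subset) simp
    have "?S \<noteq> {}" by (rule ex_in_conv[THEN iffD1]) (rule exI, rule ne)
    from continuous_attains_sup[OF compact_unit_sphere_fun this cont]
    show thesis by (elim bexE) (rule that, assumption, erule (1) bspec)
  qed
  have F: "?F y = rip (vec d y) (A *\<^sub>v vec d y)" for y
    using A' by (simp add: rip_def index_mult_mat_vec_sum[where m=d] del: index_mult_mat_vec)
  define v where "v = vec d x"
  define t where "t = ?F x"
  have v: "v \<in> carrier_vec d" and vn: "vec_norm v = 1"
    using x by (auto simp: v_def vec_norm_def)
  have le: "rip u (A *\<^sub>v u) \<le> t * (vec_norm u)\<^sup>2" if u: "u \<in> carrier_vec d" for u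
  proof (cases "vec_norm u = 0")
    case True
    then have "u = 0\<^sub>v d" using u by (simp add: vec_norm_eq_0_iff)
    then show ?thesis using True by (simp add: rip_def)
  next
    case False
    define r where "r = inverse (vec_norm u)"
    define w where "w = of_real r \<cdot>\<^sub>v u"
    have w: "w \<in> carrier_vec d" "vec_norm w = 1"
      unfolding w_def vec_norm_smult using u False by (auto simp: r_def)
    define y where "y = (\<lambda>i. if i < d then w $ i else 0)"
    have y: "vec d y = w" using w by (auto simp: y_def)
    have "(\<Sum>i<d. (norm (y i))\<^sup>2) = (vec_norm w)\<^sup>2"
      using w(1) by (simp add: vec_norm_def sum_nonneg y_def)
    then have "y \<in> ?S" using w by (auto simp: y_def)
    from max[OF this] have "rip w (A *\<^sub>v w) \<le> t"
      unfolding F y t_def .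
    moreover have "rip w (A *\<^sub>v w) = r\<^sup>2 * rip u (A *\<^sub>v u)"
      using u A' by (simp add: w_def mult_mat_vec_smult_real[where n=d and m=d] rip_simps[where n=d]
          power2_eq_square)
    ultimately show ?thesis using False
      by (simp add: r_def field_simps)
  qed
  define f where "f u = of_real t \<cdot>\<^sub>v u + of_real (-1) \<cdot>\<^sub>v (A *\<^sub>v u)" for u
  have f: "sym_op d f"
    unfolding sym_op_def f_def using A' self_adjoint_rip[OF A]
    by (auto simp: mult_mat_vec_smult_real rip_simps[where n=d] mult_add_distrib_mat_vec
        smult_add_distrib_vec distrib_left smult_smult_assoc of_real_mult[symmetric] mult.commute
        simp del: of_real_mult of_real_minus of_real_1
        intro!: eq_vecI)
  have fv: "rip u (f u) = t * (vec_norm u)\<^sup>2 - rip u (A *\<^sub>v u)" if "u \<in> carrier_vec d" for u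
    unfolding f_def using that A' by (simp add: rip_simps[where n=d] rip_self del: of_real_minus of_real_1)
  have "f v = 0\<^sub>v d"
  proof (rule psd_kernel[OF f _ v])
    show "rip v (f v) = 0" using fv[OF v] vn F[of x] by (simp add: t_def v_def)
    show "0 \<le> rip u (f u)" if "u \<in> carrier_vec d" for u using le[OF that] fv[OF that] by simp
  qed
  then have "(A *\<^sub>v v) $ i = (of_real t \<cdot>\<^sub>v v) $ i" if "i < d" for i
  proof -
    have "f v $ i = 0" using \<open>f v = 0\<^sub>v d\<close> that by simp
    then show ?thesis using that v A' unfolding f_def by (simp del: index_mult_mat_vec)
  qed
  then have ev: "A *\<^sub>v v = of_real t \<cdot>\<^sub>v v"
    using v A' by (intro eq_vecI) (auto simp del: index_mult_mat_vec)
  have "v \<noteq> 0\<^sub>v d" using vn by (auto simp: vec_norm_def)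
  from that[OF v this ev le] show thesis .
qed

text \<open>If t were not listed, its eigenspace would have dimension 0, that is, be in bijection
  with the one-element \<open>carrier_vec 0\<close>; but it contains both 0 and v.\<close>

lemma eigenvalues_are_memI:
  assumes ev: "eigenvalues_are d A \<theta>" and v: "v \<in> carrier_vec d" "v \<noteq> 0\<^sub>v d"
    and A: "A \<in> carrier_mat d d" and t: "A *\<^sub>v v = of_real t \<cdot>\<^sub>v v"
  obtains i where "i \<in> {1..d}" "\<theta> i = t"
proof (rule ccontr)
  assume "\<not> thesis"
  with that have "{i\<in>{1..d}. \<theta> i = t} = {}" by auto
  with ev have "has_dimension d (eigenspace d A t) 0"
    unfolding eigenvalues_are_def by (metis card.empty)
  then obtain B :: "'a mat" where B: "bij_betw (\<lambda>c. B *\<^sub>v c) (carrier_vec 0) (eigenspace d A t)"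
    unfolding has_dimension_def by blast
  have "carrier_vec 0 = {0\<^sub>v 0 :: 'a vec}" by auto
  then have "card (eigenspace d A t) = 1"
    using bij_betw_same_card[OF B] by simp
  moreover have "v \<in> eigenspace d A t" using v t by (simp add: eigenspace_def)
  moreover have "0\<^sub>v d \<in> eigenspace d A t"
    using A by (auto simp: eigenspace_def intro!: eq_vecI)
  ultimately show False using v(2) by (metis card_1_singletonE singletonD)
qed

text \<open>The maximum of the form is an eigenvalue and hence occurs in the list; the minimum is
  treated as the maximum for -A.\<close>

lemma eigenvalue_form_bounds:
  fixes A :: "'k::gaussian_scalar mat"
  assumes A: "self_adjoint d A" and d: "d \<ge> 1" and ev: "eigenvalues_are d A \<theta>"
    and \<theta>: "\<And>i. i \<in> {1..d} \<Longrightarrow> a \<le> \<theta> i \<and> \<theta> i \<le> b" and u: "u \<in> carrier_vec d"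
  shows "a * (vec_norm u)\<^sup>2 \<le> rip u (A *\<^sub>v u)" "rip u (A *\<^sub>v u) \<le> b * (vec_norm u)\<^sup>2"
proof -
  have A': "A \<in> carrier_mat d d" using A by (simp add: self_adjoint_def)
  show "rip u (A *\<^sub>v u) \<le> b * (vec_norm u)\<^sup>2"
  proof (rule exists_max_eigenvalue[OF A d])
    fix t v assume v: "v \<in> carrier_vec d" "v \<noteq> 0\<^sub>v d" "A *\<^sub>v v = of_real t \<cdot>\<^sub>v v"
      and le: "\<And>u. u \<in> carrier_vec d \<Longrightarrow> rip u (A *\<^sub>v u) \<le> t * (vec_norm u)\<^sup>2"
    obtain i where "i \<in> {1..d}" "\<theta> i = t" using eigenvalues_are_memI[OF ev v(1,2) A' v(3)] .
    with \<theta> have "t \<le> b" by auto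
    with le[OF u] show ?thesis by (meson mult_right_mono order_trans zero_le_power2)
  qed
  have neg: "(- A) *\<^sub>v w = of_real (-1) \<cdot>\<^sub>v (A *\<^sub>v w)" if "w \<in> carrier_vec d" for w
    using A' that by (intro eq_vecI)
      (auto simp: index_mult_mat_vec_sum[where m=d and n=d] sum_negf simp del: index_mult_mat_vec)
  have "conjugate (- x) = - conjugate x" for x :: 'k
    using conjugate_scaleR[of "-1" x] by simp
  then have nA: "self_adjoint d (- A)"
    using A carrier_matD[OF A'] by (simp add: self_adjoint_def)
  show "a * (vec_norm u)\<^sup>2 \<le> rip u (A *\<^sub>v u)"
  proof (rule exists_max_eigenvalue[OF nA d])
    fix t v assume v: "v \<in> carrier_vec d" "v \<noteq> 0\<^sub>v d" "(- A) *\<^sub>v v = of_real t \<cdot>\<^sub>v v"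
      and le: "\<And>u. u \<in> carrier_vec d \<Longrightarrow> rip u ((- A) *\<^sub>v u) \<le> t * (vec_norm u)\<^sup>2"
    have "of_real (-1) \<cdot>\<^sub>v (of_real (-1) \<cdot>\<^sub>v (A *\<^sub>v v)) = of_real (-1) \<cdot>\<^sub>v (of_real t \<cdot>\<^sub>v v)"
      using v(3) neg[OF v(1)] by simp
    then have "A *\<^sub>v v = of_real (- t) \<cdot>\<^sub>v v"
      by (simp add: smult_smult_assoc)
    then obtain i where "i \<in> {1..d}" "\<theta> i = - t" using eigenvalues_are_memI[OF ev v(1,2) A'] by blast
    with \<theta>[of i] have "a \<le> - t" by linarith
    moreover have "rip u ((- A) *\<^sub>v u) = - rip u (A *\<^sub>v u)"
      unfolding neg[OF u] using u A' by (subst rip_smult_right[of _ d]) auto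
    then have "- t * (vec_norm u)\<^sup>2 \<le> rip u (A *\<^sub>v u)"
      using le[OF u] by simp
    ultimately show ?thesis by (meson mult_right_mono order_trans zero_le_power2)
  qed
qed

section \<open>The positive square root\<close>

text \<open>The Taylor coefficients of \<open>sqrt (1 - x)\<close>.\<close>

definition sqrt_coeff :: "nat \<Rightarrow> real" where
  "sqrt_coeff n = (-1) ^ n * ((1/2) gchoose n)"

lemma sqrt_coeff_0 [simp]: "sqrt_coeff 0 = 1"
  by (simp add: sqrt_coeff_def)

lemma sqrt_coeff_Suc: "sqrt_coeff (Suc n) = (real n - 1/2) / (real n + 1) * sqrt_coeff n"
proof -
  have "(real n + 1) * ((1/2::real) gchoose (Suc n)) = (1/2 - real n) * ((1/2) gchoose n)"
    using gbinomial_mult_1[of "1/2::real" n] by (simp add: algebra_simps)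
  then have "((1/2::real) gchoose (Suc n)) = (1/2 - real n) * ((1/2) gchoose n) / (real n + 1)"
    by (simp add: field_simps)
  then show ?thesis by (simp add: sqrt_coeff_def) (simp add: field_simps)
qed

lemma abs_sqrt_coeff_le: "\<bar>sqrt_coeff n\<bar> \<le> 1"
proof (induction n)
  case (Suc n)
  have "\<bar>(real n - 1/2) / (real n + 1)\<bar> \<le> 1" by (simp add: abs_if field_simps)
  then show ?case unfolding sqrt_coeff_Suc abs_mult by (rule mult_le_one) (use Suc in auto)
qed simp

text \<open>The sign is what makes the square root series positive definite: upper bounds on the
  powers of B turn into lower bounds on the terms, see \<open>pos_def_R\<close>.\<close>

lemma sqrt_coeff_nonpos: "sqrt_coeff (Suc n) \<le> 0"
proof (induction n)
  case (Suc n)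
  then show ?case unfolding sqrt_coeff_Suc[of "Suc n"] by (intro mult_nonneg_nonpos) auto
qed (simp add: sqrt_coeff_Suc)

text \<open>The coefficient form of (sqrt (1 - x))^2 = 1 - x: Vandermonde's identity with 1/2 + 1/2
  = 1 gives (-1)^n times 1 choose n.\<close>

lemma sqrt_coeff_convolution:
  "(\<Sum>i\<le>n. sqrt_coeff i * sqrt_coeff (n - i)) = (if n = 0 then 1 else if n = 1 then -1 else 0)"
proof -
  have "(\<Sum>i\<le>n. sqrt_coeff i * sqrt_coeff (n - i)) =
      (\<Sum>i\<in>{0..n}. (-1) ^ n * (((1/2) gchoose i) * ((1/2) gchoose (n - i))))"
    by (intro sum.cong) (auto simp: sqrt_coeff_def mult_ac simp flip: power_add)
  also have "\<dots> = (-1) ^ n * (1 gchoose n)"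
    unfolding sum_distrib_left[symmetric] gbinomial_Vandermonde by simp
  also have "(1 gchoose n) = real (1 choose n)"
    by (simp add: binomial_gbinomial)
  also have "(-1) ^ n * real (1 choose n) = (if n = 0 then 1 else if n = 1 then -1 else 0)"
    by (cases n rule: nat.exhaust; cases "n - 1") auto
  finally show ?thesis .
qed

lemma sqrt_coeff_sums:
  assumes "\<bar>r\<bar> < 1"
  shows "(\<lambda>n. sqrt_coeff n * r ^ n) sums ((1 - r) powr (1/2))"
  using gen_binomial_real[of "-r" "1/2"] assms
  by (simp add: sqrt_coeff_def power_minus[of r] mult_ac)

lemma commute_pow_mat:
  fixes A C :: "'k::gaussian_scalar mat"
  assumes A: "A \<in> carrier_mat d d" and C: "C \<in> carrier_mat d d" and comm: "C * A = A * C"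
  shows "C * A ^\<^sub>m n = A ^\<^sub>m n * C"
proof (induction n)
  case (Suc n)
  have P: "A ^\<^sub>m n \<in> carrier_mat d d" using A by simp
  have "C * (A ^\<^sub>m n * A) = C * A ^\<^sub>m n * A"
    using A C P by (simp add: assoc_mult_mat[of C d d "A ^\<^sub>m n" d A d])
  also have "\<dots> = A ^\<^sub>m n * (C * A)"
    using A C P by (simp add: Suc.IH assoc_mult_mat[of "A ^\<^sub>m n" d d C d A d])
  also have "\<dots> = A ^\<^sub>m n * A * C"
    using A C P by (simp add: comm assoc_mult_mat[of "A ^\<^sub>m n" d d A d C d])
  finally show ?case by simp
qed (use A C in simp)

lemma pow_mat_add:
  fixes A :: "'k::gaussian_scalar mat"
  assumes A: "A \<in> carrier_mat d d"
  shows "A ^\<^sub>m m * A ^\<^sub>m n = A ^\<^sub>m (m + n)"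
proof (induction n)
  case 0
  then show ?case using A pow_carrier_mat[OF A, of m] by (simp del: pow_carrier_mat)
next
  case (Suc n)
  have "A ^\<^sub>m m * (A ^\<^sub>m n * A) = A ^\<^sub>m m * A ^\<^sub>m n * A"
    using A by (simp add: assoc_mult_mat[of "A ^\<^sub>m m" d d "A ^\<^sub>m n" d A d])
  then show ?case by (simp add: Suc.IH)
qed

lemma self_adjoint_pow_mat:
  assumes A: "self_adjoint d A"
  shows "self_adjoint d (A ^\<^sub>m n)"
proof (induction n)
  case 0
  have "conjugate (1 :: 'a) = 1" using conjugate_of_real[of 1, where 'k='a] by simp
  then show ?case using A by (auto simp: self_adjoint_def)
next
  case (Suc n)
  have A': "A \<in> carrier_mat d d" using A by (simp add: self_adjoint_def)
  then have P: "A ^\<^sub>m n \<in> carrier_mat d d" by simp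
  have "conjugate ((A ^\<^sub>m n * A) $$ (i, j)) = (A ^\<^sub>m n * A) $$ (j, i)" if "i < d" "j < d" for i j
  proof -
    have "conjugate ((A ^\<^sub>m n * A) $$ (i, j)) = (\<Sum>l<d. A $$ (j, l) * (A ^\<^sub>m n) $$ (l, i))"
      unfolding index_mult_mat_sum[OF P A' that] conjugate_sum_scalar conjugate_mult_scalar
      using A Suc that by (intro sum.cong) (auto simp: self_adjoint_def)
    also have "\<dots> = (A * A ^\<^sub>m n) $$ (j, i)"
      using index_mult_mat_sum[OF A' P] that by simp
    also have "A * A ^\<^sub>m n = A ^\<^sub>m n * A"
      by (rule commute_pow_mat[OF A' A']) simp
    finally show ?thesis .
  qed
  moreover have "A ^\<^sub>m n * A \<in> carrier_mat d d" using mult_carrier_mat[OF P A'] .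
  ultimately show ?case unfolding self_adjoint_def by simp
qed

lemma rip_cauchy_schwarz:
  assumes "u \<in> carrier_vec d" "v \<in> carrier_vec d"
  shows "\<bar>rip u v\<bar> \<le> vec_norm u * vec_norm v"
proof -
  have "sym_op d (\<lambda>x. x)" by (auto simp: sym_op_def)
  from psd_cauchy_schwarz[OF this _ assms] have "(rip u v)\<^sup>2 \<le> (vec_norm u * vec_norm v)\<^sup>2"
    by (simp add: rip_self power_mult_distrib)
  then show ?thesis by (simp add: abs_le_square_iff[symmetric] abs_mult)
qed

text \<open>The situation of B = 1 - A/c after scaling a positive definite A by an upper bound c of
  its form. Since r < 1, the series for the square root of 1 - B converges geometrically in each
  entry.\<close>

locale psd_contraction =
  fixes d :: nat and B :: "'k::gaussian_scalar mat" and r :: real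
  assumes sa: "self_adjoint d B" and r: "0 \<le> r" "r < 1"
    and lower: "\<And>v. v \<in> carrier_vec d \<Longrightarrow> 0 \<le> rip v (B *\<^sub>v v)"
    and upper: "\<And>v. v \<in> carrier_vec d \<Longrightarrow> rip v (B *\<^sub>v v) \<le> r * (vec_norm v)\<^sup>2"
begin

lemma B: "B \<in> carrier_mat d d"
  using sa by (simp add: self_adjoint_def)

lemma P: "B ^\<^sub>m n \<in> carrier_mat d d"
  using B by simp

lemma vec_norm_pow_le: "v \<in> carrier_vec d \<Longrightarrow> vec_norm (B ^\<^sub>m n *\<^sub>v v) \<le> r ^ n * vec_norm v"
proof (induction n arbitrary: v)
  case (Suc n)
  have Bv: "B *\<^sub>v v \<in> carrier_vec d" using B Suc.prems by simp
  have "vec_norm (B ^\<^sub>m Suc n *\<^sub>v v) = vec_norm (B ^\<^sub>m n *\<^sub>v (B *\<^sub>v v))"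
    using assoc_mult_mat_vec[OF P B Suc.prems] by simp
  also have "\<dots> \<le> r ^ n * (r * vec_norm v)"
    using Suc.IH[OF Bv] psd_vec_norm_le[OF sym_op_mult_mat_vec[OF sa] lower upper r(1) Suc.prems]
    by (meson r(1) mult_left_mono order_trans zero_le_power)
  finally show ?case by (simp add: mult_ac)
qed (use B in simp)

lemma norm_pow_index_le:
  assumes "i < d" "j < d"
  shows "norm ((B ^\<^sub>m n) $$ (i, j)) \<le> r ^ n"
proof -
  have "norm ((B ^\<^sub>m n) $$ (i, j)) \<le> vec_norm (B ^\<^sub>m n *\<^sub>v unit_vec d j)"
    using norm_index_le_vec_norm[of i "B ^\<^sub>m n *\<^sub>v unit_vec d j"] carrier_matD[OF P[of n]] assms
    by (simp add: mult_mat_unit_vec_index[OF P] del: index_mult_mat_vec pow_mat_dim)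
  also have "\<dots> \<le> r ^ n" using vec_norm_pow_le[of "unit_vec d j" n] assms by simp
  finally show ?thesis .
qed

lemma summable_coeff: "summable (\<lambda>n. norm (sqrt_coeff n *\<^sub>R (B ^\<^sub>m n) $$ (i, j)))" if "i < d" "j < d"
proof (rule summable_comparison_test_ev[OF always_eventually])
  show "\<forall>n. norm (norm (sqrt_coeff n *\<^sub>R (B ^\<^sub>m n) $$ (i, j))) \<le> r ^ n"
    using mult_mono[OF abs_sqrt_coeff_le norm_pow_index_le[OF that]] by simp
  show "summable (\<lambda>n. r ^ n)" using r by (simp add: summable_geometric)
qed

text \<open>The binomial series of the square root of 1 - B. It is summed entry by entry, in the
  normed scalars, so that no topology on matrices has to be introduced.\<close>

definition R :: "'k mat" where
  "R = mat d d (\<lambda>(i, j). \<Sum>n. sqrt_coeff n *\<^sub>R (B ^\<^sub>m n) $$ (i, j))"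

lemma R: "R \<in> carrier_mat d d"
  by (simp add: R_def)

lemma R_sums:
  assumes "i < d" "j < d"
  shows "(\<lambda>n. sqrt_coeff n *\<^sub>R (B ^\<^sub>m n) $$ (i, j)) sums R $$ (i, j)"
  using assms summable_norm_cancel[OF summable_coeff[OF assms]] by (simp add: R_def summable_sums)

lemma self_adjoint_R: "self_adjoint d R"
proof -
  have "conjugate (R $$ (i, j)) = R $$ (j, i)" if "i < d" "j < d" for i j
  proof -
    have "(\<lambda>n. conjugate (sqrt_coeff n *\<^sub>R (B ^\<^sub>m n) $$ (i, j))) sums conjugate (R $$ (i, j))"
      by (rule bounded_linear.sums[OF bounded_linear_conjugate R_sums[OF that]])
    moreover have "conjugate (sqrt_coeff n *\<^sub>R (B ^\<^sub>m n) $$ (i, j)) =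
        sqrt_coeff n *\<^sub>R (B ^\<^sub>m n) $$ (j, i)" for n
      using self_adjoint_pow_mat[OF sa, of n] that by (simp add: conjugate_scaleR self_adjoint_def)
    ultimately show ?thesis
      using R_sums[OF that(2,1)] by (simp add: sums_unique2)
  qed
  then show ?thesis using R by (simp add: self_adjoint_def)
qed

lemma R_mult_sums:
  assumes v: "v \<in> carrier_vec d"
  shows "(\<lambda>n. sqrt_coeff n * rip v (B ^\<^sub>m n *\<^sub>v v)) sums rip v (R *\<^sub>v v)"
proof -
  have *: "rip v (A *\<^sub>v v) = (\<Sum>i<d. inner (v $ i) (\<Sum>j<d. A $$ (i, j) * v $ j))"
    if "A \<in> carrier_mat d d" for A
    using that v by (simp add: rip_def index_mult_mat_vec_sum[where m=d] del: index_mult_mat_vec)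
  have "(\<lambda>n. \<Sum>i<d. inner (v $ i) (\<Sum>j<d. (sqrt_coeff n *\<^sub>R (B ^\<^sub>m n) $$ (i, j)) * v $ j))
     sums (\<Sum>i<d. inner (v $ i) (\<Sum>j<d. R $$ (i, j) * v $ j))"
    by (intro sums_sum bounded_linear.sums[OF bounded_linear_inner_right]
        bounded_linear.sums[OF bounded_linear_mult_left] R_sums) auto
  then show ?thesis
    unfolding *[OF P] *[OF R]
    by (simp add: sum_distrib_left scaleR_sum_right[symmetric] flip: inner_scaleR_right)
qed

text \<open>An entrywise Cauchy product: B^m B^(n-m) = B^n comes out of the inner sum, and the
  coefficient convolution leaves only the terms n = 0 and n = 1.\<close>

lemma R_square: "R * R = 1\<^sub>m d - B"
proof (rule eq_matI)
  fix i j assume "i < dim_row (1\<^sub>m d - B)" "j < dim_col (1\<^sub>m d - B)"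
  then have ij: "i < d" "j < d" using B by auto
  have "(\<lambda>n. \<Sum>l<d. \<Sum>m\<le>n. (sqrt_coeff m *\<^sub>R (B ^\<^sub>m m) $$ (i, l)) *
      (sqrt_coeff (n - m) *\<^sub>R (B ^\<^sub>m (n - m)) $$ (l, j))) sums (\<Sum>l<d. R $$ (i, l) * R $$ (l, j))"
  proof (rule sums_sum)
    fix l assume "l \<in> {..<d}"
    then have l: "l < d" by simp
    show "(\<lambda>n. \<Sum>m\<le>n. (sqrt_coeff m *\<^sub>R (B ^\<^sub>m m) $$ (i, l)) *
      (sqrt_coeff (n - m) *\<^sub>R (B ^\<^sub>m (n - m)) $$ (l, j))) sums (R $$ (i, l) * R $$ (l, j))"
      using Cauchy_product_sums[OF summable_coeff[OF ij(1) l] summable_coeff[OF l ij(2)]]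
        R_sums[OF ij(1) l] R_sums[OF l ij(2)] by (simp only: sums_iff)
  qed
  also have "(\<lambda>n. \<Sum>l<d. \<Sum>m\<le>n. (sqrt_coeff m *\<^sub>R (B ^\<^sub>m m) $$ (i, l)) *
      (sqrt_coeff (n - m) *\<^sub>R (B ^\<^sub>m (n - m)) $$ (l, j))) =
      (\<lambda>n. (if n = 0 then 1 else if n = 1 then -1 else 0) *\<^sub>R (B ^\<^sub>m n) $$ (i, j))"
  proof
    fix n
    have "(\<Sum>l<d. \<Sum>m\<le>n. (sqrt_coeff m *\<^sub>R (B ^\<^sub>m m) $$ (i, l)) *
      (sqrt_coeff (n - m) *\<^sub>R (B ^\<^sub>m (n - m)) $$ (l, j))) =
      (\<Sum>m\<le>n. (sqrt_coeff m * sqrt_coeff (n - m)) *\<^sub>R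
        (\<Sum>l<d. (B ^\<^sub>m m) $$ (i, l) * (B ^\<^sub>m (n - m)) $$ (l, j)))"
      by (subst sum.swap) (simp add: scaleR_sum_right mult.commute)
    also have "\<dots> = (\<Sum>m\<le>n. (sqrt_coeff m * sqrt_coeff (n - m)) *\<^sub>R (B ^\<^sub>m n) $$ (i, j))"
    proof (intro sum.cong refl)
      fix m assume "m \<in> {..n}"
      then have "B ^\<^sub>m m * B ^\<^sub>m (n - m) = B ^\<^sub>m n" by (simp add: pow_mat_add[OF B])
      then show "(sqrt_coeff m * sqrt_coeff (n - m)) *\<^sub>R
        (\<Sum>l<d. (B ^\<^sub>m m) $$ (i, l) * (B ^\<^sub>m (n - m)) $$ (l, j)) =
        (sqrt_coeff m * sqrt_coeff (n - m)) *\<^sub>R (B ^\<^sub>m n) $$ (i, j)"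
        using index_mult_mat_sum[OF P P ij, of m "n - m"] by simp
    qed
    also have "\<dots> = (if n = 0 then 1 else if n = 1 then -1 else 0) *\<^sub>R (B ^\<^sub>m n) $$ (i, j)"
      unfolding scaleR_sum_left[symmetric] sqrt_coeff_convolution ..
    finally show "(\<Sum>l<d. \<Sum>m\<le>n. (sqrt_coeff m *\<^sub>R (B ^\<^sub>m m) $$ (i, l)) *
      (sqrt_coeff (n - m) *\<^sub>R (B ^\<^sub>m (n - m)) $$ (l, j))) =
      (if n = 0 then 1 else if n = 1 then -1 else 0) *\<^sub>R (B ^\<^sub>m n) $$ (i, j)" .
  qed
  finally have "(\<lambda>n. (if n = 0 then 1 else if n = 1 then -1 else 0) *\<^sub>R (B ^\<^sub>m n) $$ (i, j))
      sums ((R * R) $$ (i, j))"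
    unfolding index_mult_mat_sum[OF R R ij] .
  moreover have "(\<lambda>n. (if n = 0 then 1 else if n = 1 then -1 else 0) *\<^sub>R (B ^\<^sub>m n) $$ (i, j))
      sums (\<Sum>n\<in>{0,1::nat}. (if n = 0 then 1 else if n = 1 then -1 else 0) *\<^sub>R (B ^\<^sub>m n) $$ (i, j))"
    by (rule sums_finite) auto
  ultimately have "(R * R) $$ (i, j) =
      (\<Sum>n\<in>{0,1::nat}. (if n = 0 then 1 else if n = 1 then -1 else 0) *\<^sub>R (B ^\<^sub>m n) $$ (i, j))"
    by (rule sums_unique2)
  then show "(R * R) $$ (i, j) = (1\<^sub>m d - B) $$ (i, j)"
    using ij B left_mult_one_mat[OF B] by simp
qed (use B in \<open>auto simp: R_def\<close>)

text \<open>Commutation with B passes to its powers and to the limit. It is the ingredient for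
  uniqueness of the positive square root.\<close>

lemma R_commute:
  assumes C: "C \<in> carrier_mat d d" and comm: "C * B = B * C"
  shows "C * R = R * C"
proof (rule eq_matI)
  fix i j assume "i < dim_row (R * C)" "j < dim_col (R * C)"
  then have ij: "i < d" "j < d" using R C by auto
  have "(\<lambda>n. \<Sum>l<d. C $$ (i, l) * (sqrt_coeff n *\<^sub>R (B ^\<^sub>m n) $$ (l, j))) sums ((C * R) $$ (i, j))"
    unfolding index_mult_mat_sum[OF C R ij]
    by (intro sums_sum bounded_linear.sums[OF bounded_linear_mult_right] R_sums ij) auto
  moreover have "(\<lambda>n. \<Sum>l<d. (sqrt_coeff n *\<^sub>R (B ^\<^sub>m n) $$ (i, l)) * C $$ (l, j)) sums ((R * C) $$ (i, j))"
    unfolding index_mult_mat_sum[OF R C ij]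
    by (intro sums_sum bounded_linear.sums[OF bounded_linear_mult_left] R_sums ij) auto
  moreover have "(\<Sum>l<d. C $$ (i, l) * (sqrt_coeff n *\<^sub>R (B ^\<^sub>m n) $$ (l, j))) =
      (\<Sum>l<d. (sqrt_coeff n *\<^sub>R (B ^\<^sub>m n) $$ (i, l)) * C $$ (l, j))" for n
    using commute_pow_mat[OF B C comm, of n] index_mult_mat_sum[OF C P ij, of n]
      index_mult_mat_sum[OF P C ij, of n] by (simp add: scaleR_sum_right[symmetric])
  ultimately show "(C * R) $$ (i, j) = (R * C) $$ (i, j)"
    using sums_unique2 by simp
qed (use R C in auto)

text \<open>The term n = 0 is exactly |v|^2, and all later coefficients are nonpositive, so
  replacing the form of B^n by its upper bound r^n |v|^2 only decreases the sum. The result is the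
  lower bound sqrt (1 - r) |v|^2.\<close>

lemma pos_def_R: "pos_def_self_adjoint d R"
  unfolding pos_def_self_adjoint_iff
proof (intro conjI ballI impI self_adjoint_R)
  fix v :: "'k vec" assume v: "v \<in> carrier_vec d" "v \<noteq> 0\<^sub>v d"
  have pos: "vec_norm v > 0" using v vec_norm_nonneg[of v] vec_norm_eq_0_iff[of v]
    by (metis carrier_vecD less_eq_real_def)
  have le: "rip v (B ^\<^sub>m n *\<^sub>v v) \<le> r ^ n * (vec_norm v)\<^sup>2" for n
  proof -
    have "rip v (B ^\<^sub>m n *\<^sub>v v) \<le> vec_norm v * vec_norm (B ^\<^sub>m n *\<^sub>v v)"
      using rip_cauchy_schwarz[of v d "B ^\<^sub>m n *\<^sub>v v"] v P[of n] by (simp del: pow_carrier_mat)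
    also have "\<dots> \<le> vec_norm v * (r ^ n * vec_norm v)"
      by (intro mult_left_mono vec_norm_pow_le v) simp
    finally show ?thesis by (simp add: power2_eq_square mult_ac)
  qed
  have "(1 - r) powr (1/2) * (vec_norm v)\<^sup>2 \<le> rip v (R *\<^sub>v v)"
  proof (rule sums_le)
    show "(\<lambda>n. sqrt_coeff n * r ^ n * (vec_norm v)\<^sup>2) sums ((1 - r) powr (1/2) * (vec_norm v)\<^sup>2)"
      using r by (intro sums_mult2 sqrt_coeff_sums) auto
    show "(\<lambda>n. sqrt_coeff n * rip v (B ^\<^sub>m n *\<^sub>v v)) sums rip v (R *\<^sub>v v)"
      by (rule R_mult_sums[OF v(1)])
    show "sqrt_coeff n * r ^ n * (vec_norm v)\<^sup>2 \<le> sqrt_coeff n * rip v (B ^\<^sub>m n *\<^sub>v v)" for n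
    proof (cases n)
      case 0
      then show ?thesis using v B by (simp add: rip_self)
    next
      case (Suc m)
      then show ?thesis
        using mult_left_mono_neg[OF le[of n] sqrt_coeff_nonpos[of m]] by (simp only: mult_ac)
    qed
  qed
  moreover have "0 < (1 - r) powr (1/2) * (vec_norm v)\<^sup>2" using r pos by simp
  ultimately show "0 < rip v (R *\<^sub>v v)" by linarith
qed

end

text \<open>Existence: A = c (1 - B), so sqrt c times the series R is a root. Uniqueness: another
  positive definite root S' commutes with A = S'^2, hence with B, R and S. Then (S' + S)(S' - S) =
  0, where S' + S is positive definite. Both halves are needed to unfold the description
  \<open>mat_sqrt\<close>.\<close>

lemma pos_def_mat_sqrt:
  fixes A :: "'k::gaussian_scalar mat"
  assumes A: "pos_def_self_adjoint d A" and m: "0 < m" "m \<le> c"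
    and lower: "\<And>v. v \<in> carrier_vec d \<Longrightarrow> m * (vec_norm v)\<^sup>2 \<le> rip v (A *\<^sub>v v)"
    and upper: "\<And>v. v \<in> carrier_vec d \<Longrightarrow> rip v (A *\<^sub>v v) \<le> c * (vec_norm v)\<^sup>2"
  shows "pos_def_self_adjoint d (mat_sqrt d A) \<and> mat_sqrt d A * mat_sqrt d A = A"
proof -
  have sa: "self_adjoint d A" and A': "A \<in> carrier_mat d d"
    using A by (auto simp: pos_def_self_adjoint_iff self_adjoint_def)
  have c: "c > 0" using m by simp
  \<comment> \<open>This is B = 1 - A/c; the bounds m and c on the form of A become the bounds 0 and
    1 - m/c on the form of B.\<close>
  define B where "B = mat d d (\<lambda>(i, j). (if i = j then 1 else 0) - inverse c *\<^sub>R A $$ (i, j))"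
  have B: "B \<in> carrier_mat d d" by (simp add: B_def)
  have Bv: "B *\<^sub>v v = v + of_real (- inverse c) \<cdot>\<^sub>v (A *\<^sub>v v)" if v: "v \<in> carrier_vec d" for v
  proof (rule eq_vecI)
    fix i assume "i < dim_vec (v + of_real (- inverse c) \<cdot>\<^sub>v (A *\<^sub>v v))"
    then have i: "i < d" using A' by simp
    have "(B *\<^sub>v v) $ i = (\<Sum>j<d. (if i = j then v $ j else 0) - inverse c *\<^sub>R (A $$ (i, j) * v $ j))"
      using i unfolding index_mult_mat_vec_sum[OF B v i]
      by (intro sum.cong) (auto simp: B_def left_diff_distrib)
    also have "\<dots> = v $ i - inverse c *\<^sub>R (A *\<^sub>v v) $ i"
      using i unfolding index_mult_mat_vec_sum[OF A' v i]
      by (simp add: sum_subtractf scaleR_sum_right)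
    finally show "(B *\<^sub>v v) $ i = (v + of_real (- inverse c) \<cdot>\<^sub>v (A *\<^sub>v v)) $ i"
      using i v A' by (simp add: scaleR_conv_of_real del: index_mult_mat_vec)
  qed (use B v A' in auto)
  have Bform: "rip v (B *\<^sub>v v) = (vec_norm v)\<^sup>2 - rip v (A *\<^sub>v v) / c" if v: "v \<in> carrier_vec d" for v
  proof -
    have "dim_vec v = d" "dim_vec (A *\<^sub>v v) = d" using v A' by auto
    then show ?thesis unfolding Bv[OF v]
      by (simp add: rip_simps[where n=d] rip_self divide_inverse mult.commute
          del: of_real_minus of_real_inverse)
  qed
  have c1: "conjugate (1::'k) = 1" using conjugate_of_real[of 1, where 'k='k] by simp
  have cd: "conjugate (x - y) = conjugate x - conjugate y" for x y :: 'k
    by (rule linear_diff[OF bounded_linear.linear[OF bounded_linear_conjugate]])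
  have saB: "self_adjoint d B"
    using sa by (auto simp: self_adjoint_def B_def cd c1 conjugate_scaleR)
  interpret psd_contraction d B "1 - m / c"
  proof
    fix v :: "'k vec" assume v: "v \<in> carrier_vec d"
    show "0 \<le> rip v (B *\<^sub>v v)"
      using upper[OF v] c by (simp add: Bform[OF v] field_simps)
    show "rip v (B *\<^sub>v v) \<le> (1 - m / c) * (vec_norm v)\<^sup>2"
      using lower[OF v] c by (simp add: Bform[OF v] field_simps)
  qed (use m c saB in auto)
  define S where "S = mat d d (\<lambda>(i, j). sqrt c *\<^sub>R R $$ (i, j))"
  have S: "S \<in> carrier_mat d d" by (simp add: S_def)
  have Sv: "S *\<^sub>v v = of_real (sqrt c) \<cdot>\<^sub>v (R *\<^sub>v v)" if v: "v \<in> carrier_vec d" for v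
  proof (rule eq_vecI)
    fix i assume "i < dim_vec (of_real (sqrt c) \<cdot>\<^sub>v (R *\<^sub>v v))"
    then have i: "i < d" using R by simp
    show "(S *\<^sub>v v) $ i = (of_real (sqrt c) \<cdot>\<^sub>v (R *\<^sub>v v)) $ i"
      using i R unfolding index_mult_mat_vec_sum[OF S v i]
      by (simp add: index_mult_mat_vec_sum[OF R v i]
          S_def sum_distrib_left scaleR_conv_of_real mult.assoc del: index_mult_mat_vec)
  qed (use S v R in auto)
  have pS: "pos_def_self_adjoint d S"
    unfolding pos_def_self_adjoint_iff
  proof (intro conjI ballI impI)
    show "self_adjoint d S" using self_adjoint_R by (simp add: self_adjoint_def S_def conjugate_scaleR)
    fix v :: "'k vec" assume v: "v \<in> carrier_vec d" "v \<noteq> 0\<^sub>v d"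
    then have "0 < rip v (R *\<^sub>v v)" using pos_def_R by (simp add: pos_def_self_adjoint_iff)
    then show "0 < rip v (S *\<^sub>v v)"
      using v R c by (simp add: Sv rip_smult_right[where n=d])
  qed
  have SS: "S * S = A"
  proof (rule eq_matI)
    fix i j assume "i < dim_row A" "j < dim_col A"
    then have ij: "i < d" "j < d" using A' by auto
    have "(S * S) $$ (i, j) = (sqrt c * sqrt c) *\<^sub>R (R * R) $$ (i, j)"
      unfolding index_mult_mat_sum[OF S S ij] index_mult_mat_sum[OF R R ij] scaleR_sum_right
      using ij by (intro sum.cong) (auto simp: S_def)
    also have "\<dots> = A $$ (i, j)"
      unfolding R_square using ij c B by (auto simp: B_def)
    finally show "(S * S) $$ (i, j) = A $$ (i, j)" .
  qed (use A' S in auto)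
  have unique: "S' = S" if S': "pos_def_self_adjoint d S'" "S' * S' = A" for S'
  proof -
    have sS': "self_adjoint d S'" and cS': "S' \<in> carrier_mat d d"
      using S' by (auto simp: pos_def_self_adjoint_iff self_adjoint_def)
    have comm_A: "S' * A = A * S'"
      using S'(2) assoc_mult_mat[OF cS' cS' cS'] by simp
    have "S' * B = B * S'"
    proof (rule eq_matI)
      fix i j assume "i < dim_row (B * S')" "j < dim_col (B * S')"
      then have ij: "i < d" "j < d" using B cS' by auto
      have "(S' * B) $$ (i, j) = (\<Sum>l<d. (if l = j then S' $$ (i, l) else 0) -
          inverse c *\<^sub>R (S' $$ (i, l) * A $$ (l, j)))"
        unfolding index_mult_mat_sum[OF cS' B ij] using ij
        by (intro sum.cong) (auto simp: B_def right_diff_distrib)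
      also have "\<dots> = S' $$ (i, j) - inverse c *\<^sub>R (S' * A) $$ (i, j)"
        unfolding index_mult_mat_sum[OF cS' A' ij] using ij by (simp add: sum_subtractf scaleR_sum_right)
      also have "\<dots> = S' $$ (i, j) - inverse c *\<^sub>R (A * S') $$ (i, j)"
        by (simp add: comm_A)
      also have "\<dots> = (\<Sum>l<d. (if i = l then S' $$ (l, j) else 0) -
          inverse c *\<^sub>R (A $$ (i, l) * S' $$ (l, j)))"
        unfolding index_mult_mat_sum[OF A' cS' ij] using ij by (simp add: sum_subtractf scaleR_sum_right)
      also have "\<dots> = (B * S') $$ (i, j)"
        unfolding index_mult_mat_sum[OF B cS' ij] using ij
        by (intro sum.cong) (auto simp: B_def left_diff_distrib)
      finally show "(S' * B) $$ (i, j) = (B * S') $$ (i, j)" .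
    qed (use B cS' in auto)
    from R_commute[OF cS' this] have SR: "S' * R = R * S'" .
    have comm: "S' *\<^sub>v (S *\<^sub>v v) = S *\<^sub>v (S' *\<^sub>v v)" if v: "v \<in> carrier_vec d" for v
    proof -
      have "S' *\<^sub>v (S *\<^sub>v v) = of_real (sqrt c) \<cdot>\<^sub>v (S' *\<^sub>v (R *\<^sub>v v))"
        using v R cS' by (simp add: Sv mult_mat_vec_smult_real[of _ d d])
      also have "S' *\<^sub>v (R *\<^sub>v v) = R *\<^sub>v (S' *\<^sub>v v)"
        using assoc_mult_mat_vec[OF cS' R v] assoc_mult_mat_vec[OF R cS' v] SR by simp
      finally show ?thesis using v cS' by (simp add: Sv)
    qed
    have eq: "S' *\<^sub>v v = S *\<^sub>v v" if v: "v \<in> carrier_vec d" for v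
    proof -
      define w where "w = S' *\<^sub>v v - S *\<^sub>v v"
      have cv: "S' *\<^sub>v v \<in> carrier_vec d" "S *\<^sub>v v \<in> carrier_vec d" and w: "w \<in> carrier_vec d"
        using v S cS' by (auto simp: w_def)
      \<comment> \<open>Both S'^2 and S^2 equal A, and the mixed terms S' S v and S S' v cancel by
        \<open>comm\<close>.\<close>
      have "S' *\<^sub>v w + S *\<^sub>v w = 0\<^sub>v d"
      proof -
        have "S' *\<^sub>v w = A *\<^sub>v v - S *\<^sub>v (S' *\<^sub>v v)"
          unfolding w_def using cv v assoc_mult_mat_vec[OF cS' cS' v]
          by (simp add: mult_minus_distrib_mat_vec[OF cS'] S'(2) comm)
        moreover have "S *\<^sub>v w = S *\<^sub>v (S' *\<^sub>v v) - A *\<^sub>v v"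
          unfolding w_def using cv v assoc_mult_mat_vec[OF S S v]
          by (simp add: mult_minus_distrib_mat_vec[OF S] SS)
        ultimately show ?thesis using A' S v cv by (intro eq_vecI) (auto simp del: index_mult_mat_vec)
      qed
      then have "rip w (S' *\<^sub>v w) + rip w (S *\<^sub>v w) = 0"
        using rip_add_right[of w d "S' *\<^sub>v w" "S *\<^sub>v w"] w S cS' by (simp add: rip_def)
      then have "w = 0\<^sub>v d"
        using S' pS w unfolding pos_def_self_adjoint_iff by (metis add_pos_pos less_irrefl)
      then have "(S' *\<^sub>v v) $ i = (S *\<^sub>v v) $ i" if "i < d" for i
      proof -
        have "w $ i = 0" using \<open>w = 0\<^sub>v d\<close> that by simp
        then show ?thesis
          by (metis carrier_vecD cv(2) eq_iff_diff_eq_0 index_minus_vec(1) that w_def)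
      qed
      then show ?thesis
        using carrier_matD[OF S] carrier_matD[OF cS'] by (intro eq_vecI) (auto simp del: index_mult_mat_vec)
    qed
    show "S' = S"
    proof (rule eq_matI)
      fix i j assume "i < dim_row S" "j < dim_col S"
      then have "i < d" "j < d" using S by auto
      then show "S' $$ (i, j) = S $$ (i, j)"
        using eq[of "unit_vec d j"] mult_mat_unit_vec_index[OF cS'] mult_mat_unit_vec_index[OF S]
        by (metis unit_vec_carrier)
    qed (use S cS' in auto)
  qed
  show ?thesis unfolding mat_sqrt_def
  proof (rule theI[where P = "\<lambda>S. pos_def_self_adjoint d S \<and> S * S = A" and a = S])
    show "pos_def_self_adjoint d S \<and> S * S = A" by (rule conjI[OF pS SS])
  qed (metis unique)
qed

section \<open>Gaussian scalars and vectors: invariance of the laws and moments\<close>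

section \<open>Rotation invariance of Gaussian scalars\<close>

lemma nn_integral_lborel_shift:
  fixes f :: "'a::euclidean_space \<Rightarrow> ennreal"
  assumes [measurable]: "f \<in> borel_measurable borel"
  shows "(\<integral>\<^sup>+x. f (c + x) \<partial>lborel) = (\<integral>\<^sup>+x. f x \<partial>lborel)"
  by (subst (2) lborel_distr_plus[of c, symmetric]) (simp add: nn_integral_distr)

lemma orthogonal_transformation_measurable:
  fixes T :: "'a::euclidean_space \<Rightarrow> 'a"
  assumes "orthogonal_transformation T"
  shows "T \<in> borel_measurable borel"
  using orthogonal_transformation_linear[OF assms]
  by (intro borel_measurable_continuous_onI linear_continuous_on) (simp add: linear_conv_bounded_linear)

lemma indicator_comp_measurable:
  "B \<in> sets borel \<Longrightarrow> k \<in> borel_measurable M \<Longrightarrow> (\<lambda>p. indicator B (k p) :: ennreal) \<in> borel_measurable M"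
  using measurable_compose[OF _ borel_measurable_indicator] by metis

text \<open>The image \<open>\<nu>\<close> of Lebesgue measure under \<open>T\<close> is translation invariant. Integrating
  \<open>1\<^sub>B(x) g(x + T y)\<close> over both variables, for the unit ball \<open>B\<close>, in either order shows that
  \<open>\<nu>\<close> and Lebesgue measure agree.\<close>

lemma lborel_distr_orthogonal:
  fixes T :: "'a::euclidean_space \<Rightarrow> 'a"
  assumes T: "orthogonal_transformation T"
  shows "distr lborel borel T = lborel"
proof (rule measure_eqI)
  note [measurable] = orthogonal_transformation_measurable[OF T]
  have lin: "T (x + y) = T x + T y" "T (x - y) = T x - T y" for x y
    using orthogonal_transformation_linear[OF T] by (auto simp: linear_add linear_diff)
  fix A :: "'a set" assume "A \<in> sets (distr lborel borel T)"
  then have A[measurable]: "A \<in> sets borel" by simp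
  let ?g = "indicator A :: 'a \<Rightarrow> ennreal"
  let ?N = "\<integral>\<^sup>+y. ?g (T y) \<partial>lborel"
  define b where "b = emeasure lborel (cball (0::'a) 1)"
  have b: "emeasure lborel (cball x 1) = b" for x :: 'a
    by (simp add: b_def emeasure_cball)
  have b0: "b \<noteq> 0" "b \<noteq> \<infinity>"
    using unit_ball_vol_pos[of "real DIM('a)"] unfolding b_def
    by (simp_all add: emeasure_cball ennreal_eq_0_iff not_le del: unit_ball_vol_pos)
  have fs: "fst \<in> borel_measurable (lborel \<Otimes>\<^sub>M lborel)" "snd \<in> borel_measurable (lborel \<Otimes>\<^sub>M lborel)"
    "(\<lambda>p. T (fst p)) \<in> borel_measurable (lborel \<Otimes>\<^sub>M lborel)"
    "(\<lambda>p. T (snd p)) \<in> borel_measurable (lborel \<Otimes>\<^sub>M lborel)" by measurable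
  have "(\<integral>\<^sup>+x. \<integral>\<^sup>+y. indicator (cball 0 1) x * ?g (x + T y) \<partial>lborel \<partial>lborel) = b * ?N"
  proof -
    have "(\<integral>\<^sup>+y. indicator (cball 0 1) x * ?g (x + T y) \<partial>lborel) = indicator (cball 0 1) x * ?N" for x
    proof -
      obtain x' where x': "x = T x'" using orthogonal_transformation_surj[OF T] by (metis surjD)
      have "(\<integral>\<^sup>+y. ?g (x + T y) \<partial>lborel) = (\<integral>\<^sup>+y. ?g (T (x' + y)) \<partial>lborel)"
        by (simp add: x' lin)
      also have "\<dots> = ?N" by (rule nn_integral_lborel_shift[of "\<lambda>y. ?g (T y)"]) measurable
      finally show ?thesis by (simp add: nn_integral_cmult)
    qed
    moreover have "(\<integral>\<^sup>+x. indicator (cball (0::'a) 1) x * ?N \<partial>lborel) = b * ?N"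
      by (subst nn_integral_multc) (auto simp: b intro!: borel_measurable_indicator)
    ultimately show ?thesis by simp
  qed
  moreover have "(\<integral>\<^sup>+x. \<integral>\<^sup>+y. indicator (cball 0 1) x * ?g (x + T y) \<partial>lborel \<partial>lborel) =
      b * (\<integral>\<^sup>+x. ?g x \<partial>lborel)"
  proof -
    have "(\<integral>\<^sup>+x. \<integral>\<^sup>+y. indicator (cball 0 1) x * ?g (x + T y) \<partial>lborel \<partial>lborel) =
        (\<integral>\<^sup>+y. \<integral>\<^sup>+x. indicator (cball 0 1) x * ?g (x + T y) \<partial>lborel \<partial>lborel)"
      using A by (intro lborel_pair.Fubini') (simp only: split_beta',
        intro borel_measurable_times_ennreal indicator_comp_measurable borel_measurable_add borel_measurable_diff fs, auto)
    also have "\<dots> = (\<integral>\<^sup>+y. \<integral>\<^sup>+x. indicator (cball 0 1) (x - T y) * ?g x \<partial>lborel \<partial>lborel)"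
    proof (rule nn_integral_cong)
      fix y
      show "(\<integral>\<^sup>+x. indicator (cball 0 1) x * ?g (x + T y) \<partial>lborel) =
          (\<integral>\<^sup>+x. indicator (cball 0 1) (x - T y) * ?g x \<partial>lborel)"
      proof -
        have "(\<lambda>x. indicator (cball 0 1) (x - T y) * ?g x) \<in> borel_measurable borel"
          using A by (intro borel_measurable_times_ennreal indicator_comp_measurable borel_measurable_indicator) auto
        from nn_integral_lborel_shift[OF this, of "T y"] show ?thesis by (simp add: add.commute)
      qed
    qed
    also have "\<dots> = (\<integral>\<^sup>+x. \<integral>\<^sup>+y. indicator (cball 0 1) (x - T y) * ?g x \<partial>lborel \<partial>lborel)"
      using A by (intro lborel_pair.Fubini') (simp only: split_beta',
        intro borel_measurable_times_ennreal indicator_comp_measurable borel_measurable_add borel_measurable_diff fs, auto)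
    also have "\<dots> = (\<integral>\<^sup>+x. b * ?g x \<partial>lborel)"
    proof (rule nn_integral_cong)
      fix x
      obtain x' where x': "x = T x'" using orthogonal_transformation_surj[OF T] by (metis surjD)
      have "indicator (cball 0 1) (x - T y) = (indicator (cball x' 1) y :: ennreal)" for y
        using orthogonal_transformation_norm[OF T, of "x' - y"]
        by (simp add: x' indicator_def dist_norm flip: lin)
      then show "(\<integral>\<^sup>+y. indicator (cball 0 1) (x - T y) * ?g x \<partial>lborel) = b * ?g x"
        by (simp, subst nn_integral_multc) (auto simp: b intro!: borel_measurable_indicator)
    qed
    also have "\<dots> = b * (\<integral>\<^sup>+x. ?g x \<partial>lborel)" by (simp add: nn_integral_cmult)
    finally show ?thesis .
  qed
  ultimately have "b * ?N = b * emeasure lborel A" by simp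
  then have "?N = emeasure lborel A"
    using b0 by (simp add: ennreal_mult_cancel_left)
  moreover have "?N = emeasure (distr lborel borel T) A"
    using nn_integral_distr[of T lborel borel ?g] by simp
  ultimately show "emeasure (distr lborel borel T) A = emeasure lborel A" by simp
qed simp

definition gauss_sd :: "'k::gaussian_scalar itself \<Rightarrow> real" where
  "gauss_sd _ = 1 / sqrt (real DIM('k))"

lemma gauss_sd_pos [simp]: "0 < gauss_sd TYPE('k::gaussian_scalar)"
  by (simp add: gauss_sd_def)

definition gauss_density :: "'k::gaussian_scalar \<Rightarrow> real" where
  "gauss_density x = (\<Prod>b\<in>Basis. normal_density 0 (gauss_sd TYPE('k)) (inner x b))"

text \<open>Because all \<beta> real components have the same variance, the joint density depends on
  the norm alone; this is the source of every invariance below.\<close>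

lemma gauss_density_eq:
  "gauss_density (x::'k::gaussian_scalar) =
    (1 / sqrt (2 * pi * (gauss_sd TYPE('k))\<^sup>2)) ^ DIM('k) * exp (- (norm x)\<^sup>2 / (2 * (gauss_sd TYPE('k))\<^sup>2))"
proof -
  have "(norm x)\<^sup>2 = (\<Sum>b\<in>Basis. (inner x b)\<^sup>2)"
    unfolding power2_norm_eq_inner by (subst euclidean_inner) (simp add: power2_eq_square)
  then have "- (norm x)\<^sup>2 / (2 * (gauss_sd TYPE('k))\<^sup>2) =
      (\<Sum>b\<in>Basis. - (inner x b)\<^sup>2 / (2 * (gauss_sd TYPE('k))\<^sup>2))"
    by (simp add: sum_negf sum_divide_distrib)
  then show ?thesis
    by (simp add: gauss_density_def normal_density_def prod.distrib exp_sum power_one_over prod_dividef)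
qed

lemma borel_measurable_gauss_density [measurable]: "gauss_density \<in> borel_measurable borel"
  unfolding gauss_density_def by measurable

lemma gauss_density_nonneg [simp]: "0 \<le> gauss_density x"
  by (simp add: gauss_density_def prod_nonneg)

lemma prob_space_gaussian_component:
  "prob_space (density lborel (normal_density 0 (gauss_sd TYPE('k::gaussian_scalar))))"
  by (rule prob_space_normal_density) simp

abbreviation gauss_coords :: "('k::gaussian_scalar \<Rightarrow> real) measure" where
  "gauss_coords \<equiv> PiM Basis (\<lambda>_::'k. density lborel (normal_density 0 (gauss_sd TYPE('k))))"

lemma gaussian_entry_eq_distr:
  "(gaussian_entry :: 'k::gaussian_scalar measure) =
     distr gauss_coords borel (\<lambda>x. \<Sum>b\<in>Basis. x b *\<^sub>R b)"
  by (simp add: gaussian_entry_def gauss_sd_def)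

text \<open>The product of the one-dimensional laws has the product density, since both measures
  agree on boxes; \<open>lborel_eq\<close> then carries this from coordinates to the scalar
  type.\<close>

lemma gaussian_entry_density:
  "(gaussian_entry :: 'k::gaussian_scalar measure) = density lborel (\<lambda>x. ennreal (gauss_density x))"
proof -
  let ?nd = "normal_density 0 (gauss_sd TYPE('k))"
  interpret P: product_sigma_finite "\<lambda>_::'k. density lborel ?nd"
    unfolding product_sigma_finite_def
    using prob_space_imp_sigma_finite[OF prob_space_gaussian_component] by blast
  interpret L: product_sigma_finite "\<lambda>_::'k. lborel :: real measure"
    by standard
  have "density (PiM Basis (\<lambda>_::'k. lborel)) (\<lambda>x. ennreal (\<Prod>b\<in>Basis. ?nd (x b))) =
      PiM Basis (\<lambda>_. density lborel ?nd)"
  proof (rule P.PiM_eqI)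
    show "sets (density (PiM Basis (\<lambda>_::'k. lborel)) (\<lambda>x. ennreal (\<Prod>b\<in>Basis. ?nd (x b)))) =
      sets (PiM Basis (\<lambda>_. density lborel ?nd))"
      by (simp cong: sets_PiM_cong)
    fix A :: "'k \<Rightarrow> real set" assume A: "\<And>i. i \<in> Basis \<Longrightarrow> A i \<in> sets (density lborel ?nd)"
    then have A': "A i \<in> sets borel" if "i \<in> Basis" for i using that by simp
    have PA: "Pi\<^sub>E Basis A \<in> sets (PiM Basis (\<lambda>_::'k. lborel))"
      using A' by (intro sets_PiM_I_finite) auto
    have "emeasure (density (PiM Basis (\<lambda>_::'k. lborel)) (\<lambda>x. ennreal (\<Prod>b\<in>Basis. ?nd (x b)))) (Pi\<^sub>E Basis A)
       = (\<integral>\<^sup>+x. ennreal (\<Prod>b\<in>Basis. ?nd (x b)) * indicator (Pi\<^sub>E Basis A) x \<partial>PiM Basis (\<lambda>_::'k. lborel))"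
      by (rule emeasure_density[OF _ PA]) measurable
    also have "\<dots> = (\<integral>\<^sup>+x. (\<Prod>b\<in>Basis. ennreal (?nd (x b)) * indicator (A b) (x b)) \<partial>PiM Basis (\<lambda>_::'k. lborel))"
    proof (rule nn_integral_cong)
      fix x assume x: "x \<in> space (PiM Basis (\<lambda>_::'k. lborel :: real measure))"
      have "indicator (Pi\<^sub>E Basis A) x = (\<Prod>b\<in>Basis. indicator (A b) (x b) :: ennreal)"
      proof (cases "\<forall>b\<in>Basis. x b \<in> A b")
        case True
        then show ?thesis using x by (auto simp: space_PiM PiE_iff indicator_def)
      next
        case False
        then show ?thesis
          by (auto simp: indicator_def PiE_iff intro!: prod_zero[symmetric])
      qed
      then show "ennreal (\<Prod>b\<in>Basis. ?nd (x b)) * indicator (Pi\<^sub>E Basis A) x =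
          (\<Prod>b\<in>Basis. ennreal (?nd (x b)) * indicator (A b) (x b))"
        by (simp add: prod.distrib prod_ennreal)
    qed
    also have "\<dots> = (\<Prod>b\<in>Basis. \<integral>\<^sup>+x. ennreal (?nd x) * indicator (A b) x \<partial>lborel)"
    proof (rule L.product_nn_integral_prod)
      fix b :: 'k assume "b \<in> Basis"
      then have [measurable]: "A b \<in> sets borel" by (rule A')
      show "(\<lambda>x. ennreal (?nd x) * indicator (A b) x) \<in> borel_measurable lborel" by measurable
    qed simp
    also have "\<dots> = (\<Prod>b\<in>Basis. emeasure (density lborel ?nd) (A b))"
      using A' by (intro prod.cong refl) (simp add: emeasure_density)
    finally show "emeasure (density (PiM Basis (\<lambda>_::'k. lborel)) (\<lambda>x. ennreal (\<Prod>b\<in>Basis. ?nd (x b)))) (Pi\<^sub>E Basis A)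
       = (\<Prod>b\<in>Basis. emeasure (density lborel ?nd) (A b))" .
  qed simp
  then have "(gaussian_entry :: 'k measure) = distr (density (PiM Basis (\<lambda>_::'k. lborel))
      (\<lambda>x. ennreal (gauss_density (\<Sum>b\<in>Basis. x b *\<^sub>R b)))) borel (\<lambda>x. \<Sum>b\<in>Basis. x b *\<^sub>R b)"
    by (simp add: gaussian_entry_eq_distr gauss_density_def inner_sum_left_Basis cong: prod.cong)
  also have "\<dots> = density (distr (PiM Basis (\<lambda>_::'k. lborel)) borel (\<lambda>x. \<Sum>b\<in>Basis. x b *\<^sub>R b))
      (\<lambda>x. ennreal (gauss_density x))"
    by (rule density_distr[symmetric]) measurable
  finally show ?thesis by (simp add: lborel_eq[symmetric])
qed

lemma space_gaussian_entry [simp]: "space gaussian_entry = UNIV"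
  by (simp add: gaussian_entry_def)

lemma sets_gaussian_entry [simp, measurable_cong]: "sets gaussian_entry = sets borel"
  by (simp add: gaussian_entry_def)

lemma measurable_gaussian_entry [simp]:
  "measurable M gaussian_entry = measurable M borel" "measurable gaussian_entry M = measurable borel M"
  by (rule measurable_cong_sets; simp)+

lemma prob_space_gaussian_entry: "prob_space (gaussian_entry :: 'k::gaussian_scalar measure)"
  unfolding gaussian_entry_eq_distr
  by (intro prob_space.prob_space_distr prob_space_PiM prob_space_gaussian_component) measurable

interpretation gaussian: prob_space "gaussian_entry :: 'k::gaussian_scalar measure"
  by (rule prob_space_gaussian_entry)

interpretation gaussian_prod: product_sigma_finite "\<lambda>_::'i. gaussian_entry :: 'k::gaussian_scalar measure"
  by standard

interpretation gaussian_pair: pair_sigma_finite "gaussian_entry :: 'k::gaussian_scalar measure"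
    "gaussian_entry :: 'k measure"
  by standard

lemma emeasure_gaussian_UNIV [simp]: "emeasure (gaussian_entry :: 'k::gaussian_scalar measure) UNIV = 1"
  using gaussian.emeasure_space_1[where 'k='k] by simp

lemma gaussian_distr_orthogonal:
  fixes T :: "'k::gaussian_scalar \<Rightarrow> 'k"
  assumes T: "orthogonal_transformation T"
  shows "distr gaussian_entry borel T = gaussian_entry"
proof -
  note [measurable] = orthogonal_transformation_measurable[OF T]
  have "gauss_density (T x) = gauss_density x" for x
    by (simp add: gauss_density_eq orthogonal_transformation_norm[OF T])
  then have "distr gaussian_entry borel T = distr (density lborel (\<lambda>x. ennreal (gauss_density (T x)))) borel T"
    by (simp add: gaussian_entry_density)
  also have "\<dots> = density (distr lborel borel T) (\<lambda>x. ennreal (gauss_density x))"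
    by (rule density_distr[symmetric]) measurable
  finally show ?thesis by (simp add: lborel_distr_orthogonal[OF T] gaussian_entry_density)
qed

lemma gaussian_nn_integral_orthogonal:
  fixes T :: "'k::gaussian_scalar \<Rightarrow> 'k"
  assumes T: "orthogonal_transformation T" and [measurable]: "f \<in> borel_measurable borel"
  shows "(\<integral>\<^sup>+x. f (T x) \<partial>gaussian_entry) = (\<integral>\<^sup>+x. f x \<partial>gaussian_entry)"
proof -
  have [measurable]: "T \<in> measurable gaussian_entry borel"
    using orthogonal_transformation_measurable[OF T] by simp
  show ?thesis
    by (subst (2) gaussian_distr_orthogonal[OF T, symmetric]) (simp add: nn_integral_distr)
qed

lemma gaussian_integral_uminus:
  fixes f :: "'k::gaussian_scalar \<Rightarrow> real"
  assumes [measurable]: "f \<in> borel_measurable borel"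
  shows "(\<integral>x. f (- x) \<partial>gaussian_entry) = (\<integral>x. f x \<partial>gaussian_entry)"
proof -
  have T: "orthogonal_transformation (\<lambda>x::'k. - x)"
    by (simp add: orthogonal_transformation linear_iff)
  show ?thesis
    by (subst (2) gaussian_distr_orthogonal[OF T, symmetric]) (simp add: integral_distr)
qed

text \<open>For c > 0 the map T is c times an orthogonal transformation, so invariance applies; for
  c = 0 it vanishes. The cases of interest are left and right multiplication by a scalar, with c its
  norm.\<close>

lemma gaussian_nn_integral_similarity:
  fixes T :: "'k::gaussian_scalar \<Rightarrow> 'k"
  assumes T: "linear T" "\<And>x. norm (T x) = c * norm x"
    and f[measurable]: "f \<in> borel_measurable borel"
  shows "(\<integral>\<^sup>+x. f (T x) \<partial>gaussian_entry) = (\<integral>\<^sup>+x. f (c *\<^sub>R x) \<partial>gaussian_entry)"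
proof (cases "c = 0")
  case True
  then have "T x = 0" for x using T(2)[of x] by simp
  then show ?thesis by (simp add: True)
next
  case False
  have c: "c > 0" using False T(2)[of 1] norm_ge_zero[of "T 1"] by simp
  define U where "U x = inverse c *\<^sub>R T x" for x
  have U: "orthogonal_transformation U"
    using T c unfolding U_def orthogonal_transformation
    by (auto intro: linear_compose_scale_right)
  have "f (T x) = f (c *\<^sub>R U x)" for x using False by (simp add: U_def)
  then have "(\<integral>\<^sup>+x. f (T x) \<partial>gaussian_entry) = (\<integral>\<^sup>+x. f (c *\<^sub>R U x) \<partial>gaussian_entry)"
    by simp
  also have "\<dots> = (\<integral>\<^sup>+x. f (c *\<^sub>R x) \<partial>gaussian_entry)"
    by (rule gaussian_nn_integral_orthogonal[OF U, of "\<lambda>x. f (c *\<^sub>R x)"]) measurable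
  finally show ?thesis .
qed

text \<open>The plane rotation (x, y) to (a x + b y, -b x + a y) is orthogonal on pairs of scalars
  and preserves the joint density, a function of |x|^2 + |y|^2. Projecting to the first component
  gives the claim.\<close>

lemma gaussian_nn_integral_rotation:
  fixes f :: "'k::gaussian_scalar \<Rightarrow> ennreal"
  assumes ab: "a\<^sup>2 + b\<^sup>2 = 1" and f[measurable]: "f \<in> borel_measurable borel"
  shows "(\<integral>\<^sup>+y. \<integral>\<^sup>+x. f (a *\<^sub>R x + b *\<^sub>R y) \<partial>gaussian_entry \<partial>gaussian_entry) =
    (\<integral>\<^sup>+x. f x \<partial>gaussian_entry)"
proof -
  define T where "T = (\<lambda>(x::'k, y::'k). (a *\<^sub>R x + b *\<^sub>R y, - b *\<^sub>R x + a *\<^sub>R y))"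
  have nT: "(norm (a *\<^sub>R x + b *\<^sub>R y))\<^sup>2 + (norm (- b *\<^sub>R x + a *\<^sub>R y))\<^sup>2 = (norm x)\<^sup>2 + (norm y)\<^sup>2" for x y :: 'k
  proof -
    have "(norm (a *\<^sub>R x + b *\<^sub>R y))\<^sup>2 + (norm (- b *\<^sub>R x + a *\<^sub>R y))\<^sup>2 =
        (a\<^sup>2 + b\<^sup>2) * (norm x)\<^sup>2 + (a\<^sup>2 + b\<^sup>2) * (norm y)\<^sup>2"
      unfolding power2_norm_eq_inner
      by (simp add: inner_add_left inner_add_right inner_diff_left inner_diff_right
          inner_commute[of y x] algebra_simps power2_eq_square)
    then show ?thesis by (simp add: ab)
  qed
  have T: "orthogonal_transformation T"
    unfolding orthogonal_transformation
  proof (intro conjI allI)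
    show "linear T" by (rule linearI) (auto simp: T_def algebra_simps)
    show "norm (T v) = norm v" for v using nT by (cases v) (simp add: T_def norm_Pair)
  qed
  note [measurable] = orthogonal_transformation_measurable[OF T]
  define h where "h = (\<lambda>(x::'k, y::'k). ennreal (gauss_density x) * ennreal (gauss_density y))"
  have h[measurable]: "h \<in> borel_measurable borel"
    unfolding h_def borel_prod[symmetric] by measurable
  have hT: "h (T p) = h p" for p
  proof -
    obtain x y where p: "p = (x, y)" by fastforce
    let ?s = "2 * (gauss_sd TYPE('k))\<^sup>2"
    have "gauss_density (fst (T p)) * gauss_density (snd (T p)) = gauss_density x * gauss_density y"
    proof -
      have "exp (- (norm (fst (T p)))\<^sup>2 / ?s) * exp (- (norm (snd (T p)))\<^sup>2 / ?s) =
          exp (- (norm x)\<^sup>2 / ?s) * exp (- (norm y)\<^sup>2 / ?s)"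
        unfolding exp_add[symmetric] add_divide_distrib[symmetric] using nT[of x y]
        by (simp add: p T_def add.commute flip: minus_add_distrib)
      then show ?thesis by (simp add: gauss_density_eq mult_ac)
    qed
    then show ?thesis
      by (simp add: h_def p split_beta flip: ennreal_mult)
  qed
  have dens: "gaussian_entry \<Otimes>\<^sub>M gaussian_entry = density lborel h"
    unfolding gaussian_entry_density h_def lborel_prod[symmetric]
    by (rule pair_measure_density)
      (auto simp flip: gaussian_entry_density intro: lborel.sigma_finite_measure_axioms
        gaussian.sigma_finite_measure_axioms)
  have "(\<integral>\<^sup>+y. \<integral>\<^sup>+x. f (a *\<^sub>R x + b *\<^sub>R y) \<partial>gaussian_entry \<partial>gaussian_entry) =
      (\<integral>\<^sup>+p. f (fst (T p)) \<partial>(gaussian_entry \<Otimes>\<^sub>M gaussian_entry))"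
    by (subst gaussian_pair.nn_integral_snd[symmetric]) (auto simp: T_def split_beta')
  also have "\<dots> = (\<integral>\<^sup>+p. f (fst p) \<partial>distr (density lborel (\<lambda>p. h (T p))) borel T)"
  proof -
    have "(\<lambda>p. f (fst p)) \<in> borel_measurable (borel :: ('k \<times> 'k) measure)"
      unfolding borel_prod[symmetric] by measurable
    then show ?thesis unfolding dens hT by (subst nn_integral_distr) simp_all
  qed
  also have "distr (density lborel (\<lambda>p. h (T p))) borel T = density (distr lborel borel T) h"
    by (rule density_distr[symmetric]) measurable
  also have "\<dots> = gaussian_entry \<Otimes>\<^sub>M gaussian_entry"
    by (simp add: lborel_distr_orthogonal[OF T] dens)
  also have "(\<integral>\<^sup>+p. f (fst p) \<partial>(gaussian_entry \<Otimes>\<^sub>M gaussian_entry)) = (\<integral>\<^sup>+x. f x \<partial>gaussian_entry)"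
    by (subst gaussian.nn_integral_fst[symmetric]) (auto simp: gaussian.emeasure_space_1[simplified])
  finally show ?thesis .
qed

lemma gaussian_nn_integral_add:
  fixes f :: "'k::gaussian_scalar \<Rightarrow> ennreal"
  assumes f[measurable]: "f \<in> borel_measurable borel"
  shows "(\<integral>\<^sup>+y. \<integral>\<^sup>+x. f (a *\<^sub>R x + b *\<^sub>R y) \<partial>gaussian_entry \<partial>gaussian_entry) =
    (\<integral>\<^sup>+x. f (sqrt (a\<^sup>2 + b\<^sup>2) *\<^sub>R x) \<partial>gaussian_entry)"
proof (cases "a\<^sup>2 + b\<^sup>2 = 0")
  case True
  then have "a = 0" "b = 0" by (auto simp: sum_power2_eq_zero_iff)
  then show ?thesis by simp
next
  case False
  define s where "s = sqrt (a\<^sup>2 + b\<^sup>2)"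
  have s: "s > 0" "s\<^sup>2 = a\<^sup>2 + b\<^sup>2"
    using False by (auto simp: s_def sum_power2_gt_zero_iff)
  have "(a / s)\<^sup>2 + (b / s)\<^sup>2 = 1"
    using s False by (simp add: power_divide flip: add_divide_distrib)
  moreover have "s *\<^sub>R ((a / s) *\<^sub>R x + (b / s) *\<^sub>R y) = a *\<^sub>R x + b *\<^sub>R y" for x y :: 'k
    using s by (simp add: scaleR_add_right)
  moreover have "(\<lambda>x. f (s *\<^sub>R x)) \<in> borel_measurable borel" by measurable
  ultimately show ?thesis
    unfolding s_def[symmetric] using gaussian_nn_integral_rotation[of "a / s" "b / s" "\<lambda>x. f (s *\<^sub>R x)"]
    by (simp only:)
qed

text \<open>A sum of independent scaled and rotated Gaussian scalars is Gaussian with added squared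
  scales. Coordinates are split off one at a time: \<open>gaussian_nn_integral_similarity\<close>
  replaces T i by the factor c i, and \<open>gaussian_nn_integral_add\<close> merges it with the
  rest.\<close>

lemma gaussian_nn_integral_sum:
  fixes T :: "'i \<Rightarrow> 'k::gaussian_scalar \<Rightarrow> 'k"
  assumes "finite J" and T: "\<And>j. j \<in> J \<Longrightarrow> linear (T j)" "\<And>j x. j \<in> J \<Longrightarrow> norm (T j x) = c j * norm x"
    and f: "f \<in> borel_measurable borel"
  shows "(\<integral>\<^sup>+g. f (\<Sum>j\<in>J. T j (g j)) \<partial>PiM J (\<lambda>_. gaussian_entry)) =
    (\<integral>\<^sup>+x. f (sqrt (\<Sum>j\<in>J. (c j)\<^sup>2) *\<^sub>R x) \<partial>gaussian_entry)"
  using assms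
proof (induction J arbitrary: f rule: finite_induct)
  case empty
  then show ?case
    by (simp add: PiM_empty)
next
  case (insert i J)
  note [measurable] = insert.prems(3)
  have Tm[measurable]: "T j \<in> borel_measurable borel" if "j \<in> insert i J" for j
    using insert.prems(1)[OF that]
    by (intro borel_measurable_continuous_onI linear_continuous_on) (simp add: linear_conv_bounded_linear)
  have [measurable]: "T i \<in> borel_measurable borel" using Tm by simp
  let ?r = "sqrt (\<Sum>j\<in>J. (c j)\<^sup>2)"
  have meas: "(\<lambda>g. \<Sum>j\<in>I. T j (g j)) \<in> borel_measurable (PiM I (\<lambda>_. gaussian_entry))"
    if "I \<subseteq> insert i J" for I
  proof (rule borel_measurable_sum)
    fix j assume j: "j \<in> I"
    then have "T j \<in> measurable borel borel" using Tm that by auto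
    moreover have "(\<lambda>g. g j) \<in> measurable (PiM I (\<lambda>_. gaussian_entry)) borel"
      using measurable_component_singleton[OF j, of "\<lambda>_. gaussian_entry"] by simp
    ultimately show "(\<lambda>g. T j (g j)) \<in> borel_measurable (PiM I (\<lambda>_. gaussian_entry))"
      by (rule measurable_compose_rev)
  qed
  have "(\<integral>\<^sup>+g. f (\<Sum>j\<in>insert i J. T j (g j)) \<partial>PiM (insert i J) (\<lambda>_. gaussian_entry)) =
      (\<integral>\<^sup>+y. \<integral>\<^sup>+g. f (\<Sum>j\<in>insert i J. T j ((g(i := y)) j)) \<partial>PiM J (\<lambda>_. gaussian_entry) \<partial>gaussian_entry)"
    using insert.hyps
    by (intro gaussian_prod.product_nn_integral_insert_rev measurable_compose[OF meas insert.prems(3)]) auto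
  also have "\<dots> = (\<integral>\<^sup>+y. \<integral>\<^sup>+g. f (T i y + (\<Sum>j\<in>J. T j (g j))) \<partial>PiM J (\<lambda>_. gaussian_entry) \<partial>gaussian_entry)"
  proof -
    have "(\<Sum>j\<in>insert i J. T j ((g(i := y)) j)) = T i y + (\<Sum>j\<in>J. T j (g j))" for g y
      using insert.hyps by (simp add: sum.insert) (intro sum.cong, auto)
    then show ?thesis by simp
  qed
  also have "\<dots> = (\<integral>\<^sup>+y. \<integral>\<^sup>+x. f (T i y + ?r *\<^sub>R x) \<partial>gaussian_entry \<partial>gaussian_entry)"
    \<comment> \<open>The induction hypothesis is applied to the translate of \<open>f\<close> by T
      i y, which is why \<open>f\<close> is arbitrary in the induction.\<close>
    using insert.prems by (intro nn_integral_cong insert.IH[where f = "\<lambda>x. f (T i _ + x)"]) auto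
  also have "\<dots> = (\<integral>\<^sup>+x. \<integral>\<^sup>+y. f (T i y + ?r *\<^sub>R x) \<partial>gaussian_entry \<partial>gaussian_entry)"
    by (rule gaussian_pair.Fubini') measurable
  also have "\<dots> = (\<integral>\<^sup>+x. \<integral>\<^sup>+y. f (c i *\<^sub>R y + ?r *\<^sub>R x) \<partial>gaussian_entry \<partial>gaussian_entry)"
    using insert.prems
    by (intro nn_integral_cong gaussian_nn_integral_similarity[where f = "\<lambda>y. f (y + ?r *\<^sub>R _)"]) auto
  also have "\<dots> = (\<integral>\<^sup>+x. f (sqrt ((c i)\<^sup>2 + ?r\<^sup>2) *\<^sub>R x) \<partial>gaussian_entry)"
    by (rule gaussian_nn_integral_add) measurable
  also have "(c i)\<^sup>2 + ?r\<^sup>2 = (\<Sum>j\<in>insert i J. (c j)\<^sup>2)"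
    using insert.hyps by (simp add: sum_nonneg)
  finally show ?case .
qed

section \<open>The law of a Gaussian matrix applied to a vector\<close>

abbreviation gauss_PiM :: "'i set \<Rightarrow> ('i \<Rightarrow> 'k::gaussian_scalar) measure" where
  "gauss_PiM I \<equiv> PiM I (\<lambda>_. gaussian_entry)"

lemma sets_gauss_PiM [measurable_cong]: "sets (gauss_PiM I :: ('i \<Rightarrow> 'k::gaussian_scalar) measure) = sets (PiM I (\<lambda>_. borel))"
  by (rule sets_PiM_cong) auto

lemma prob_space_gauss_PiM: "prob_space (gauss_PiM I :: ('i \<Rightarrow> 'k::gaussian_scalar) measure)"
  by (rule prob_space_PiM) (rule prob_space_gaussian_entry)

lemma gauss_PiM_component_measurable:
  "i \<in> I \<Longrightarrow> (\<lambda>g. g i) \<in> borel_measurable (gauss_PiM I :: ('i \<Rightarrow> 'k::gaussian_scalar) measure)"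
  using measurable_component_singleton[of i I "\<lambda>_. gaussian_entry :: 'k measure"] by simp

lemma distr_gauss_PiM_component:
  assumes "i \<in> I"
  shows "distr (gauss_PiM I :: ('i \<Rightarrow> 'k::gaussian_scalar) measure) borel (\<lambda>g. g i) = gaussian_entry"
proof -
  have "distr (gauss_PiM I :: ('i \<Rightarrow> 'k) measure) borel (\<lambda>g. g i) = distr (gauss_PiM I) gaussian_entry (\<lambda>g. g i)"
    by (rule distr_cong) auto
  also have "\<dots> = gaussian_entry"
    by (rule distr_PiM_component) (auto simp: prob_space_gaussian_entry assms)
  finally show ?thesis .
qed

lemma distr_indep_PiM:
  fixes X :: "'i \<Rightarrow> 'a \<Rightarrow> 'b::topological_space"
  assumes "prob_space P" "prob_space.indep_vars P (\<lambda>_. borel) X I" "I \<noteq> {}"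
    and "\<And>i. i \<in> I \<Longrightarrow> distr P borel (X i) = \<mu>"
  shows "distr P (PiM I (\<lambda>_. borel)) (\<lambda>\<omega>. \<lambda>i\<in>I. X i \<omega>) = PiM I (\<lambda>_. \<mu>)"
proof -
  interpret prob_space P by fact
  have "\<And>i. i \<in> I \<Longrightarrow> random_variable borel (X i)"
    using assms(2) by (auto simp: indep_vars_def)
  from indep_vars_iff_distr_eq_PiM'[OF assms(3) this] assms(2)
  show ?thesis by (simp add: assms(4) cong: PiM_cong)
qed

lemma indep_vars_gauss_PiM:
  assumes "I \<noteq> {}"
  shows "prob_space.indep_vars (gauss_PiM I :: ('i \<Rightarrow> 'k::gaussian_scalar) measure) (\<lambda>_. borel) (\<lambda>i g. g i) I"
proof -
  interpret prob_space "gauss_PiM I :: ('i \<Rightarrow> 'k) measure" by (rule prob_space_gauss_PiM)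
  have "distr (gauss_PiM I) (PiM I (\<lambda>_. borel)) (\<lambda>g. \<lambda>i\<in>I. g i :: 'k) =
      distr (gauss_PiM I) (PiM I (\<lambda>_. borel)) (\<lambda>g. g)"
    by (rule distr_cong) (auto simp: space_PiM PiE_def extensional_restrict)
  also have "\<dots> = gauss_PiM I"
    by (rule distr_id2) (simp add: sets_gauss_PiM)
  also have "gauss_PiM I = PiM I (\<lambda>i. distr (gauss_PiM I) borel (\<lambda>g. g i :: 'k))"
    by (intro PiM_cong refl) (simp add: distr_gauss_PiM_component)
  finally show ?thesis
    using assms by (subst indep_vars_iff_distr_eq_PiM') (auto simp: gauss_PiM_component_measurable)
qed

lemma distr_gauss_PiM_scale:
  fixes c :: real
  assumes "I \<noteq> {}"
  shows "distr (gauss_PiM I :: ('i \<Rightarrow> 'k::gaussian_scalar) measure) (PiM I (\<lambda>_. borel)) (\<lambda>g. \<lambda>i\<in>I. c *\<^sub>R g i) =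
    PiM I (\<lambda>_. distr gaussian_entry borel (\<lambda>x. c *\<^sub>R x))"
proof (rule distr_indep_PiM[OF prob_space_gauss_PiM _ assms])
  interpret prob_space "gauss_PiM I :: ('i \<Rightarrow> 'k) measure" by (rule prob_space_gauss_PiM)
  show "indep_vars (\<lambda>_. borel) (\<lambda>i g. c *\<^sub>R g i :: 'k) I"
    using indep_vars_compose2[OF indep_vars_gauss_PiM[OF assms], of "\<lambda>_ x. c *\<^sub>R x" "\<lambda>_. borel"] by simp
  fix i assume i: "i \<in> I"
  show "distr (gauss_PiM I) borel (\<lambda>g. c *\<^sub>R g i :: 'k) = distr gaussian_entry borel (\<lambda>x. c *\<^sub>R x)"
  proof -
    have "distr (gauss_PiM I) borel (\<lambda>g. c *\<^sub>R g i :: 'k) =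
        distr (distr (gauss_PiM I) borel (\<lambda>g. g i)) borel (\<lambda>x. c *\<^sub>R x)"
      using gauss_PiM_component_measurable[OF i] by (subst distr_distr) (auto simp: comp_def)
    then show ?thesis by (simp add: distr_gauss_PiM_component[OF i])
  qed
qed

lemma sum_singleton_Times: "(\<Sum>q\<in>{i} \<times> A. f q) = (\<Sum>j\<in>A. f (i, j))"
  using sum.cartesian_product[of "\<lambda>a b. f (a, b)" A "{i}"] by simp

text \<open>Entry i of G w uses only row i, so distinct entries depend on disjoint blocks of
  independent variables. Within a row, right multiplication by w j scales norms by |w j|, and the
  sum is therefore c times a Gaussian scalar.\<close>

lemma distr_gaussian_rows:
  fixes w :: "nat \<Rightarrow> 'k::gaussian_scalar"
  assumes d: "d \<ge> 1"
  defines "c \<equiv> sqrt (\<Sum>j<d. (norm (w j))\<^sup>2)"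
  shows "distr (gauss_PiM ({..<d} \<times> {..<d})) (PiM {..<d} (\<lambda>_. borel))
      (\<lambda>G. \<lambda>i\<in>{..<d}. \<Sum>j<d. G (i, j) * w j) =
    PiM {..<d} (\<lambda>_. distr gaussian_entry borel (\<lambda>x. c *\<^sub>R x))"
proof (rule distr_indep_PiM[OF prob_space_gauss_PiM])
  let ?I = "{..<d} \<times> {..<d}"
  let ?P = "gauss_PiM ?I :: (nat \<times> nat \<Rightarrow> 'k) measure"
  interpret prob_space ?P by (rule prob_space_gauss_PiM)
  show "{..<d} \<noteq> {}" using d by (auto simp: lessThan_empty_iff)
  have ne: "?I \<noteq> {}" using d by (auto simp: lessThan_empty_iff)
  let ?K = "\<lambda>i. {i} \<times> {..<d}"
  let ?Y = "\<lambda>i g. \<Sum>q\<in>?K i. g q * w (snd q)"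
  have Y: "?Y i \<in> borel_measurable (PiM (?K i) (\<lambda>_. borel))" for i
    by (intro borel_measurable_sum borel_measurable_times measurable_component_singleton) auto
  have "indep_vars (\<lambda>i. PiM (?K i) (\<lambda>_. borel)) (\<lambda>i G. restrict (\<lambda>q. G q) (?K i)) {..<d}"
    by (rule indep_vars_restrict[OF indep_vars_gauss_PiM[OF ne]]) (auto simp: disjoint_family_on_def)
  from indep_vars_compose2[OF this, of ?Y "\<lambda>_. borel"] Y
  have "indep_vars (\<lambda>_. borel) (\<lambda>i G. ?Y i (restrict G (?K i))) {..<d}" by auto
  also have Y_eq: "(\<lambda>i G. ?Y i (restrict G (?K i))) = (\<lambda>i G. \<Sum>j<d. G (i, j) * w j)"
    by (intro ext) (simp add: sum_singleton_Times)
  finally show "indep_vars (\<lambda>_. borel) (\<lambda>i G. \<Sum>j<d. G (i, j) * w j) {..<d}" .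
  fix i assume i: "i \<in> {..<d}"
  interpret Q: product_prob_space "\<lambda>_. gaussian_entry :: 'k measure" ?I
    by standard
  have R: "(\<lambda>G. restrict G (?K i)) \<in> measurable ?P (gauss_PiM (?K i))"
    using i by (intro measurable_restrict_subset) auto
  have Ym: "?Y i \<in> borel_measurable (gauss_PiM (?K i))"
    using Y[of i] by (simp cong: measurable_cong_sets add: sets_gauss_PiM)
  have "distr ?P borel (\<lambda>G. \<Sum>j<d. G (i, j) * w j) = distr ?P borel (\<lambda>G. ?Y i (restrict G (?K i)))"
    by (intro arg_cong[where f = "distr ?P borel"] ext) (simp add: sum_singleton_Times)
  also have "\<dots> = distr (distr ?P (gauss_PiM (?K i)) (\<lambda>G. restrict G (?K i))) borel (?Y i)"
    using distr_distr[OF Ym R] by (simp add: comp_def)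
  also have "distr ?P (gauss_PiM (?K i)) (\<lambda>G. restrict G (?K i)) = gauss_PiM (?K i)"
    using i by (intro Q.distr_PiM_restrict_finite) auto
  also have "distr (gauss_PiM (?K i)) borel (?Y i) = distr gaussian_entry borel (\<lambda>x. c *\<^sub>R x)"
  proof (rule measure_eqI)
    fix A assume "A \<in> sets (distr (gauss_PiM (?K i)) borel (?Y i))"
    then have A[measurable]: "A \<in> sets borel" by simp
    have "emeasure (distr (gauss_PiM (?K i)) borel (?Y i)) A =
        (\<integral>\<^sup>+g. indicator A (?Y i g) \<partial>gauss_PiM (?K i))"
      using nn_integral_distr[OF Ym, of "indicator A"] by simp
    also have "\<dots> = (\<integral>\<^sup>+x. indicator A (sqrt (\<Sum>q\<in>?K i. (norm (w (snd q)))\<^sup>2) *\<^sub>R x) \<partial>gaussian_entry)"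
      by (rule gaussian_nn_integral_sum)
        (auto simp: norm_mult mult.commute algebra_simps intro!: linearI)
    also have "(\<Sum>q\<in>?K i. (norm (w (snd q)))\<^sup>2) = (\<Sum>j<d. (norm (w j))\<^sup>2)"
      by (simp add: sum_singleton_Times)
    also have "(\<integral>\<^sup>+x. indicator A (sqrt (\<Sum>j<d. (norm (w j))\<^sup>2) *\<^sub>R x) \<partial>gaussian_entry) =
        emeasure (distr gaussian_entry borel (\<lambda>x. c *\<^sub>R x)) A"
      unfolding c_def[symmetric]
      using nn_integral_distr[of "\<lambda>x. c *\<^sub>R x" gaussian_entry borel "indicator A"] by simp
    finally show "emeasure (distr (gauss_PiM (?K i)) borel (?Y i)) A =
        emeasure (distr gaussian_entry borel (\<lambda>x. c *\<^sub>R x)) A" .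
  qed simp
  finally show "distr ?P borel (\<lambda>G. \<Sum>j<d. G (i, j) * w j) = distr gaussian_entry borel (\<lambda>x. c *\<^sub>R x)" .
qed

lemma gaussian_rows_nn_integral:
  fixes w :: "nat \<Rightarrow> 'k::gaussian_scalar"
  assumes d: "d \<ge> 1" and F[measurable]: "F \<in> borel_measurable (PiM {..<d} (\<lambda>_. borel))"
  shows "(\<integral>\<^sup>+G. F (\<lambda>i\<in>{..<d}. \<Sum>j<d. G (i, j) * w j) \<partial>gauss_PiM ({..<d} \<times> {..<d})) =
    (\<integral>\<^sup>+g. F (\<lambda>i\<in>{..<d}. sqrt (\<Sum>j<d. (norm (w j))\<^sup>2) *\<^sub>R g i) \<partial>gauss_PiM {..<d})"
proof -
  have ne: "{..<d} \<noteq> {}" using d by (auto simp: lessThan_empty_iff)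
  let ?c = "sqrt (\<Sum>j<d. (norm (w j))\<^sup>2)"
  have 1: "(\<lambda>G. \<lambda>i\<in>{..<d}. \<Sum>j<d. G (i, j) * w j) \<in>
      measurable (gauss_PiM ({..<d} \<times> {..<d})) (PiM {..<d} (\<lambda>_. borel))"
    by (intro measurable_restrict borel_measurable_sum borel_measurable_times
        gauss_PiM_component_measurable) auto
  have 2: "(\<lambda>g. \<lambda>i\<in>{..<d}. ?c *\<^sub>R g i :: 'k) \<in>
      measurable (gauss_PiM {..<d}) (PiM {..<d} (\<lambda>_. borel))"
    by (intro measurable_restrict borel_measurable_scaleR gauss_PiM_component_measurable) auto
  show ?thesis
    using nn_integral_distr[OF 1, of F] nn_integral_distr[OF 2, of F] F
    unfolding distr_gaussian_rows[OF d] distr_gauss_PiM_scale[OF ne] by simp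
qed

lemma vec_norm_mult_vec:
  assumes "S \<in> carrier_mat n d"
  shows "vec_norm (S *\<^sub>v vec d g) = sqrt (\<Sum>i<n. (norm (\<Sum>j<d. S $$ (i, j) * g j))\<^sup>2)"
  using assms by (simp add: vec_norm_def index_mult_mat_vec_sum[where m=d] del: index_mult_mat_vec)

lemma measurable_vec_norm_mult_vec:
  fixes S :: "'k::gaussian_scalar mat"
  assumes "S \<in> carrier_mat n d"
  shows "(\<lambda>g. vec_norm (S *\<^sub>v vec d g)) \<in> borel_measurable (PiM {..<d} (\<lambda>_. borel))"
  unfolding vec_norm_mult_vec[OF assms] by measurable

lemma space_mat_borel [simp]: "space (mat_borel d) = carrier_mat d d"
  by (simp add: mat_borel_def)

lemma measurable_mat_borel_entry:
  assumes "i < d" "j < d"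
  shows "(\<lambda>A :: 'k::gaussian_scalar mat. A $$ (i, j)) \<in> borel_measurable (mat_borel d)"
proof -
  have "(\<lambda>A :: 'k mat. \<lambda>ij\<in>{..<d} \<times> {..<d}. A $$ ij) \<in> measurable (mat_borel d) (PiM ({..<d} \<times> {..<d}) (\<lambda>_. borel))"
    unfolding mat_borel_def by (rule measurable_vimage_algebra1) (auto simp: space_PiM)
  from measurable_compose[OF this measurable_component_singleton[of "(i, j)"]] assms
  show ?thesis by simp
qed

lemma measurable_mat_borelI:
  fixes A :: "'w \<Rightarrow> 'k::gaussian_scalar mat"
  assumes "\<And>x. x \<in> space N \<Longrightarrow> A x \<in> carrier_mat d d"
    and "\<And>i j. i < d \<Longrightarrow> j < d \<Longrightarrow> (\<lambda>x. A x $$ (i, j)) \<in> borel_measurable N"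
  shows "A \<in> measurable N (mat_borel d)"
  unfolding mat_borel_def
  by (rule measurable_vimage_algebra2) (use assms in \<open>auto intro!: measurable_restrict\<close>)

lemma measurable_mult_mat:
  fixes S :: "'k::gaussian_scalar mat"
  assumes S: "S \<in> carrier_mat d d"
  shows "(\<lambda>g. S * mat d d g) \<in> measurable (gauss_PiM ({..<d} \<times> {..<d})) (mat_borel d)"
proof (rule measurable_mat_borelI)
  fix i j assume ij: "i < d" "j < d"
  have "(\<lambda>g. \<Sum>l<d. S $$ (i, l) * g (l, j)) \<in> borel_measurable (gauss_PiM ({..<d} \<times> {..<d}))"
    using ij by (intro borel_measurable_sum borel_measurable_times gauss_PiM_component_measurable) auto
  then show "(\<lambda>g. (S * mat d d g) $$ (i, j)) \<in> borel_measurable (gauss_PiM ({..<d} \<times> {..<d}))"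
    using index_mult_mat_sum[OF S mat_carrier ij] ij by simp
qed (use S in auto)

text \<open>The vector w enters only through its norm. Hence the law of the growth factor of one
  random matrix does not depend on the direction to which it is applied.\<close>

lemma gaussian_matrix_law_nn_integral:
  fixes \<Sigma> :: "'k::gaussian_scalar mat"
  assumes d: "d \<ge> 1" and S: "mat_sqrt d \<Sigma> \<in> carrier_mat d d" and w: "w \<in> carrier_vec d"
    and h[measurable]: "h \<in> borel_measurable borel"
  shows "(\<integral>\<^sup>+A. h (vec_norm (A *\<^sub>v w)) \<partial>gaussian_matrix_law d \<Sigma>) =
    (\<integral>\<^sup>+g. h (vec_norm w * vec_norm (mat_sqrt d \<Sigma> *\<^sub>v vec d g)) \<partial>gauss_PiM {..<d})"
proof -
  let ?S = "mat_sqrt d \<Sigma>"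
  let ?F = "\<lambda>g. vec_norm (?S *\<^sub>v vec d g)"
  have "(\<lambda>A. sqrt (\<Sum>i<d. (norm (\<Sum>j<d. A $$ (i, j) * w $ j))\<^sup>2)) \<in> borel_measurable (mat_borel d)"
    by (intro measurable_compose[OF _ borel_measurable_sqrt] borel_measurable_sum borel_measurable_power
        measurable_compose[OF _ borel_measurable_norm] borel_measurable_times measurable_mat_borel_entry) auto
  also have "?this \<longleftrightarrow> (\<lambda>A. vec_norm (A *\<^sub>v w)) \<in> borel_measurable (mat_borel d)"
    using w by (intro measurable_cong)
      (auto simp: vec_norm_def index_mult_mat_vec_sum[where m=d and n=d] simp del: index_mult_mat_vec)
  finally have m: "(\<lambda>A. vec_norm (A *\<^sub>v w)) \<in> borel_measurable (mat_borel d)" .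
  have "(\<integral>\<^sup>+A. h (vec_norm (A *\<^sub>v w)) \<partial>gaussian_matrix_law d \<Sigma>) =
      (\<integral>\<^sup>+G. h (vec_norm (?S * mat d d G *\<^sub>v w)) \<partial>gauss_PiM ({..<d} \<times> {..<d}))"
    unfolding gaussian_matrix_law_def
    by (rule nn_integral_distr[OF measurable_mult_mat[OF S]]) (simp, rule measurable_compose[OF m h])
  also have "\<dots> = (\<integral>\<^sup>+G. h (?F (\<lambda>i\<in>{..<d}. \<Sum>j<d. G (i, j) * w $ j)) \<partial>gauss_PiM ({..<d} \<times> {..<d}))"
  proof (rule nn_integral_cong)
    fix G :: "nat \<times> nat \<Rightarrow> 'k"
    have "mat d d G *\<^sub>v w = vec d (\<lambda>i\<in>{..<d}. \<Sum>j<d. G (i, j) * w $ j)"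
      using w by (intro eq_vecI)
        (auto simp: index_mult_mat_vec_sum[where m=d and n=d] simp del: index_mult_mat_vec)
    then show "h (vec_norm (?S * mat d d G *\<^sub>v w)) = h (?F (\<lambda>i\<in>{..<d}. \<Sum>j<d. G (i, j) * w $ j))"
      using assoc_mult_mat_vec[OF S _ w, of "mat d d G"] by simp
  qed
  also have "\<dots> = (\<integral>\<^sup>+g. h (?F (\<lambda>i\<in>{..<d}. sqrt (\<Sum>j<d. (norm (w $ j))\<^sup>2) *\<^sub>R g i)) \<partial>gauss_PiM {..<d})"
    by (rule gaussian_rows_nn_integral[OF d, of "\<lambda>g. h (?F g)"])
      (rule measurable_compose[OF measurable_vec_norm_mult_vec[OF S] h])
  also have "\<dots> = (\<integral>\<^sup>+g. h (vec_norm w * ?F g) \<partial>gauss_PiM {..<d})"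
  proof (rule nn_integral_cong)
    fix g :: "nat \<Rightarrow> 'k"
    have "vec d (\<lambda>i\<in>{..<d}. vec_norm w *\<^sub>R g i) = of_real (vec_norm w) \<cdot>\<^sub>v vec d g"
      by (intro eq_vecI) (auto simp: scaleR_conv_of_real)
    moreover have "sqrt (\<Sum>j<d. (norm (w $ j))\<^sup>2) = vec_norm w"
      using w by (simp add: vec_norm_def)
    ultimately show "h (?F (\<lambda>i\<in>{..<d}. sqrt (\<Sum>j<d. (norm (w $ j))\<^sup>2) *\<^sub>R g i)) = h (vec_norm w * ?F g)"
      by (simp add: mult_mat_vec_smult_real[OF S] vec_norm_smult)
  qed
  finally show ?thesis .
qed

section \<open>Moments of Gaussian scalars\<close>

lemma distr_gaussian_entry_component:
  assumes b: "(b::'k::gaussian_scalar) \<in> Basis"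
  shows "distr gaussian_entry borel (\<lambda>x. inner x b) = density lborel (normal_density 0 (gauss_sd TYPE('k)))"
proof -
  let ?N = "density lborel (\<lambda>x. ennreal (normal_density 0 (gauss_sd TYPE('k)) x))"
  have "distr gaussian_entry borel (\<lambda>x. inner x b) = distr gauss_coords borel (\<lambda>x. x b)"
    unfolding gaussian_entry_eq_distr using b
    by (simp add: distr_distr comp_def inner_sum_left_Basis)
  also have "\<dots> = distr gauss_coords ?N (\<lambda>x. x b)"
    by (rule distr_cong) auto
  also have "\<dots> = ?N"
    using b by (intro distr_PiM_component prob_space_gaussian_component) auto
  finally show ?thesis .
qed

lemma gaussian_component_nn_integral:
  assumes b: "(b::'k::gaussian_scalar) \<in> Basis" and [measurable]: "f \<in> borel_measurable borel"
  shows "(\<integral>\<^sup>+x. f (inner x b) \<partial>gaussian_entry) =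
    (\<integral>\<^sup>+t. ennreal (normal_density 0 (gauss_sd TYPE('k)) t) * f t \<partial>lborel)"
proof -
  have "(\<integral>\<^sup>+x. f (inner x b) \<partial>gaussian_entry) = (\<integral>\<^sup>+t. f t \<partial>distr gaussian_entry borel (\<lambda>x. inner x b))"
    by (subst nn_integral_distr) auto
  then show ?thesis
    unfolding distr_gaussian_entry_component[OF b] by (simp add: nn_integral_density)
qed

lemma has_bochner_integral_gaussian_component:
  assumes b: "(b::'k::gaussian_scalar) \<in> Basis"
    and h: "has_bochner_integral lborel (\<lambda>t. normal_density 0 (gauss_sd TYPE('k)) t * f t) (z::real)"
    and [measurable]: "f \<in> borel_measurable borel"
  shows "has_bochner_integral gaussian_entry (\<lambda>x. f (inner x b)) z"
proof -
  have "has_bochner_integral (density lborel (normal_density 0 (gauss_sd TYPE('k)))) f z"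
    using h by (intro has_bochner_integral_density) auto
  then have "has_bochner_integral (distr gaussian_entry borel (\<lambda>x::'k. inner x b)) f z"
    unfolding distr_gaussian_entry_component[OF b] .
  then show ?thesis
    by (simp add: has_bochner_integral_iff integrable_distr_eq integral_distr)
qed

lemma gaussian_second_moment:
  "has_bochner_integral gaussian_entry (\<lambda>x::'k::gaussian_scalar. (norm x)\<^sup>2) 1"
proof -
  have "has_bochner_integral gaussian_entry (\<lambda>x::'k. (inner x b)\<^sup>2) (1 / real DIM('k))"
    if b: "b \<in> Basis" for b :: 'k
  proof (rule has_bochner_integral_gaussian_component[OF b])
    have "fact 2 / ((2 / (gauss_sd TYPE('k))\<^sup>2) ^ 1 * fact 1) = 1 / real DIM('k)"
      by (simp add: gauss_sd_def power_divide field_simps)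
    with normal_moment_even[of "gauss_sd TYPE('k)" 0 1]
    show "has_bochner_integral lborel (\<lambda>t. normal_density 0 (gauss_sd TYPE('k)) t * t\<^sup>2) (1 / real DIM('k))"
      by simp
  qed simp
  then have "has_bochner_integral gaussian_entry (\<lambda>x::'k. \<Sum>b\<in>Basis. (inner x b)\<^sup>2) (\<Sum>b\<in>(Basis::'k set). 1 / real DIM('k))"
    by (intro has_bochner_integral_sum) auto
  moreover have "(norm x)\<^sup>2 = (\<Sum>b\<in>Basis. (inner x b)\<^sup>2)" for x :: 'k
    unfolding power2_norm_eq_inner by (subst euclidean_inner) (simp add: power2_eq_square)
  ultimately show ?thesis by simp
qed

text \<open>The square of a sum of \<beta> terms is at most \<beta> times the sum of squares, which
  reduces the claim to fourth moments of real components.\<close>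

lemma gaussian_fourth_moment:
  "integrable gaussian_entry (\<lambda>x::'k::gaussian_scalar. (norm x) ^ 4)"
proof -
  have "integrable gaussian_entry (\<lambda>x::'k. (inner x b) ^ 4)" if b: "b \<in> Basis" for b :: 'k
    using has_bochner_integral_gaussian_component[OF b, of "\<lambda>t. t ^ 4"]
      normal_moment_even[of "gauss_sd TYPE('k)" 0 2] by (auto intro: integrable.intros)
  then have i: "integrable gaussian_entry (\<lambda>x::'k. real DIM('k) * (\<Sum>b\<in>Basis. (inner x b) ^ 4))"
    by (intro integrable_mult_right integrable_sum) auto
  show ?thesis
  proof (rule Bochner_Integration.integrable_bound[OF i])
    show "AE x::'k in gaussian_entry. norm ((norm x) ^ 4) \<le> norm (real DIM('k) * (\<Sum>b\<in>Basis. (inner x b) ^ 4))"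
    proof (intro AE_I2)
      fix x :: 'k
      have "(norm x) ^ 4 = ((norm x)\<^sup>2)\<^sup>2" by simp
      also have "(norm x)\<^sup>2 = (\<Sum>b\<in>Basis. (inner x b)\<^sup>2)"
        unfolding power2_norm_eq_inner by (subst euclidean_inner) (simp add: power2_eq_square)
      also have "(\<Sum>b\<in>Basis. (inner x b)\<^sup>2)\<^sup>2 \<le> real DIM('k) * (\<Sum>b\<in>Basis. ((inner x b)\<^sup>2)\<^sup>2)"
        using sum_squared_le_sum_of_squares[of "\<lambda>b. (inner x b)\<^sup>2" Basis] by (simp add: mult.commute)
      finally show "norm ((norm x) ^ 4) \<le> norm (real DIM('k) * (\<Sum>b\<in>Basis. (inner x b) ^ 4))"
        by (simp add: sum_nonneg)
    qed
  qed simp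
qed

lemma inverse_ennreal_antimono:
  assumes "0 \<le> a" "a \<le> b"
  shows "inverse (ennreal b) \<le> inverse (ennreal a)"
  using assms by (cases "a = 0") (auto simp: inverse_ennreal intro!: ennreal_leI le_imp_inverse_le)

lemma nn_integral_inverse_sqrt_unit:
  "(\<integral>\<^sup>+t. inverse (ennreal (\<bar>t\<bar> powr (1/2))) * indicator {-1..1} t \<partial>lborel) < \<infinity>"
proof -
  let ?f = "\<lambda>t::real. inverse (ennreal (\<bar>t\<bar> powr (1/2)))"
  have pos: "(\<integral>\<^sup>+t. ?f t * indicator {0..1} t \<partial>lborel) = 2"
  proof -
    \<comment> \<open>At t = 0 the inverse in \<open>ennreal\<close> is infinite while
      \<open>0 powr (-1/2)\<close> is 0; the integrands agree only off this null set.\<close>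
    have ae: "AE t::real in lborel. t \<noteq> 0" by (rule AE_lborel_singleton)
    have "(\<integral>\<^sup>+t. ?f t * indicator {0..1} t \<partial>lborel) =
        (\<integral>\<^sup>+t. ennreal (t powr (-1/2)) * indicator {0..1} t \<partial>lborel)"
      by (rule nn_integral_cong_AE, use ae in eventually_elim)
        (auto simp: indicator_def inverse_ennreal powr_minus)
    also have "\<dots> = ennreal (1 powr (-1/2 + 1) / (-1/2 + 1))"
      by (rule nn_integral_has_integral_lebesgue'[OF _ has_integral_powr_from_0]) auto
    finally show ?thesis by simp
  qed
  have neg: "(\<integral>\<^sup>+t. ?f t * indicator {-1..0} t \<partial>lborel) = 2"
  proof -
    have "(\<integral>\<^sup>+t. ?f t * indicator {-1..0} t \<partial>lborel) =
        (\<integral>\<^sup>+t. ?f (- t) * indicator {-1..0} (- t) \<partial>lborel)"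
      by (subst lborel_distr_uminus[symmetric]) (simp add: nn_integral_distr)
    also have "\<dots> = (\<integral>\<^sup>+t. ?f t * indicator {0..1} t \<partial>lborel)"
      by (intro nn_integral_cong) (auto simp: indicator_def)
    finally show ?thesis by (simp add: pos)
  qed
  have "(\<integral>\<^sup>+t. ?f t * indicator {-1..1} t \<partial>lborel) \<le>
      (\<integral>\<^sup>+t. ?f t * indicator {0..1} t + ?f t * indicator {-1..0} t \<partial>lborel)"
    by (intro nn_integral_mono) (auto simp: indicator_def)
  also have "\<dots> = 2 + 2" by (simp add: nn_integral_add pos neg)
  finally show ?thesis by (rule le_less_trans) (simp add: ennreal_add_less_top)
qed

text \<open>E |x|^(-1/2), with \<open>inverse\<close> in \<open>ennreal\<close> because
  \<open>powr\<close> with a negative exponent would give 0 at 0 and hide the singularity.\<close>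

definition gauss_neg_moment :: "'k::gaussian_scalar itself \<Rightarrow> ennreal" where
  "gauss_neg_moment _ = (\<integral>\<^sup>+x. inverse (ennreal (norm (x::'k) powr (1/2))) \<partial>gaussian_entry)"

text \<open>The norm dominates one real coordinate t, so E |t|^(-1/2) is an upper bound. On [-1, 1]
  the density is at most its peak K and |t|^(-1/2) is integrable; outside, |t|^(-1/2) \<le>
  1.\<close>

lemma gauss_neg_moment_finite: "gauss_neg_moment TYPE('k::gaussian_scalar) < \<infinity>"
proof -
  obtain b :: 'k where b: "b \<in> Basis" using nonempty_Basis by blast
  let ?nd = "normal_density 0 (gauss_sd TYPE('k))"
  let ?f = "\<lambda>t::real. inverse (ennreal (\<bar>t\<bar> powr (1/2)))"
  define K where "K = 1 / sqrt (2 * pi * (gauss_sd TYPE('k))\<^sup>2)"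
  have "gauss_neg_moment TYPE('k) \<le> (\<integral>\<^sup>+x. ?f (inner x b) \<partial>gaussian_entry)"
    unfolding gauss_neg_moment_def
    by (intro nn_integral_mono inverse_ennreal_antimono powr_mono2) (auto simp: Basis_le_norm b)
  also have "\<dots> = (\<integral>\<^sup>+t. ennreal (?nd t) * ?f t \<partial>lborel)"
    by (rule gaussian_component_nn_integral[OF b]) measurable
  also have "\<dots> \<le> (\<integral>\<^sup>+t. ennreal K * (?f t * indicator {-1..1} t) + ennreal (?nd t) \<partial>lborel)"
  proof (rule nn_integral_mono)
    fix t :: real
    show "ennreal (?nd t) * ?f t \<le> ennreal K * (?f t * indicator {-1..1} t) + ennreal (?nd t)"
    proof (cases "\<bar>t\<bar> \<le> 1")
      case True
      have "?nd t \<le> K"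
        unfolding normal_density_def K_def by (intro mult_left_le) auto
      then have "ennreal (?nd t) * ?f t \<le> ennreal K * ?f t"
        by (intro mult_right_mono ennreal_leI) auto
      also have "\<dots> \<le> ennreal K * (?f t * indicator {-1..1} t) + ennreal (?nd t)"
        using True by (auto simp: indicator_def)
      finally show ?thesis .
    next
      case False
      then have "1 \<le> \<bar>t\<bar> powr (1/2)" by (intro ge_one_powr_ge_zero) auto
      then have "?f t \<le> inverse (ennreal 1)" by (intro inverse_ennreal_antimono) auto
      then have "ennreal (?nd t) * ?f t \<le> ennreal (?nd t) * 1" by (intro mult_left_mono) auto
      then show ?thesis by (auto intro: add_increasing)
    qed
  qed
  also have "\<dots> = ennreal K * (\<integral>\<^sup>+t. ?f t * indicator {-1..1} t \<partial>lborel) + (\<integral>\<^sup>+t. ennreal (?nd t) \<partial>lborel)"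
    by (simp add: nn_integral_add nn_integral_cmult)
  also have "(\<integral>\<^sup>+t. ennreal (?nd t) \<partial>lborel) = 1"
    using integral_normal_density[of "gauss_sd TYPE('k)" 0] integrable_normal_density[of "gauss_sd TYPE('k)" 0]
    by (simp add: nn_integral_eq_integral)
  also have "ennreal K * (\<integral>\<^sup>+t. ?f t * indicator {-1..1} t \<partial>lborel) + 1 < \<infinity>"
    using nn_integral_inverse_sqrt_unit by (simp add: ennreal_mult_less_top ennreal_add_less_top)
  finally show ?thesis .
qed

section \<open>Variance of quadratic forms and estimates for the logarithm\<close>

section \<open>Concentration of quadratic forms\<close>

text \<open>The form of the leading n by n block, with n a separate argument so that one coordinate
  at a time can be added to it. \<open>re_trace\<close> and \<open>frob\<close> (the squared
  Frobenius norm) are cut off in the same way.\<close>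

definition quad :: "'k::gaussian_scalar mat \<Rightarrow> nat \<Rightarrow> (nat \<Rightarrow> 'k) \<Rightarrow> real" where
  "quad A n g = (\<Sum>i<n. \<Sum>j<n. inner (g i) (A $$ (i, j) * g j))"

definition re_trace :: "'k::gaussian_scalar mat \<Rightarrow> nat \<Rightarrow> real" where
  "re_trace A n = (\<Sum>i<n. inner 1 (A $$ (i, i)))"

definition frob :: "'k::gaussian_scalar mat \<Rightarrow> nat \<Rightarrow> real" where
  "frob A n = (\<Sum>i<n. \<Sum>j<n. (norm (A $$ (i, j)))\<^sup>2)"

text \<open>The variance of |x|^2, since |x|^2 has mean 1.\<close>

definition gauss_var :: "'k::gaussian_scalar itself \<Rightarrow> real" where
  "gauss_var _ = (\<integral>x. ((norm (x::'k))\<^sup>2 - 1)\<^sup>2 \<partial>gaussian_entry)"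

lemma gauss_integrable_var: "integrable gaussian_entry (\<lambda>x::'k::gaussian_scalar. ((norm x)\<^sup>2 - 1)\<^sup>2)"
proof -
  have "integrable gaussian_entry (\<lambda>x::'k. (norm x) ^ 4 - 2 * (norm x)\<^sup>2 + 1)"
    using gaussian_second_moment[where 'k='k]
    by (intro Bochner_Integration.integrable_add Bochner_Integration.integrable_diff gaussian_fourth_moment
        integrable_mult_right) (auto simp: has_bochner_integral_iff)
  moreover have "((norm x)\<^sup>2 - 1)\<^sup>2 = (norm x) ^ 4 - 2 * (norm x)\<^sup>2 + 1" for x :: 'k
    by (simp add: power2_eq_square algebra_simps numeral_eq_Suc)
  ultimately show ?thesis by simp
qed

lemma gauss_var_nonneg: "0 \<le> gauss_var TYPE('k::gaussian_scalar)"
  by (simp add: gauss_var_def)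

lemma gauss_inner_integrals:
  fixes w :: "'k::gaussian_scalar"
  shows "integrable gaussian_entry (\<lambda>x. inner x w)" "(\<integral>x. inner x w \<partial>gaussian_entry) = 0"
    "integrable gaussian_entry (\<lambda>x. (inner x w)\<^sup>2)" "(\<integral>x. (inner x w)\<^sup>2 \<partial>gaussian_entry) \<le> (norm w)\<^sup>2"
proof -
  have i2: "integrable gaussian_entry (\<lambda>x::'k. (norm x)\<^sup>2)" and e2: "(\<integral>x. (norm (x::'k))\<^sup>2 \<partial>gaussian_entry) = 1"
    using gaussian_second_moment[where 'k='k] by (auto simp: has_bochner_integral_iff)
  have le: "(inner x w)\<^sup>2 \<le> (norm w)\<^sup>2 * (norm x)\<^sup>2" for x
    using Cauchy_Schwarz_ineq[of x w] by (simp add: power2_norm_eq_inner mult.commute)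
  show i: "integrable gaussian_entry (\<lambda>x. (inner x w)\<^sup>2)"
    by (rule Bochner_Integration.integrable_bound[OF integrable_mult_right[OF i2, of "(norm w)\<^sup>2"]])
      (use le in auto)
  have "(\<integral>x. (inner x w)\<^sup>2 \<partial>gaussian_entry) \<le> (\<integral>x. (norm w)\<^sup>2 * (norm (x::'k))\<^sup>2 \<partial>gaussian_entry)"
    by (intro integral_mono i integrable_mult_right i2 le)
  then show "(\<integral>x. (inner x w)\<^sup>2 \<partial>gaussian_entry) \<le> (norm w)\<^sup>2" by (simp add: e2)
  show "integrable gaussian_entry (\<lambda>x. inner x w)"
  proof (rule Bochner_Integration.integrable_bound)
    show "integrable gaussian_entry (\<lambda>x. 1 + (inner x w)\<^sup>2)"
      using i by (intro Bochner_Integration.integrable_add) auto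
    show "AE x in gaussian_entry. norm (inner x w) \<le> norm (1 + (inner x w)\<^sup>2)"
    proof (intro AE_I2)
      fix x
      have "0 \<le> (\<bar>inner x w\<bar> - 1)\<^sup>2" by simp
      then show "norm (inner x w) \<le> norm (1 + (inner x w)\<^sup>2)"
        by (simp add: power2_eq_square algebra_simps abs_mult_self_eq)
    qed
  qed simp
  have "(\<integral>x. inner (- x) w \<partial>gaussian_entry) = (\<integral>x. inner x w \<partial>gaussian_entry)"
    by (rule gaussian_integral_uminus[of "\<lambda>x. inner x w"]) simp
  then show "(\<integral>x. inner x w \<partial>gaussian_entry) = 0" by simp
qed

text \<open>The increment Z = 2 <y, w> + a (|y|^2 - 1) has mean zero, so the cross term with F
  disappears. The coefficients 8 and 2 come from (p + q)^2 \<le> 2 p^2 + 2 q^2 for the two parts of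
  Z.\<close>

lemma gaussian_increment_second_moment:
  fixes w :: "'k::gaussian_scalar"
  shows "(\<integral>\<^sup>+y. ennreal ((F + 2 * inner y w + a * ((norm y)\<^sup>2 - 1))\<^sup>2) \<partial>gaussian_entry) \<le>
    ennreal (F\<^sup>2) + ennreal (8 * (norm w)\<^sup>2) + ennreal (2 * a\<^sup>2 * gauss_var TYPE('k))"
proof -
  define Z where "Z y = 2 * inner y w + a * ((norm y)\<^sup>2 - 1)" for y :: 'k
  have i2: "integrable gaussian_entry (\<lambda>x::'k. (norm x)\<^sup>2)" and e2: "(\<integral>x. (norm (x::'k))\<^sup>2 \<partial>gaussian_entry) = 1"
    using gaussian_second_moment[where 'k='k] by (auto simp: has_bochner_integral_iff)
  have iZ: "integrable gaussian_entry Z"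
    unfolding Z_def using gauss_inner_integrals(1)[of w] i2
    by (intro Bochner_Integration.integrable_add Bochner_Integration.integrable_diff integrable_mult_right) auto
  have eZ: "(\<integral>y. Z y \<partial>gaussian_entry) = 0"
    unfolding Z_def using gauss_inner_integrals(1,2)[of w] i2 e2
    by (simp add: gaussian.prob_space[simplified])
  have bound: "(Z y)\<^sup>2 \<le> 8 * (inner y w)\<^sup>2 + 2 * a\<^sup>2 * ((norm y)\<^sup>2 - 1)\<^sup>2" for y
  proof -
    have "0 \<le> (2 * inner y w - a * ((norm y)\<^sup>2 - 1))\<^sup>2" by simp
    then show ?thesis unfolding Z_def by (simp add: power2_eq_square algebra_simps)
  qed
  have ib: "integrable gaussian_entry (\<lambda>y. 8 * (inner y w)\<^sup>2 + 2 * a\<^sup>2 * ((norm y)\<^sup>2 - 1)\<^sup>2)"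
    using gauss_inner_integrals(3)[of w] gauss_integrable_var
    by (intro Bochner_Integration.integrable_add integrable_mult_right) auto
  have mZ: "Z \<in> borel_measurable borel" unfolding Z_def by measurable
  have iZ2: "integrable gaussian_entry (\<lambda>y. (Z y)\<^sup>2)"
    using bound mZ by (intro Bochner_Integration.integrable_bound[OF ib]) (auto intro!: AE_I2)
  have "(\<integral>y. (Z y)\<^sup>2 \<partial>gaussian_entry) \<le>
      (\<integral>y. 8 * (inner y w)\<^sup>2 + 2 * a\<^sup>2 * ((norm y)\<^sup>2 - 1)\<^sup>2 \<partial>gaussian_entry)"
    by (rule integral_mono[OF iZ2 ib bound])
  also have "\<dots> = 8 * (\<integral>y. (inner y w)\<^sup>2 \<partial>gaussian_entry) + 2 * a\<^sup>2 * gauss_var TYPE('k)"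
    unfolding gauss_var_def using gauss_inner_integrals(3)[of w] gauss_integrable_var
    by (subst Bochner_Integration.integral_add) auto
  finally have Z2: "(\<integral>y. (Z y)\<^sup>2 \<partial>gaussian_entry) \<le> 8 * (norm w)\<^sup>2 + 2 * a\<^sup>2 * gauss_var TYPE('k)"
    using gauss_inner_integrals(4)[of w] by linarith
  have eq: "(F + Z y)\<^sup>2 = F\<^sup>2 + 2 * F * Z y + (Z y)\<^sup>2" for y
    by (simp add: power2_eq_square algebra_simps)
  have iF: "integrable gaussian_entry (\<lambda>y. F\<^sup>2 + 2 * F * Z y + (Z y)\<^sup>2)"
    using iZ iZ2 by (intro Bochner_Integration.integrable_add integrable_mult_right) auto
  have "(\<integral>\<^sup>+y. ennreal ((F + Z y)\<^sup>2) \<partial>gaussian_entry) = ennreal (\<integral>y. (F + Z y)\<^sup>2 \<partial>gaussian_entry)"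
    by (rule nn_integral_eq_integral) (use iF in \<open>simp add: eq\<close>, simp)
  also have "(\<integral>y. (F + Z y)\<^sup>2 \<partial>gaussian_entry) = F\<^sup>2 + (\<integral>y. (Z y)\<^sup>2 \<partial>gaussian_entry)"
    unfolding eq using iZ iZ2 eZ by (simp add: gaussian.prob_space[simplified])
  also have "ennreal \<dots> \<le> ennreal (F\<^sup>2 + (8 * (norm w)\<^sup>2 + 2 * a\<^sup>2 * gauss_var TYPE('k)))"
    using Z2 by (intro ennreal_leI) simp
  also have "\<dots> = ennreal (F\<^sup>2) + ennreal (8 * (norm w)\<^sup>2) + ennreal (2 * a\<^sup>2 * gauss_var TYPE('k))"
    using gauss_var_nonneg[where 'k='k] by (simp add: add.assoc)
  finally show ?thesis by (simp add: Z_def add.assoc)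
qed

text \<open>Self-adjointness makes the new row and the new column contribute equally, hence the
  factor 2, and makes the diagonal entry real. In this form the increment is centred for fixed
  g.\<close>

lemma quad_Suc:
  fixes A :: "'k::gaussian_scalar mat"
  assumes A: "self_adjoint d A" and n: "Suc n \<le> d"
  shows "quad A (Suc n) (g(n := y)) - re_trace A (Suc n) =
    (quad A n g - re_trace A n) + 2 * inner y (\<Sum>j<n. A $$ (n, j) * g j) +
      inner 1 (A $$ (n, n)) * ((norm y)\<^sup>2 - 1)"
proof -
  have "A $$ (n, n) = of_real (inner 1 (A $$ (n, n)))"
    using A n by (intro self_conjugate_real) (auto simp: self_adjoint_def)
  then have diag: "inner y (A $$ (n, n) * y) = inner 1 (A $$ (n, n)) * (norm y)\<^sup>2"
    by (metis inner_scaleR_right power2_norm_eq_inner scaleR_conv_of_real)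
  have sym: "inner (g i) (A $$ (i, n) * y) = inner y (A $$ (n, i) * g i)" if "i < n" for i
    using A n that inner_mult_conjugate[of "A $$ (i, n)" y "g i"]
    by (simp add: self_adjoint_def inner_commute)
  have "quad A (Suc n) (g(n := y)) = quad A n g + (\<Sum>i<n. inner (g i) (A $$ (i, n) * y)) +
      (\<Sum>j<n. inner y (A $$ (n, j) * g j)) + inner y (A $$ (n, n) * y)"
    by (simp add: quad_def sum.distrib)
  also have "(\<Sum>i<n. inner (g i) (A $$ (i, n) * y)) = (\<Sum>j<n. inner y (A $$ (n, j) * g j))"
    using sym by (intro sum.cong) auto
  finally have F: "quad A (Suc n) (g(n := y)) = quad A n g + (\<Sum>j<n. inner y (A $$ (n, j) * g j)) +
      (\<Sum>j<n. inner y (A $$ (n, j) * g j)) + inner y (A $$ (n, n) * y)" .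
  show ?thesis
    unfolding F by (simp add: diag re_trace_def inner_sum_right algebra_simps)
qed

lemma measurable_quad: "quad A n \<in> borel_measurable (PiM {..<n} (\<lambda>_. borel :: 'k::gaussian_scalar measure))"
  unfolding quad_def by measurable

text \<open>The centred form is a martingale as coordinates are added, so the second moments of its
  increments add up. Averaging |w|^2 over the earlier coordinates gives the squared norm of the new
  row left of the diagonal. The factor 8 + 2 Var dominates both the off-diagonal cost 8 and the
  diagonal cost 2 Var.\<close>

lemma quad_variance:
  fixes A :: "'k::gaussian_scalar mat"
  assumes A: "self_adjoint d A" and n: "n \<le> d"
  shows "(\<integral>\<^sup>+g. ennreal ((quad A n g - re_trace A n)\<^sup>2) \<partial>gauss_PiM {..<n}) \<le>
    ennreal ((8 + 2 * gauss_var TYPE('k)) * frob A n)"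
  using n
proof (induction n)
  case 0
  then show ?case by (simp add: quad_def re_trace_def frob_def)
next
  case (Suc n)
  let ?v = "gauss_var TYPE('k)"
  let ?w = "\<lambda>g. \<Sum>j<n. A $$ (n, j) * g j"
  let ?a = "inner 1 (A $$ (n, n))"
  let ?r = "\<Sum>j<n. (norm (A $$ (n, j)))\<^sup>2"
  have v: "?v \<ge> 0" by (rule gauss_var_nonneg)
  have P1: "emeasure (gauss_PiM {..<n} :: (nat \<Rightarrow> 'k) measure) (space (gauss_PiM {..<n})) = 1"
    by (rule prob_space.emeasure_space_1[OF prob_space_gauss_PiM])
  have m1: "quad A n \<in> borel_measurable (gauss_PiM {..<n})"
    using measurable_quad[of A n] by (simp cong: measurable_cong_sets add: sets_gauss_PiM)
  have m2: "?w \<in> borel_measurable (gauss_PiM {..<n})"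
    by (intro borel_measurable_sum borel_measurable_times gauss_PiM_component_measurable) auto
  have m3: "quad A (Suc n) \<in> borel_measurable (gauss_PiM {..<Suc n})"
    using measurable_quad[of A "Suc n"] by (simp cong: measurable_cong_sets add: sets_gauss_PiM)
  have "(\<integral>\<^sup>+g. ennreal ((quad A (Suc n) g - re_trace A (Suc n))\<^sup>2) \<partial>gauss_PiM {..<Suc n}) =
      (\<integral>\<^sup>+g. \<integral>\<^sup>+y. ennreal ((quad A (Suc n) (g(n := y)) - re_trace A (Suc n))\<^sup>2) \<partial>gaussian_entry \<partial>gauss_PiM {..<n})"
    using m3 unfolding lessThan_Suc
    by (intro gaussian_prod.product_nn_integral_insert) auto
  also have "\<dots> \<le> (\<integral>\<^sup>+g. ennreal ((quad A n g - re_trace A n)\<^sup>2) + ennreal (8 * (norm (?w g))\<^sup>2) +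
      ennreal (2 * ?a\<^sup>2 * ?v) \<partial>gauss_PiM {..<n})"
    unfolding quad_Suc[OF A Suc.prems]
    by (intro nn_integral_mono gaussian_increment_second_moment)
  also have "\<dots> = (\<integral>\<^sup>+g. ennreal ((quad A n g - re_trace A n)\<^sup>2) \<partial>gauss_PiM {..<n}) +
      (\<integral>\<^sup>+g. ennreal (8 * (norm (?w g))\<^sup>2) \<partial>gauss_PiM {..<n}) + ennreal (2 * ?a\<^sup>2 * ?v)"
    using m1 m2 P1 by (simp add: nn_integral_add)
  also have "(\<integral>\<^sup>+g. ennreal (8 * (norm (?w g))\<^sup>2) \<partial>gauss_PiM {..<n}) =
      (\<integral>\<^sup>+x. ennreal (8 * (norm (sqrt ?r *\<^sub>R (x::'k)))\<^sup>2) \<partial>gaussian_entry)"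
    by (rule gaussian_nn_integral_sum[where f = "\<lambda>x. ennreal (8 * (norm x)\<^sup>2)" and T = "\<lambda>j x. A $$ (n, j) * x"])
      (auto simp: norm_mult algebra_simps intro!: linearI)
  also have "\<dots> = ennreal (\<integral>x. 8 * ?r * (norm (x::'k))\<^sup>2 \<partial>gaussian_entry)"
  proof -
    have "8 * (norm (sqrt ?r *\<^sub>R (x::'k)))\<^sup>2 = 8 * ?r * (norm x)\<^sup>2" for x
      by (simp add: power_mult_distrib sum_nonneg)
    then show ?thesis
      using gaussian_second_moment[where 'k='k]
      by (simp only:) (intro nn_integral_eq_integral integrable_mult_right AE_I2,
          auto simp: has_bochner_integral_iff sum_nonneg)
  qed
  also have "(\<integral>x. 8 * ?r * (norm (x::'k))\<^sup>2 \<partial>gaussian_entry) = 8 * ?r"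
    using gaussian_second_moment[where 'k='k] by (simp add: has_bochner_integral_iff)
  finally have "(\<integral>\<^sup>+g. ennreal ((quad A (Suc n) g - re_trace A (Suc n))\<^sup>2) \<partial>gauss_PiM {..<Suc n}) \<le>
      ennreal ((8 + 2 * ?v) * frob A n) + ennreal (8 * ?r) + ennreal (2 * ?a\<^sup>2 * ?v)"
    using Suc by (auto elim!: order_trans intro!: add_right_mono)
  also have "\<dots> = ennreal ((8 + 2 * ?v) * frob A n + 8 * ?r + 2 * ?a\<^sup>2 * ?v)"
    using v by (simp add: frob_def sum_nonneg)
  also have "\<dots> \<le> ennreal ((8 + 2 * ?v) * frob A (Suc n))"
  proof (rule ennreal_leI)
    have "\<bar>?a\<bar> \<le> norm (1::'k) * norm (A $$ (n, n))" by (rule Cauchy_Schwarz_ineq2)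
    then have "?a\<^sup>2 \<le> (norm (A $$ (n, n)))\<^sup>2" by (simp add: abs_le_square_iff[symmetric])
    then have "2 * ?a\<^sup>2 * ?v \<le> (8 + 2 * ?v) * (norm (A $$ (n, n)))\<^sup>2"
      using v by (simp add: algebra_simps) (smt (verit) mult_left_mono zero_le_power2)
    moreover have "8 * ?r \<le> (8 + 2 * ?v) * ?r"
      using v by (intro mult_right_mono) (auto simp: sum_nonneg)
    moreover have "frob A (Suc n) = frob A n + (\<Sum>i<n. (norm (A $$ (i, n)))\<^sup>2) + ?r + (norm (A $$ (n, n)))\<^sup>2"
      by (simp add: frob_def sum.distrib)
    moreover have "0 \<le> (8 + 2 * ?v) * (\<Sum>i<n. (norm (A $$ (i, n)))\<^sup>2)"
      using v by (intro mult_nonneg_nonneg sum_nonneg) auto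
    ultimately show "(8 + 2 * ?v) * frob A n + 8 * ?r + 2 * ?a\<^sup>2 * ?v \<le> (8 + 2 * ?v) * frob A (Suc n)"
      by (simp add: distrib_left)
  qed
  finally show ?case .
qed

lemma quad_eq_rip:
  assumes A: "A \<in> carrier_mat d d"
  shows "quad A d g = rip (vec d g) (A *\<^sub>v vec d g)"
  using A by (simp add: quad_def rip_def index_mult_mat_vec_sum[where m=d] inner_sum_right
      del: index_mult_mat_vec)

text \<open>Each column is A applied to a unit vector and so has norm at most c. With c of order 1/d
  the sum over d columns is of order 1/d.\<close>

lemma frob_le:
  fixes A :: "'k::gaussian_scalar mat"
  assumes A: "self_adjoint d A" and c: "0 \<le> c"
    and psd: "\<And>v. v \<in> carrier_vec d \<Longrightarrow> 0 \<le> rip v (A *\<^sub>v v)"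
    and le: "\<And>v. v \<in> carrier_vec d \<Longrightarrow> rip v (A *\<^sub>v v) \<le> c * (vec_norm v)\<^sup>2"
  shows "frob A d \<le> real d * c\<^sup>2"
proof -
  have A': "A \<in> carrier_mat d d" using A by (simp add: self_adjoint_def)
  have "(\<Sum>i<d. (norm (A $$ (i, j)))\<^sup>2) \<le> c\<^sup>2" if j: "j < d" for j
  proof -
    have "(\<Sum>i<d. (norm (A $$ (i, j)))\<^sup>2) = (vec_norm (A *\<^sub>v unit_vec d j))\<^sup>2"
      using A' j by (simp add: vec_norm_def sum_nonneg mult_mat_unit_vec_index[OF A'] del: index_mult_mat_vec)
    also have "\<dots> \<le> (c * vec_norm (unit_vec d j :: 'k vec))\<^sup>2"
      by (intro power_mono psd_vec_norm_le[OF sym_op_mult_mat_vec[OF A] psd le c]) auto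
    finally show ?thesis using j by simp
  qed
  then have "(\<Sum>j<d. \<Sum>i<d. (norm (A $$ (i, j)))\<^sup>2) \<le> (\<Sum>j<d. c\<^sup>2)"
    by (intro sum_mono) auto
  then show ?thesis unfolding frob_def by (subst sum.swap) simp
qed

section \<open>Logarithmic moments\<close>

text \<open>Multiplying 1 - z \<le> exp (-z) by exp z gives exp z - 1 \<le> z exp z. Hence exp z - 1
  - z \<le> z (exp z - 1), and the right side is bounded according to the sign of z.\<close>

lemma exp_le_quadratic: "exp z \<le> 1 + z + z\<^sup>2 * exp \<bar>z\<bar>" for z :: real
proof -
  have "1 - z \<le> exp (- z)" using exp_ge_add_one_self[of "- z"] by simp
  then have "exp z * (1 - z) \<le> exp z * exp (- z)" by (intro mult_left_mono) auto
  then have 1: "exp z - 1 \<le> z * exp z" by (simp add: algebra_simps flip: exp_add)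
  have 2: "1 + z \<le> exp z" by (rule exp_ge_add_one_self)
  have "z * (exp z - 1) \<le> z\<^sup>2 * exp \<bar>z\<bar>"
  proof (cases "z \<ge> 0")
    case True
    then have "z * (exp z - 1) \<le> z * (z * exp z)" using 1 by (intro mult_left_mono)
    then show ?thesis using True by (simp add: power2_eq_square mult.assoc)
  next
    case False
    then have "z * (exp z - 1) \<le> z * z" using 2 by (intro mult_left_mono_neg) linarith+
    also have "z * z \<le> z * z * exp \<bar>z\<bar>" by (simp add: mult_le_cancel_left1)
    finally show ?thesis by (simp add: power2_eq_square)
  qed
  moreover have "exp z - 1 - z \<le> z * (exp z - 1)" using 1 by (simp add: algebra_simps)
  ultimately show ?thesis by simp
qed

text \<open>Half of the exponent |y|/2 absorbs the polynomial factor: (|y|/4)^2 / 2 \<le> exp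
  (|y|/4), that is, y^2 \<le> 32 exp (|y|/4).\<close>

lemma square_exp_le: "y\<^sup>2 * exp (\<bar>y\<bar> / 4) \<le> 32 * (exp (y / 2) + exp (- y / 2))" for y :: real
proof -
  have "(\<bar>y\<bar> / 4)\<^sup>2 / 2 \<le> exp (\<bar>y\<bar> / 4)"
    using exp_lower_Taylor_quadratic[of "\<bar>y\<bar> / 4"] by (simp add: add_increasing)
  then have "y\<^sup>2 \<le> 32 * exp (\<bar>y\<bar> / 4)" by (simp add: power_divide)
  then have "y\<^sup>2 * exp (\<bar>y\<bar> / 4) \<le> 32 * exp (\<bar>y\<bar> / 4) * exp (\<bar>y\<bar> / 4)"
    by (intro mult_right_mono) auto
  also have "\<dots> = 32 * exp (\<bar>y\<bar> / 2)" by (simp flip: exp_add)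
  also have "\<dots> \<le> 32 * (exp (y / 2) + exp (- y / 2))" by (simp add: abs_if)
  finally show ?thesis .
qed

text \<open>For y = \<open>ln N\<close> the last bracket is N^(1/2) + N^(-1/2), whose expectation is
  finite. Restricting |s| to 1/4 leaves room in the exponent 1/2 for the factor y^2.\<close>

lemma exp_scaled_le:
  fixes s y :: real
  assumes "\<bar>s\<bar> \<le> 1/4"
  shows "exp (s * y) \<le> 1 + s * y + 32 * s\<^sup>2 * (exp (y / 2) + exp (- y / 2))"
proof -
  have "exp (s * y) \<le> 1 + s * y + (s * y)\<^sup>2 * exp \<bar>s * y\<bar>" by (rule exp_le_quadratic)
  also have "(s * y)\<^sup>2 * exp \<bar>s * y\<bar> \<le> s\<^sup>2 * (y\<^sup>2 * exp (\<bar>y\<bar> / 4))"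
    using mult_right_mono[OF assms, of "\<bar>y\<bar>"]
    by (simp add: power_mult_distrib abs_mult mult.assoc mult_left_mono)
  also have "\<dots> \<le> s\<^sup>2 * (32 * (exp (y / 2) + exp (- y / 2)))"
    by (intro mult_left_mono square_exp_le) auto
  finally show ?thesis by (simp add: mult_ac)
qed

lemma abs_le_exp_sum: "\<bar>y\<bar> \<le> 2 * (exp (y / 2) + exp (- y / 2))" for y :: real
proof -
  have "\<bar>y\<bar> / 2 \<le> exp (\<bar>y\<bar> / 2)" using exp_ge_add_one_self[of "\<bar>y\<bar> / 2"] by linarith
  also have "\<dots> \<le> exp (y / 2) + exp (- y / 2)" by (simp add: abs_if)
  finally show ?thesis by simp
qed

text \<open>Three regimes of z are separated: near 1 the variance controls \<open>ln\<close>, near 0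
  the moment of order -1/4 does, and \<eta> absorbs the remainder. The singular term carries the
  factor \<eta> as well, so boundedness of that moment suffices; only C grows as \<eta>
  decreases.\<close>

lemma abs_ln_le_eta:
  fixes \<eta> :: real
  assumes "0 < \<eta>"
  obtains C where "C \<ge> 0" "\<And>z. 0 < z \<Longrightarrow> \<bar>ln z\<bar> \<le> \<eta> + C * (z - 1)\<^sup>2 + \<eta> * z powr (-1/4)"
proof -
  \<comment> \<open>Below \<delta> the quantity u = -\<open>ln z\<close> exceeds 32/\<eta>, hence u
    \<le> \<eta> u^2 / 32 = \<eta> (u/4)^2 / 2 \<le> \<eta> exp (u/4).\<close>
  define \<delta> where "\<delta> = exp (- 32 / \<eta>)"
  \<comment> \<open>The coefficient that completes the square (x/(2 \<delta>) - \<eta>)^2 / \<eta>,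
    which trades the linear bound |z - 1|/\<delta> for \<eta> plus a quadratic term.\<close>
  define C where "C = 1 / (4 * \<eta> * \<delta>\<^sup>2)"
  have \<delta>: "0 < \<delta>" "\<delta> \<le> 1" using assms by (auto simp: \<delta>_def)
  have C: "C \<ge> 0" using assms by (simp add: C_def)
  have quad: "x / \<delta> \<le> \<eta> + C * x\<^sup>2" for x
  proof -
    have "0 \<le> (x / (2 * \<delta>) - \<eta>)\<^sup>2 / \<eta>" using assms by simp
    also have "\<dots> = \<eta> + C * x\<^sup>2 - x / \<delta>"
      using assms \<delta> by (simp add: C_def power2_eq_square field_simps)
    finally show ?thesis by simp
  qed
  have "\<bar>ln z\<bar> \<le> \<eta> + C * (z - 1)\<^sup>2 + \<eta> * z powr (-1/4)" if z: "0 < z" for z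
  proof -
    have p: "0 \<le> \<eta> * z powr (-1/4)" using assms by simp
    consider "z \<ge> 1" | "\<delta> \<le> z" "z < 1" | "z < \<delta>" by linarith
    then show ?thesis
    proof cases
      case 1
      have "ln z \<le> z - 1" using z by (rule ln_le_minus_one)
      also have "\<dots> \<le> (z - 1) / \<delta>" using 1 \<delta> by (simp add: le_divide_eq mult_left_le)
      also have "\<dots> \<le> \<eta> + C * (z - 1)\<^sup>2" by (rule quad)
      finally show ?thesis using 1 p by simp
    next
      case 2
      have "- ln z = ln (1 / z)" using z by (simp add: ln_div)
      also have "\<dots> \<le> 1 / z - 1" using z by (intro ln_le_minus_one) simp
      also have "\<dots> = (1 - z) / z" using z by (simp add: field_simps)
      also have "\<dots> \<le> (1 - z) / \<delta>" using 2 \<delta> z by (intro divide_left_mono) auto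
      also have "\<dots> \<le> \<eta> + C * (1 - z)\<^sup>2" by (rule quad)
      finally show ?thesis using 2 z p by (simp add: power2_commute)
    next
      case 3
      define u where "u = - ln z"
      have "ln z < - 32 / \<eta>" using 3 z unfolding \<delta>_def by (metis exp_gt_zero ln_exp ln_less_cancel_iff)
      then have u: "32 / \<eta> \<le> u" by (simp add: u_def)
      then have u0: "u > 0" using assms by (smt (verit) divide_pos_pos)
      have "u = \<eta> * (u * (32 / \<eta>)) / 32" using assms by simp
      also have "\<dots> \<le> \<eta> * (u * u) / 32"
        using u u0 assms by (intro divide_right_mono mult_left_mono) auto
      also have "\<dots> = \<eta> * ((u / 4)\<^sup>2 / 2)" by (simp add: power2_eq_square)
      also have "\<dots> \<le> \<eta> * exp (u / 4)"
        using exp_lower_Taylor_quadratic[of "u / 4"] u0 assms by (intro mult_left_mono) auto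
      also have "exp (u / 4) = z powr (-1/4)" using z by (simp add: powr_def u_def)
      finally have "u \<le> \<eta> * z powr (-1/4)" .
      moreover have "0 \<le> \<eta> + C * (z - 1)\<^sup>2" using C assms by simp
      moreover have "\<bar>ln z\<bar> = u" using u0 by (simp add: u_def)
      ultimately show ?thesis by linarith
    qed
  qed
  with C that show thesis by blast
qed

text \<open>Convexity of \<open>x \<mapsto> x powr (-1/4)\<close>, applied to the mean of the \<open>|v\<^sub>i|\<^sup>2\<close>.\<close>

lemma inverse_vec_norm_le:
  fixes v :: "'k::gaussian_scalar vec"
  assumes d: "d \<ge> 1" "dim_vec v = d" and N: "(vec_norm v)\<^sup>2 / real d \<le> N\<^sup>2" "0 \<le> N"
  shows "inverse (ennreal (N powr (1/2))) \<le> (\<Sum>i<d. ennreal (1 / real d) * inverse (ennreal (norm (v $ i) powr (1/2))))"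
proof (cases "\<exists>i<d. v $ i = 0")
  case True
  then obtain i where i: "i < d" "v $ i = 0" by blast
  have "ennreal (1 / real d) * inverse (ennreal (norm (v $ i) powr (1/2))) = \<top>"
    using d i by (simp add: ennreal_mult_top ennreal_eq_0_iff)
  then have "(\<Sum>i<d. ennreal (1 / real d) * inverse (ennreal (norm (v $ i) powr (1/2)))) = \<top>"
    using i by (subst sum.remove[of _ i]) auto
  then show ?thesis by (simp only: top_greatest)
next
  case False
  define x where "x i = (norm (v $ i))\<^sup>2" for i
  define W where "W = (\<Sum>i<d. x i) / real d"
  have x: "x i > 0" if "i < d" for i using False that by (auto simp: x_def)
  have W: "W > 0" unfolding W_def using d x by (intro divide_pos_pos sum_pos) (auto simp: lessThan_empty_iff)
  have WN: "W \<le> N\<^sup>2" using N(1) d(2) by (simp add: W_def x_def vec_norm_def sum_nonneg)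
  have N0: "N > 0" using WN W N(2) by (smt (verit) zero_eq_power2)
  have root: "r powr (-1/2) = (r\<^sup>2) powr (-1/4)" if "r > 0" for r :: real
    using that by (simp add: powr_powr flip: powr_numeral)
  \<comment> \<open>The graph of x^(-1/4) lies above its tangent at the mean W; the linear parts of
    these tangent bounds cancel on summation over i.\<close>
  have tangent: "W powr (-1/4) * (1 - (x i / W - 1) / 4) \<le> x i powr (-1/4)" if i: "i < d" for i
  proof -
    let ?z = "x i / W"
    have z: "?z > 0" using x[OF i] W by simp
    have "1 - (?z - 1) / 4 \<le> 1 + (- ln ?z / 4)" using ln_le_minus_one[OF z] by simp
    also have "\<dots> \<le> exp (- ln ?z / 4)" by (rule exp_ge_add_one_self)
    also have "\<dots> = ?z powr (-1/4)" using x[OF i] W by (simp add: powr_def)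
    finally have "W powr (-1/4) * (1 - (?z - 1) / 4) \<le> W powr (-1/4) * ?z powr (-1/4)"
      by (intro mult_left_mono) auto
    also have "\<dots> = x i powr (-1/4)"
      using x[OF i] W by (simp flip: powr_mult)
    finally show ?thesis .
  qed
  have "N powr (-1/2) = (N\<^sup>2) powr (-1/4)" by (rule root[OF N0])
  also have "\<dots> \<le> W powr (-1/4)" using W WN by (intro powr_mono2') auto
  finally have "N powr (-1/2) \<le> W powr (-1/4)" .
  also have "W powr (-1/4) = (1 / real d) * (\<Sum>i<d. W powr (-1/4) * (1 - (x i / W - 1) / 4))"
  proof -
    have "(\<Sum>i<d. 1 - (x i / W - 1) / 4) = real d - ((\<Sum>i<d. x i) / W - real d) / 4"
      by (simp add: sum_subtractf sum_divide_distrib[symmetric])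
    also have "(\<Sum>i<d. x i) / W = real d"
      using W d by (simp add: W_def field_simps)
    finally show ?thesis using d by (simp flip: sum_distrib_left)
  qed
  also have "\<dots> \<le> (1 / real d) * (\<Sum>i<d. x i powr (-1/4))"
    by (intro mult_left_mono sum_mono tangent) auto
  also have "\<dots> = (\<Sum>i<d. 1 / real d * norm (v $ i) powr (-1/2))"
    unfolding sum_distrib_left x_def using False
    by (intro sum.cong refl arg_cong[where f = "(*) (1 / real d)"] root[symmetric]) auto
  finally have le: "N powr (-1/2) \<le> (\<Sum>i<d. 1 / real d * norm (v $ i) powr (-1/2))" .
  have "inverse (ennreal (N powr (1/2))) = ennreal (N powr (-1/2))"
    using N0 by (simp add: inverse_ennreal powr_minus)
  also have "\<dots> \<le> ennreal (\<Sum>i<d. 1 / real d * norm (v $ i) powr (-1/2))"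
    by (rule ennreal_leI[OF le])
  also have "\<dots> = (\<Sum>i<d. ennreal (1 / real d) * inverse (ennreal (norm (v $ i) powr (1/2))))"
    using False by (subst sum_ennreal[symmetric])
      (auto intro!: sum.cong simp: inverse_ennreal powr_minus ennreal_mult' simp flip: ennreal_mult)
  finally show ?thesis .
qed

section \<open>Exponential growth of the products in a fixed dimension\<close>

section \<open>Almost sure growth rates\<close>

text \<open>Markov's inequality bounds the exceptional probabilities by (\<rho>/q)^n, and since
  \<rho> < q these are summable, so Borel-Cantelli applies.\<close>

lemma AE_eventually_less_power:
  fixes F :: "nat \<Rightarrow> 'w \<Rightarrow> ennreal"
  assumes M: "prob_space M" and F[measurable]: "\<And>n. F n \<in> borel_measurable M"
    and int: "\<And>n. (\<integral>\<^sup>+\<omega>. F n \<omega> \<partial>M) = \<rho> ^ n" and \<rho>: "\<rho> < ennreal q"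
  shows "AE \<omega> in M. eventually (\<lambda>n. F n \<omega> < ennreal (q ^ n)) sequentially"
proof -
  interpret prob_space M by fact
  obtain r where r: "\<rho> = ennreal r" "0 \<le> r" using \<rho> by (cases \<rho>) auto
  have rq: "r < q" using \<rho> r by (simp add: ennreal_less_iff)
  then have q: "q > 0" using r by linarith
  define B where "B n = {\<omega> \<in> space M. ennreal (q ^ n) \<le> F n \<omega>}" for n
  have B[measurable]: "B n \<in> sets M" for n unfolding B_def by measurable
  have le: "measure M (B n) \<le> (r / q) ^ n" for n
  proof -
    have "ennreal (q ^ n * measure M (B n)) = ennreal (q ^ n) * emeasure M (B n)"
      using q by (simp add: ennreal_mult emeasure_eq_measure)
    also have "\<dots> = (\<integral>\<^sup>+\<omega>. ennreal (q ^ n) * indicator (B n) \<omega> \<partial>M)"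
      by (simp add: nn_integral_cmult)
    also have "\<dots> \<le> (\<integral>\<^sup>+\<omega>. F n \<omega> \<partial>M)"
      by (intro nn_integral_mono) (auto simp: B_def indicator_def)
    also have "\<dots> = ennreal (r ^ n)" by (simp add: int r ennreal_power)
    finally have "q ^ n * measure M (B n) \<le> r ^ n" using r by simp
    then show ?thesis using q by (simp add: power_divide field_simps)
  qed
  have "summable (\<lambda>n. measure M (B n))"
  proof (rule summable_comparison_test_ev[OF always_eventually])
    show "\<forall>n. norm (measure M (B n)) \<le> (r / q) ^ n" using le by simp
    show "summable (\<lambda>n. (r / q) ^ n)" using r q rq by (simp add: summable_geometric)
  qed
  from borel_cantelli_AE1[OF B _ this] have "AE \<omega> in M. eventually (\<lambda>n. \<omega> \<in> space M - B n) sequentially"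
    by (simp add: emeasure_eq_measure)
  then show ?thesis
    by eventually_elim (auto simp: B_def not_le elim: eventually_mono)
qed

text \<open>The bounds \<open>exp (\<plusminus> s Y) \<le> 1 \<plusminus> s Y + O(s\<^sup>2)\<close> for \<open>Y = ln N\<close>, in expectation, are Chernoff bounds
  with the correct first-order term.\<close>

lemma log_moment_bounds:
  fixes N :: "'a \<Rightarrow> real"
  assumes Q: "prob_space Q" and N[measurable]: "N \<in> borel_measurable Q" and nonneg: "\<And>x. 0 \<le> N x"
    and pos: "(\<integral>\<^sup>+x. ennreal (N x powr (1/2)) \<partial>Q) < \<infinity>"
    and neg: "(\<integral>\<^sup>+x. inverse (ennreal (N x powr (1/2))) \<partial>Q) < \<infinity>"
  shows "integrable Q (\<lambda>x. ln (N x))" "AE x in Q. 0 < N x"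
    and "\<And>\<epsilon>. 0 < \<epsilon> \<Longrightarrow> \<exists>s>0.
      (\<integral>\<^sup>+x. ennreal (N x powr s) \<partial>Q) < ennreal (exp (s * ((\<integral>x. ln (N x) \<partial>Q) + \<epsilon>))) \<and>
      (\<integral>\<^sup>+x. inverse (ennreal (N x powr s)) \<partial>Q) < ennreal (exp (- (s * ((\<integral>x. ln (N x) \<partial>Q) - \<epsilon>))))"
proof -
  interpret prob_space Q by fact
  \<comment> \<open>A finite integral makes the inverse finite almost everywhere, and it is infinite
    where N vanishes.\<close>
  have "AE x in Q. inverse (ennreal (N x powr (1/2))) \<noteq> \<infinity>"
    using neg by (intro nn_integral_PInf_AE) auto
  then show N0: "AE x in Q. 0 < N x"
    by eventually_elim (use nonneg in \<open>auto simp: less_le\<close>)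
  define D where "D x = exp (ln (N x) / 2) + exp (- ln (N x) / 2)" for x
  have Dm[measurable]: "D \<in> borel_measurable Q" unfolding D_def by measurable
  have "(\<integral>\<^sup>+x. ennreal (D x) \<partial>Q) =
      (\<integral>\<^sup>+x. ennreal (N x powr (1/2)) + inverse (ennreal (N x powr (1/2))) \<partial>Q)"
    by (rule nn_integral_cong_AE, use N0 in eventually_elim)
      (auto simp: D_def powr_def inverse_ennreal exp_minus)
  also have "\<dots> < \<infinity>" using pos neg by (simp add: nn_integral_add)
  finally have iD: "integrable Q D"
    by (intro integrableI_nonneg) (auto simp: D_def add_nonneg_nonneg)
  show iln: "integrable Q (\<lambda>x. ln (N x))"
  proof (rule Bochner_Integration.integrable_bound)
    show "integrable Q (\<lambda>x. 2 * D x)" using iD by simp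
    show "AE x in Q. norm (ln (N x)) \<le> norm (2 * D x)"
      using abs_le_exp_sum by (auto simp: D_def intro!: AE_I2 order_trans[OF abs_le_exp_sum])
  qed simp
  define m where "m = (\<integral>x. ln (N x) \<partial>Q)"
  define E where "E = (\<integral>x. D x \<partial>Q)"
  have E: "E \<ge> 0" unfolding E_def D_def by (intro integral_nonneg_AE AE_I2) (auto intro: add_nonneg_nonneg)
  have key: "(\<integral>\<^sup>+x. ennreal (exp (s * ln (N x))) \<partial>Q) \<le> ennreal (1 + s * m + 32 * s\<^sup>2 * E)"
    if s: "\<bar>s\<bar> \<le> 1/4" for s
  proof -
    have i: "integrable Q (\<lambda>x. 1 + s * ln (N x) + 32 * s\<^sup>2 * D x)"
      using iln iD by (intro Bochner_Integration.integrable_add integrable_mult_right) auto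
    have le: "exp (s * ln (N x)) \<le> 1 + s * ln (N x) + 32 * s\<^sup>2 * D x" for x
      unfolding D_def by (rule exp_scaled_le[OF s])
    have "(\<integral>\<^sup>+x. ennreal (exp (s * ln (N x))) \<partial>Q) \<le> (\<integral>\<^sup>+x. ennreal (1 + s * ln (N x) + 32 * s\<^sup>2 * D x) \<partial>Q)"
      by (intro nn_integral_mono ennreal_leI le)
    also have "\<dots> = ennreal (\<integral>x. 1 + s * ln (N x) + 32 * s\<^sup>2 * D x \<partial>Q)"
      by (intro nn_integral_eq_integral i AE_I2 order_trans[OF _ le]) simp
    also have "(\<integral>x. 1 + s * ln (N x) + 32 * s\<^sup>2 * D x \<partial>Q) = 1 + s * m + 32 * s\<^sup>2 * E"
      unfolding m_def E_def using iln iD by (simp add: prob_space)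
    finally show ?thesis .
  qed
  fix \<epsilon> :: real assume \<epsilon>: "0 < \<epsilon>"
  \<comment> \<open>This gives 32 s E \<le> \<epsilon> - s < \<epsilon>, so the quadratic error
    stays strictly below s \<epsilon>; the summand 1 supplies the strictness and keeps the
    denominator positive if E = 0.\<close>
  define s where "s = min (1/4) (\<epsilon> / (32 * E + 1))"
  have s: "s > 0" using \<epsilon> E by (simp add: s_def)
  have s4: "s \<le> 1/4" unfolding s_def by (rule min.cobounded1)
  have "s \<le> \<epsilon> / (32 * E + 1)" unfolding s_def by (rule min.cobounded2)
  then have "s * (32 * E + 1) \<le> \<epsilon>"
    using E by (simp add: le_divide_eq)
  then have sE: "32 * s * E < \<epsilon>" using s by (simp add: algebra_simps)
  then have sE2: "32 * s\<^sup>2 * E < s * \<epsilon>"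
    using s by (simp add: power2_eq_square mult_ac)
  have exp_bound: "(\<integral>\<^sup>+x. ennreal (exp (t * ln (N x))) \<partial>Q) < ennreal (exp (t * m + s * \<epsilon>))"
    if t: "t = s \<or> t = - s" for t
  proof -
    have "(\<integral>\<^sup>+x. ennreal (exp (t * ln (N x))) \<partial>Q) \<le> ennreal (1 + t * m + 32 * t\<^sup>2 * E)"
      by (rule key) (use t s s4 in auto)
    also have "\<dots> \<le> ennreal (exp (t * m + 32 * t\<^sup>2 * E))"
      using exp_ge_add_one_self[of "t * m + 32 * t\<^sup>2 * E"] by (intro ennreal_leI) linarith
    also have "\<dots> < ennreal (exp (t * m + s * \<epsilon>))"
      using t sE2 by (intro ennreal_lessI) auto
    finally show ?thesis .
  qed
  have p: "(\<integral>\<^sup>+x. ennreal (N x powr s) \<partial>Q) = (\<integral>\<^sup>+x. ennreal (exp (s * ln (N x))) \<partial>Q)"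
    by (rule nn_integral_cong_AE, use N0 in eventually_elim) (auto simp: powr_def)
  have n: "(\<integral>\<^sup>+x. inverse (ennreal (N x powr s)) \<partial>Q) = (\<integral>\<^sup>+x. ennreal (exp (- s * ln (N x))) \<partial>Q)"
    by (rule nn_integral_cong_AE, use N0 in eventually_elim) (auto simp: powr_def inverse_ennreal exp_minus)
  show "\<exists>s>0.
      (\<integral>\<^sup>+x. ennreal (N x powr s) \<partial>Q) < ennreal (exp (s * ((\<integral>x. ln (N x) \<partial>Q) + \<epsilon>))) \<and>
      (\<integral>\<^sup>+x. inverse (ennreal (N x powr s)) \<partial>Q) < ennreal (exp (- (s * ((\<integral>x. ln (N x) \<partial>Q) - \<epsilon>))))"
  proof (intro exI[of _ s] conjI s)
    show "(\<integral>\<^sup>+x. ennreal (N x powr s) \<partial>Q) < ennreal (exp (s * ((\<integral>x. ln (N x) \<partial>Q) + \<epsilon>)))"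
      unfolding p m_def[symmetric] using exp_bound[of s] by (simp add: distrib_left)
    show "(\<integral>\<^sup>+x. inverse (ennreal (N x powr s)) \<partial>Q) < ennreal (exp (- (s * ((\<integral>x. ln (N x) \<partial>Q) - \<epsilon>))))"
      unfolding n m_def[symmetric] using exp_bound[of "- s"] by (simp add: right_diff_distrib)
  qed
qed

section \<open>Products of Gaussian matrices\<close>

lemma mat_product_carrier:
  assumes "\<And>i. i \<ge> 1 \<Longrightarrow> a i \<in> carrier_mat d d"
  shows "mat_product d a n \<in> carrier_mat d d"
  using assms by (induction n) (auto intro!: mult_carrier_mat)

lemma mat_product_cong:
  assumes "\<And>i. i \<in> {1..n} \<Longrightarrow> a i = b i"
  shows "mat_product d a n = mat_product d b n"
  using assms by (induction n) auto

lemma measurable_mat_borel_mult: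
  fixes f g :: "'w \<Rightarrow> 'k::gaussian_scalar mat"
  assumes f: "f \<in> measurable N (mat_borel d)" and g: "g \<in> measurable N (mat_borel d)"
  shows "(\<lambda>x. f x * g x) \<in> measurable N (mat_borel d)"
proof (rule measurable_mat_borelI)
  have c: "f x \<in> carrier_mat d d" "g x \<in> carrier_mat d d" if "x \<in> space N" for x
    using measurable_space[OF f that] measurable_space[OF g that] by auto
  show "f x * g x \<in> carrier_mat d d" if "x \<in> space N" for x
    using c[OF that] by (rule mult_carrier_mat)
  fix i j assume ij: "i < d" "j < d"
  have "(\<lambda>x. \<Sum>l<d. f x $$ (i, l) * g x $$ (l, j)) \<in> borel_measurable N"
    using ij by (intro borel_measurable_sum borel_measurable_times
        measurable_compose[OF f measurable_mat_borel_entry] measurable_compose[OF g measurable_mat_borel_entry]) auto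
  also have "?this \<longleftrightarrow> (\<lambda>x. (f x * g x) $$ (i, j)) \<in> borel_measurable N"
    using index_mult_mat_sum[OF c ij] by (intro measurable_cong) simp
  finally show "(\<lambda>x. (f x * g x) $$ (i, j)) \<in> borel_measurable N" .
qed

lemma measurable_mat_borel_vec_norm:
  fixes f :: "'w \<Rightarrow> 'k::gaussian_scalar mat"
  assumes f: "f \<in> measurable N (mat_borel d)" and v: "v \<in> carrier_vec d"
  shows "(\<lambda>x. vec_norm (f x *\<^sub>v v)) \<in> borel_measurable N"
proof -
  have c: "f x \<in> carrier_mat d d" if "x \<in> space N" for x
    using measurable_space[OF f that] by auto
  have "(\<lambda>x. sqrt (\<Sum>i<d. (norm (\<Sum>j<d. f x $$ (i, j) * v $ j))\<^sup>2)) \<in> borel_measurable N"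
    by (intro measurable_compose[OF _ borel_measurable_sqrt] borel_measurable_sum borel_measurable_power
        measurable_compose[OF _ borel_measurable_norm] borel_measurable_times
        measurable_compose[OF f measurable_mat_borel_entry]) auto
  also have "?this \<longleftrightarrow> (\<lambda>x. vec_norm (f x *\<^sub>v v)) \<in> borel_measurable N"
  proof (rule measurable_cong)
    fix x assume "x \<in> space N"
    with c have cx: "f x \<in> carrier_mat d d" by blast
    show "sqrt (\<Sum>i<d. (norm (\<Sum>j<d. f x $$ (i, j) * v $ j))\<^sup>2) = vec_norm (f x *\<^sub>v v)"
      using cx v by (simp add: vec_norm_def index_mult_mat_vec_sum[OF cx v] del: index_mult_mat_vec)
  qed
  finally show ?thesis .
qed

lemma measurable_mat_product:
  assumes "{1..n} \<subseteq> I"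
  shows "(\<lambda>a. mat_product d a n :: 'k::gaussian_scalar mat) \<in> measurable (PiM I (\<lambda>_. mat_borel d)) (mat_borel d)"
  using assms
proof (induction n)
  case 0
  then show ?case by (simp add: measurable_const)
next
  case (Suc n)
  have "(\<lambda>a. a (Suc n) :: 'k mat) \<in> measurable (PiM I (\<lambda>_. mat_borel d)) (mat_borel d)"
    using Suc.prems by (intro measurable_component_singleton) auto
  moreover have "(\<lambda>a. mat_product d a n :: 'k mat) \<in> measurable (PiM I (\<lambda>_. mat_borel d)) (mat_borel d)"
    using Suc.prems by (intro Suc.IH) auto
  ultimately show ?case by (simp add: measurable_mat_borel_mult)
qed

locale gaussian_product = prob_space M for M :: "'w measure" +
  fixes d :: nat and \<Sigma> :: "'k::gaussian_scalar mat" and A :: "nat \<Rightarrow> 'w \<Rightarrow> 'k mat"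
  assumes d: "d \<ge> 1" and iid: "iid_gaussian_matrices M d \<Sigma> A" and S: "mat_sqrt d \<Sigma> \<in> carrier_mat d d"
begin

abbreviation Pr :: "nat \<Rightarrow> 'w \<Rightarrow> 'k mat" where
  "Pr n \<omega> \<equiv> mat_product d (\<lambda>i. A i \<omega>) n"

abbreviation N :: "(nat \<Rightarrow> 'k) \<Rightarrow> real" where
  "N g \<equiv> vec_norm (mat_sqrt d \<Sigma> *\<^sub>v vec d g)"

lemma A_measurable: "i \<ge> 1 \<Longrightarrow> A i \<in> measurable M (mat_borel d)"
  using iid by (auto simp: iid_gaussian_matrices_def indep_vars_def)

lemma A_carrier: "i \<ge> 1 \<Longrightarrow> \<omega> \<in> space M \<Longrightarrow> A i \<omega> \<in> carrier_mat d d"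
  using measurable_space[OF A_measurable] by simp

lemma Pr_carrier: "\<omega> \<in> space M \<Longrightarrow> Pr n \<omega> \<in> carrier_mat d d"
  by (intro mat_product_carrier A_carrier)

lemma Pr_measurable: "Pr n \<in> measurable M (mat_borel d)"
proof (induction n)
  case (Suc n)
  then show ?case using measurable_mat_borel_mult[OF A_measurable[of "Suc n"] Suc] by simp
qed (simp add: measurable_const)

lemma N_measurable: "N \<in> borel_measurable (gauss_PiM {..<d})"
  using measurable_vec_norm_mult_vec[OF S] by (simp cong: measurable_cong_sets add: sets_gauss_PiM)

text \<open>Conditioning on the first n factors fixes w = P_n v; the next factor then contributes
  h(|w| N(g)) = h(|w|) h(N(g)). Multiplicativity of h makes normalised vectors unnecessary and
  allows w = 0. Both x^s and its inverse in \<open>ennreal\<close> are admissible for h.\<close>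

lemma nn_integral_Pr_multiplicative:
  fixes h :: "real \<Rightarrow> ennreal"
  assumes h[measurable]: "h \<in> borel_measurable borel" and h1: "h 1 = 1"
    and mult: "\<And>x y. 0 \<le> x \<Longrightarrow> 0 \<le> y \<Longrightarrow> h (x * y) = h x * h y"
    and v: "v \<in> carrier_vec d" "vec_norm v = 1"
  shows "(\<integral>\<^sup>+\<omega>. h (vec_norm (Pr n \<omega> *\<^sub>v v)) \<partial>M) = (\<integral>\<^sup>+g. h (N g) \<partial>gauss_PiM {..<d}) ^ n"
proof (induction n)
  case 0
  then show ?case using v h1 by (simp add: emeasure_space_1)
next
  case (Suc n)
  let ?\<rho> = "\<integral>\<^sup>+g. h (N g) \<partial>gauss_PiM {..<d}"
  let ?B = "\<lambda>\<omega>. restrict (\<lambda>i. A i \<omega>) {1..n}"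
  let ?PB = "PiM {1..n} (\<lambda>_. mat_borel d :: 'k mat measure)"
  let ?C = "\<lambda>\<omega>. restrict (\<lambda>i. A i \<omega>) {Suc n}"
  let ?PC = "PiM {Suc n} (\<lambda>_. mat_borel d :: 'k mat measure)"
  have "indep_var ?PB ?B ?PC ?C"
    \<comment> \<open>The last factor is treated as a block with the single index
      \<open>Suc n\<close>, so that independence of two disjoint blocks turns the expectation into
      an iterated integral.\<close>
    using iid by (intro indep_var_restrict[of _ _ "{1..}"]) (auto simp: iid_gaussian_matrices_def)
  then have Bm: "?B \<in> measurable M ?PB" and Cm: "?C \<in> measurable M ?PC"
    and dist: "distr M ?PB ?B \<Otimes>\<^sub>M distr M ?PC ?C = distr M (?PB \<Otimes>\<^sub>M ?PC) (\<lambda>\<omega>. (?B \<omega>, ?C \<omega>))"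
    by (auto simp: indep_var_distribution_eq)
  have Sm: "(\<lambda>x. x (Suc n)) \<in> measurable ?PC (mat_borel d)"
    by (rule measurable_component_singleton) simp
  note Am = A_measurable[of "Suc n", simplified]
  have law: "distr M (mat_borel d) (A (Suc n)) = gaussian_matrix_law d \<Sigma>"
    using iid by (simp add: iid_gaussian_matrices_def)
  interpret L: prob_space "distr M ?PC ?C"
    using Cm by (rule prob_space_distr)
  have PB: "mat_product d b n \<in> carrier_mat d d" if "b \<in> space ?PB" for b
    using measurable_space[OF measurable_mat_product[of n "{1..n}"] that] by simp
  have PrB: "Pr n \<omega> = mat_product d (?B \<omega>) n" for \<omega>
    by (rule mat_product_cong) simp
  let ?\<Phi> = "\<lambda>(b, c). h (vec_norm (c (Suc n) * mat_product d b n *\<^sub>v v))"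
  have \<Phi>: "?\<Phi> \<in> borel_measurable (?PB \<Otimes>\<^sub>M ?PC)"
    unfolding split_beta'
    by (intro measurable_compose[OF measurable_mat_borel_vec_norm[where d=d] h] measurable_mat_borel_mult v
        measurable_compose[OF measurable_fst measurable_mat_product] measurable_compose[OF measurable_snd Sm]) auto
  have "(\<integral>\<^sup>+\<omega>. h (vec_norm (Pr (Suc n) \<omega> *\<^sub>v v)) \<partial>M) = (\<integral>\<^sup>+\<omega>. ?\<Phi> (?B \<omega>, ?C \<omega>) \<partial>M)"
    using PrB by simp
  also have "\<dots> = (\<integral>\<^sup>+p. ?\<Phi> p \<partial>(distr M ?PB ?B \<Otimes>\<^sub>M distr M ?PC ?C))"
    unfolding dist using Bm Cm \<Phi> by (intro nn_integral_distr[symmetric]) auto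
  also have "\<dots> = (\<integral>\<^sup>+b. \<integral>\<^sup>+c. ?\<Phi> (b, c) \<partial>distr M ?PC ?C \<partial>distr M ?PB ?B)"
    using \<Phi> by (intro L.nn_integral_fst[symmetric]) (simp cong: measurable_cong_sets sets_pair_measure_cong)
  also have "\<dots> = (\<integral>\<^sup>+b. h (vec_norm (mat_product d b n *\<^sub>v v)) * ?\<rho> \<partial>distr M ?PB ?B)"
  proof (rule nn_integral_cong)
    fix b assume "b \<in> space (distr M ?PB ?B)"
    then have c: "mat_product d b n \<in> carrier_mat d d" using PB by simp
    let ?w = "mat_product d b n *\<^sub>v v"
    have w: "?w \<in> carrier_vec d" using c v by simp
    have fm: "(\<lambda>a. h (vec_norm (a *\<^sub>v ?w))) \<in> borel_measurable (mat_borel d)"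
      by (rule measurable_compose[OF measurable_mat_borel_vec_norm[OF _ w] h]) simp
    have "(\<integral>\<^sup>+c. ?\<Phi> (b, c) \<partial>distr M ?PC ?C) = (\<integral>\<^sup>+c. h (vec_norm (c (Suc n) *\<^sub>v ?w)) \<partial>distr M ?PC ?C)"
    proof (rule nn_integral_cong)
      fix x assume "x \<in> space (distr M ?PC ?C)"
      then have "x (Suc n) \<in> carrier_mat d d" using measurable_space[OF Sm] by simp
      then show "?\<Phi> (b, x) = h (vec_norm (x (Suc n) *\<^sub>v ?w))" using assoc_mult_mat_vec[OF _ c v(1)] by simp
    qed
    also have "\<dots> = (\<integral>\<^sup>+\<omega>. h (vec_norm (A (Suc n) \<omega> *\<^sub>v ?w)) \<partial>M)"
      using measurable_compose[OF Sm fm] by (subst nn_integral_distr[OF Cm]) auto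
    also have "\<dots> = (\<integral>\<^sup>+a. h (vec_norm (a *\<^sub>v ?w)) \<partial>distr M (mat_borel d) (A (Suc n)))"
      using fm by (subst nn_integral_distr[OF Am]) auto
    also have "\<dots> = (\<integral>\<^sup>+g. h (vec_norm ?w * N g) \<partial>gauss_PiM {..<d})"
      unfolding law by (rule gaussian_matrix_law_nn_integral[OF d S w h])
    also have "\<dots> = h (vec_norm ?w) * ?\<rho>"
      using measurable_compose[OF N_measurable h] by (simp add: mult nn_integral_cmult)
    finally show "(\<integral>\<^sup>+c. ?\<Phi> (b, c) \<partial>distr M ?PC ?C) = h (vec_norm ?w) * ?\<rho>" .
  qed
  also have "\<dots> = (\<integral>\<^sup>+\<omega>. h (vec_norm (Pr n \<omega> *\<^sub>v v)) * ?\<rho> \<partial>M)"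
  proof -
    have "(\<lambda>b. h (vec_norm (mat_product d b n *\<^sub>v v)) * ?\<rho>) \<in> borel_measurable ?PB"
      by (intro borel_measurable_times_ennreal measurable_const
          measurable_compose[OF measurable_mat_borel_vec_norm[where d=d] h] measurable_mat_product v) auto
    then show ?thesis using Bm by (subst nn_integral_distr) (auto simp: PrB)
  qed
  also have "\<dots> = (\<integral>\<^sup>+\<omega>. h (vec_norm (Pr n \<omega> *\<^sub>v v)) \<partial>M) * ?\<rho>"
    by (intro nn_integral_multc measurable_compose[OF measurable_mat_borel_vec_norm[OF Pr_measurable v(1)] h])
  finally show ?case by (simp add: Suc.IH mult.commute)
qed

end

section \<open>The operator norm\<close>

lemma L2_set_sum_le: "L2_set (\<lambda>i. \<Sum>j\<in>J. f j i) I \<le> (\<Sum>j\<in>J. L2_set (f j) I)"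
proof (induction J rule: infinite_finite_induct)
  case (insert j J)
  then show ?case using L2_set_triangle_ineq[of "f j" "\<lambda>i. \<Sum>j\<in>J. f j i" I] by simp
qed (simp_all add: L2_set_def)

text \<open>P v combines the columns of P with coefficients of norm at most 1. The crude sum over d
  columns is harmless, since d stays fixed while n grows.\<close>

lemma vec_norm_mult_le:
  fixes P :: "'k::gaussian_scalar mat"
  assumes P: "P \<in> carrier_mat d d" and v: "v \<in> carrier_vec d" "vec_norm v \<le> 1"
  shows "vec_norm (P *\<^sub>v v) \<le> (\<Sum>j<d. vec_norm (P *\<^sub>v unit_vec d j))"
proof -
  have "vec_norm (P *\<^sub>v v) = L2_set (\<lambda>i. norm (\<Sum>j<d. P $$ (i, j) * v $ j)) {..<d}"
    using P v by (simp add: vec_norm_def L2_set_def index_mult_mat_vec_sum[OF P] del: index_mult_mat_vec)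
  also have "\<dots> \<le> L2_set (\<lambda>i. \<Sum>j<d. norm (P $$ (i, j))) {..<d}"
  proof (rule L2_set_mono)
    fix i
    have "norm (\<Sum>j<d. P $$ (i, j) * v $ j) \<le> (\<Sum>j<d. norm (P $$ (i, j) * v $ j))" by (rule norm_sum)
    also have "\<dots> \<le> (\<Sum>j<d. norm (P $$ (i, j)))"
    proof (rule sum_mono)
      fix j assume "j \<in> {..<d}"
      then have "norm (v $ j) \<le> 1" using norm_index_le_vec_norm[of j v] v by simp
      then show "norm (P $$ (i, j) * v $ j) \<le> norm (P $$ (i, j))"
        by (simp add: norm_mult mult_left_le)
    qed
    finally show "norm (\<Sum>j<d. P $$ (i, j) * v $ j) \<le> (\<Sum>j<d. norm (P $$ (i, j)))" .
  qed simp
  also have "\<dots> \<le> (\<Sum>j<d. L2_set (\<lambda>i. norm (P $$ (i, j))) {..<d})" by (rule L2_set_sum_le)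
  also have "\<dots> = (\<Sum>j<d. vec_norm (P *\<^sub>v unit_vec d j))"
    using P by (intro sum.cong refl)
      (simp add: vec_norm_def L2_set_def mult_mat_unit_vec_index[OF P] del: index_mult_mat_vec)
  finally show ?thesis .
qed

lemma op_norm_bounds:
  fixes P :: "'k::gaussian_scalar mat"
  assumes P: "P \<in> carrier_mat d d" and d: "d \<ge> 1"
  shows "vec_norm (P *\<^sub>v unit_vec d 0) \<le> op_norm P" "op_norm P \<le> (\<Sum>j<d. vec_norm (P *\<^sub>v unit_vec d j))"
proof -
  let ?V = "{v \<in> carrier_vec (dim_col P). vec_norm v \<le> 1}"
  have e: "unit_vec d 0 \<in> ?V" using P d by simp
  have le: "vec_norm (P *\<^sub>v v) \<le> (\<Sum>j<d. vec_norm (P *\<^sub>v unit_vec d j))" if "v \<in> ?V" for v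
    using vec_norm_mult_le[OF P] that P by simp
  show "vec_norm (P *\<^sub>v unit_vec d 0) \<le> op_norm P"
    unfolding op_norm_def by (rule cSUP_upper[OF e]) (use le in \<open>auto intro!: bdd_aboveI\<close>)
  show "op_norm P \<le> (\<Sum>j<d. vec_norm (P *\<^sub>v unit_vec d j))"
    unfolding op_norm_def by (rule cSUP_least[OF _ le]) (use e in blast)
qed

section \<open>The largest Lyapunov exponent of Gaussian matrices\<close>

text \<open>The tolerances 1/(k + 1) form a countable family, so they can be handled simultaneously
  almost surely; the factor d contributes (ln d)/n, which tends to 0.\<close>

lemma tendsto_ln_growth:
  fixes x :: "nat \<Rightarrow> real"
  assumes d: "d \<ge> (1::nat)"
    and lower: "\<And>k. eventually (\<lambda>n. exp (real n * (m - 1 / real (Suc k))) \<le> x n) sequentially"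
    and upper: "\<And>k. eventually (\<lambda>n. x n \<le> real d * exp (real n * (m + 1 / real (Suc k)))) sequentially"
  shows "(\<lambda>n. ln (x n) / real n) \<longlonglongrightarrow> m"
proof (rule tendstoI)
  fix e :: real assume e: "0 < e"
  obtain k where k: "1 / real (Suc k) < e / 2"
    using reals_Archimedean[of "e / 2"] e by (auto simp: inverse_eq_divide)
  have "(\<lambda>n. ln (real d) / real n) \<longlonglongrightarrow> 0" by (rule lim_const_over_n)
  then have "eventually (\<lambda>n. dist (ln (real d) / real n) 0 < e / 2) sequentially"
    using e by (intro tendstoD) auto
  with lower[of k] upper[of k] eventually_gt_at_top[of "0::nat"]
  show "eventually (\<lambda>n. dist (ln (x n) / real n) m < e) sequentially"
  proof eventually_elim
    case (elim n)
    let ?\<epsilon> = "1 / real (Suc k)"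
    have n: "real n > 0" using elim(3) by simp
    have x: "x n > 0" using elim(1) by (rule less_le_trans[OF exp_gt_zero])
    have "real n * (m - ?\<epsilon>) \<le> ln (x n)" using elim(1) x by (simp add: ln_ge_iff)
    then have 1: "m - ?\<epsilon> \<le> ln (x n) / real n" using n by (simp add: le_divide_eq mult.commute)
    have "ln (x n) \<le> ln (real d * exp (real n * (m + ?\<epsilon>)))"
      using elim(2) x d by (subst ln_le_cancel_iff) auto
    also have "\<dots> = ln (real d) + real n * (m + ?\<epsilon>)" using d by (simp add: ln_mult)
    finally have "ln (x n) / real n \<le> (ln (real d) + real n * (m + ?\<epsilon>)) / real n"
      using n by (simp add: divide_right_mono)
    also have "\<dots> = ln (real d) / real n + (m + ?\<epsilon>)" using n by (simp add: add_divide_distrib)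
    finally have 2: "ln (x n) / real n \<le> ln (real d) / real n + (m + ?\<epsilon>)" .
    have "ln (real d) / real n < e / 2" using elim(4) unfolding dist_real_def diff_0_right abs_less_iff by blast
    with 1 2 k show ?case unfolding dist_real_def abs_less_iff by linarith
  qed
qed

context gaussian_product
begin

context
  assumes pos: "(\<integral>\<^sup>+g. ennreal (N g powr (1/2)) \<partial>gauss_PiM {..<d}) < \<infinity>"
    and neg: "(\<integral>\<^sup>+g. inverse (ennreal (N g powr (1/2))) \<partial>gauss_PiM {..<d}) < \<infinity>"
begin

abbreviation mu :: real where
  "mu \<equiv> (\<integral>g. ln (N g) \<partial>gauss_PiM {..<d})"

text \<open>The moments of order s and -s of |P_n v| are n-th powers of those of one factor.
  \<open>log_moment_bounds\<close> puts the one-step moments strictly below exp (s (mu +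
  \<epsilon>)) and exp (-s (mu - \<epsilon>)), which is the gap needed for Borel-Cantelli on each
  side.\<close>

lemma AE_vector_growth:
  assumes v: "v \<in> carrier_vec d" "vec_norm v = 1" and \<epsilon>: "0 < \<epsilon>"
  shows "AE \<omega> in M. eventually (\<lambda>n. exp (real n * (mu - \<epsilon>)) \<le> vec_norm (Pr n \<omega> *\<^sub>v v) \<and>
    vec_norm (Pr n \<omega> *\<^sub>v v) \<le> exp (real n * (mu + \<epsilon>))) sequentially"
proof -
  obtain s where s: "s > 0"
    and p: "(\<integral>\<^sup>+g. ennreal (N g powr s) \<partial>gauss_PiM {..<d}) < ennreal (exp (s * (mu + \<epsilon>)))"
    and n: "(\<integral>\<^sup>+g. inverse (ennreal (N g powr s)) \<partial>gauss_PiM {..<d}) < ennreal (exp (- (s * (mu - \<epsilon>))))"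
    using log_moment_bounds(3)[OF prob_space_gauss_PiM N_measurable vec_norm_nonneg pos neg \<epsilon>] by blast
  have m: "(\<lambda>\<omega>. vec_norm (Pr n \<omega> *\<^sub>v v)) \<in> borel_measurable M" for n
    by (rule measurable_mat_borel_vec_norm[OF Pr_measurable v(1)])
  let ?Z = "\<lambda>n \<omega>. vec_norm (Pr n \<omega> *\<^sub>v v)"
  have hp: "(\<lambda>x::real. ennreal (x powr s)) \<in> borel_measurable borel"
    "(\<lambda>x::real. inverse (ennreal (x powr s))) \<in> borel_measurable borel" by measurable
  have "AE \<omega> in M. eventually (\<lambda>n. ennreal (?Z n \<omega> powr s) < ennreal (exp (s * (mu + \<epsilon>)) ^ n)) sequentially"
  proof (rule AE_eventually_less_power[OF prob_space_axioms _ _ p])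
    show "(\<integral>\<^sup>+\<omega>. ennreal (?Z n \<omega> powr s) \<partial>M) = (\<integral>\<^sup>+g. ennreal (N g powr s) \<partial>gauss_PiM {..<d}) ^ n" for n
      by (rule nn_integral_Pr_multiplicative[OF hp(1) _ _ v]) (auto simp: powr_mult ennreal_mult)
  qed (rule measurable_compose[OF m hp(1)])
  moreover have "AE \<omega> in M. eventually (\<lambda>n. inverse (ennreal (?Z n \<omega> powr s)) <
      ennreal (exp (- (s * (mu - \<epsilon>))) ^ n)) sequentially"
  proof (rule AE_eventually_less_power[OF prob_space_axioms _ _ n])
    show "(\<integral>\<^sup>+\<omega>. inverse (ennreal (?Z n \<omega> powr s)) \<partial>M) =
        (\<integral>\<^sup>+g. inverse (ennreal (N g powr s)) \<partial>gauss_PiM {..<d}) ^ n" for n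
      by (rule nn_integral_Pr_multiplicative[OF hp(2) _ _ v])
        (auto simp: powr_mult ennreal_mult ennreal_inverse_mult)
  qed (rule measurable_compose[OF m hp(2)])
  ultimately show ?thesis
  proof eventually_elim
    case (elim \<omega>)
    from elim show ?case
    proof eventually_elim
      case (elim n)
      have e1: "exp (s * (mu + \<epsilon>)) ^ n = exp (s * (real n * (mu + \<epsilon>)))"
        by (simp add: exp_of_nat_mult[symmetric] mult_ac)
      have e2: "exp (- (s * (mu - \<epsilon>))) ^ n = exp (- (s * (real n * (mu - \<epsilon>))))"
        by (simp add: exp_of_nat_mult[symmetric] mult_ac)
      \<comment> \<open>The second bound makes the inverse of |P_n v|^s finite, which excludes the
        value 0.\<close>
      have Z0: "?Z n \<omega> > 0"
      proof (rule ccontr)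
        assume "\<not> ?Z n \<omega> > 0"
        then have "?Z n \<omega> = 0" using vec_norm_nonneg[of "Pr n \<omega> *\<^sub>v v"] by simp
        with elim(2) show False by simp
      qed
      have Zs: "?Z n \<omega> powr s = exp (s * ln (?Z n \<omega>))" using Z0 by (simp add: powr_def)
      have "exp (s * ln (?Z n \<omega>)) < exp (s * (real n * (mu + \<epsilon>)))"
        using elim(1) unfolding e1 Zs by (simp add: ennreal_less_iff)
      then have "ln (?Z n \<omega>) < real n * (mu + \<epsilon>)" using s by simp
      then have up: "?Z n \<omega> < exp (real n * (mu + \<epsilon>))" using Z0 by (metis exp_less_mono exp_ln)
      have "exp (- (s * ln (?Z n \<omega>))) < exp (- (s * (real n * (mu - \<epsilon>))))"
        using elim(2) unfolding e2 Zs by (simp add: inverse_ennreal ennreal_less_iff exp_minus)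
      then have "real n * (mu - \<epsilon>) < ln (?Z n \<omega>)" using s by simp
      then have "exp (real n * (mu - \<epsilon>)) < ?Z n \<omega>" using Z0 by (metis exp_less_mono exp_ln)
      with up show ?case by simp
    qed
  qed
qed

lemma AE_op_norm_growth: "AE \<omega> in M. (\<lambda>n. ln (op_norm (Pr n \<omega>)) / real n) \<longlonglongrightarrow> mu"
proof -
  let ?Z = "\<lambda>j n \<omega>. vec_norm (Pr n \<omega> *\<^sub>v unit_vec d j)"
  \<comment> \<open>One null set is chosen for all tolerances 1/(k + 1) and all d unit
    vectors.\<close>
  have "AE \<omega> in M. \<forall>k. \<forall>j\<in>{..<d}. eventually (\<lambda>n. exp (real n * (mu - 1 / real (Suc k))) \<le> ?Z j n \<omega> \<and>
    ?Z j n \<omega> \<le> exp (real n * (mu + 1 / real (Suc k)))) sequentially"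
    unfolding AE_all_countable
    by (intro allI AE_finite_allI AE_vector_growth) auto
  moreover have "AE \<omega> in M. \<omega> \<in> space M" by (rule AE_space)
  ultimately show ?thesis
  proof eventually_elim
    case (elim \<omega>)
    have bounds: "?Z 0 n \<omega> \<le> op_norm (Pr n \<omega>)" "op_norm (Pr n \<omega>) \<le> (\<Sum>j<d. ?Z j n \<omega>)" for n
      using op_norm_bounds[OF Pr_carrier[OF elim(2)] d] by auto
    show ?case
    proof (rule tendsto_ln_growth[OF d])
      fix k
      have "eventually (\<lambda>n. exp (real n * (mu - 1 / real (Suc k))) \<le> ?Z 0 n \<omega>) sequentially"
        using bspec[OF spec[OF elim(1), of k], of 0] d by (simp add: eventually_conj_iff)
      then show "eventually (\<lambda>n. exp (real n * (mu - 1 / real (Suc k))) \<le> op_norm (Pr n \<omega>)) sequentially"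
        by eventually_elim (rule order_trans[OF _ bounds(1)])
      have "eventually (\<lambda>n. \<forall>j\<in>{..<d}. ?Z j n \<omega> \<le> exp (real n * (mu + 1 / real (Suc k)))) sequentially"
        using spec[OF elim(1), of k] by (intro eventually_ball_finite) (simp_all add: eventually_conj_iff)
      then show "eventually (\<lambda>n. op_norm (Pr n \<omega>) \<le> real d * exp (real n * (mu + 1 / real (Suc k)))) sequentially"
      proof eventually_elim
        case (elim n)
        have "op_norm (Pr n \<omega>) \<le> (\<Sum>j<d. ?Z j n \<omega>)" by (rule bounds)
        also have "\<dots> \<le> (\<Sum>j<d. exp (real n * (mu + 1 / real (Suc k))))"
          using elim by (intro sum_mono) auto
        finally show ?case by simp
      qed
    qed
  qed
qed

text \<open>The definite description is justified because two almost sure limits agree at some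
  sample point of a probability space, and both are constants.\<close>

lemma largest_lyapunov_eq: "largest_lyapunov M d A = mu"
  unfolding largest_lyapunov_def
proof (rule the_equality)
  show "AE \<omega> in M. (\<lambda>n. ln (op_norm (Pr n \<omega>)) / real n) \<longlonglongrightarrow> mu"
    by (rule AE_op_norm_growth)
  fix \<mu> assume "AE \<omega> in M. (\<lambda>n. ln (op_norm (Pr n \<omega>)) / real n) \<longlonglongrightarrow> \<mu>"
  with AE_op_norm_growth have "AE \<omega> in M. \<mu> = mu"
    by eventually_elim (rule LIMSEQ_unique)
  then show "\<mu> = mu" by simp
qed

end

end

section \<open>Bounds uniform in d and passage to the limit\<close>

section \<open>The limit of large dimension\<close>

locale bounded_covariance =
  fixes d :: nat and \<Sigma> :: "'k::gaussian_scalar mat" and \<theta> :: "nat \<Rightarrow> real" and L :: real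
  assumes d: "d \<ge> 1" and pd: "pos_def_self_adjoint d \<Sigma>"
    and ev: "eigenvalues_are d \<Sigma> (\<lambda>i. \<theta> i / real d)"
    and \<theta>: "\<And>i. i \<in> {1..d} \<Longrightarrow> 1 \<le> \<theta> i \<and> \<theta> i \<le> L"
begin

abbreviation S :: "'k mat" where "S \<equiv> mat_sqrt d \<Sigma>"
abbreviation N :: "(nat \<Rightarrow> 'k) \<Rightarrow> real" where "N g \<equiv> vec_norm (S *\<^sub>v vec d g)"
abbreviation \<tau> :: real where "\<tau> \<equiv> re_trace \<Sigma> d"

lemma L: "1 \<le> L"
  using \<theta>[of 1] d by force

lemma sa: "self_adjoint d \<Sigma>" and carrier: "\<Sigma> \<in> carrier_mat d d"
  using pd by (auto simp: pos_def_self_adjoint_iff self_adjoint_def)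

lemma form_bounds:
  assumes "v \<in> carrier_vec d"
  shows "1 / real d * (vec_norm v)\<^sup>2 \<le> rip v (\<Sigma> *\<^sub>v v)" "rip v (\<Sigma> *\<^sub>v v) \<le> L / real d * (vec_norm v)\<^sup>2"
proof -
  have "1 / real d \<le> \<theta> i / real d \<and> \<theta> i / real d \<le> L / real d" if "i \<in> {1..d}" for i
    using \<theta>[OF that] by (simp add: divide_right_mono)
  from eigenvalue_form_bounds[OF sa d ev this assms]
  show "1 / real d * (vec_norm v)\<^sup>2 \<le> rip v (\<Sigma> *\<^sub>v v)" "rip v (\<Sigma> *\<^sub>v v) \<le> L / real d * (vec_norm v)\<^sup>2"
    by simp_all
qed

lemma form_nonneg: "v \<in> carrier_vec d \<Longrightarrow> 0 \<le> rip v (\<Sigma> *\<^sub>v v)"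
  by (rule order_trans[OF _ form_bounds(1)]) auto

lemma S_pos_def: "pos_def_self_adjoint d S" and S_square: "S * S = \<Sigma>"
  using pos_def_mat_sqrt[OF pd, of "1 / real d" "L / real d"] form_bounds d L by (auto simp: divide_right_mono)

lemma S_self_adjoint: "self_adjoint d S" and S: "S \<in> carrier_mat d d"
  using S_pos_def by (auto simp: pos_def_self_adjoint_iff self_adjoint_def)

text \<open>|S g|^2 is the form of S^2 = \<Sigma>, so concentration can be read off from \<Sigma>
  without knowing the entries of the square root.\<close>

lemma N_square: "(N g)\<^sup>2 = quad \<Sigma> d g"
proof -
  have "(N g)\<^sup>2 = rip (vec d g) (S *\<^sub>v (S *\<^sub>v vec d g))"
    unfolding rip_self[symmetric] by (rule self_adjoint_rip[OF S_self_adjoint]) (use S in auto)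
  also have "S *\<^sub>v (S *\<^sub>v vec d g) = \<Sigma> *\<^sub>v vec d g"
    using assoc_mult_mat_vec[OF S S, of "vec d g"] by (simp add: S_square)
  finally show ?thesis by (simp add: quad_eq_rip[OF carrier])
qed

lemma N_measurable: "N \<in> borel_measurable (gauss_PiM {..<d})"
  using measurable_vec_norm_mult_vec[OF S] by (simp cong: measurable_cong_sets add: sets_gauss_PiM)

text \<open>Diagonal entries are values of the form at unit vectors, each therefore between 1/d and
  L/d.\<close>

lemma trace_bounds: "1 \<le> \<tau>" "\<tau> \<le> L"
proof -
  have e: "rip (unit_vec d i) (\<Sigma> *\<^sub>v unit_vec d i) = inner 1 (\<Sigma> $$ (i, i))" if i: "i < d" for i
  proof -
    have "rip (unit_vec d i) (\<Sigma> *\<^sub>v unit_vec d i) = (\<Sum>j<d. if j = i then inner 1 (\<Sigma> $$ (j, i)) else 0)"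
      unfolding rip_def using i
      by (intro sum.cong) (auto simp: mult_mat_unit_vec_index[OF carrier] simp del: index_mult_mat_vec)
    then show ?thesis using i by simp
  qed
  have "1 / real d \<le> inner 1 (\<Sigma> $$ (i, i))" "inner 1 (\<Sigma> $$ (i, i)) \<le> L / real d" if i: "i < d" for i
    using form_bounds[of "unit_vec d i"] e[OF i] i by auto
  then have "(\<Sum>i<d. 1 / real d) \<le> \<tau>" "\<tau> \<le> (\<Sum>i<d. L / real d)"
    unfolding re_trace_def by (intro sum_mono; simp)+
  moreover have "(\<Sum>i<d. 1 / real d) = 1" "(\<Sum>i<d. L / real d) = L" using d by auto
  ultimately show "1 \<le> \<tau>" "\<tau> \<le> L" by simp_all
qed

text \<open>All columns of \<Sigma> have norm at most L/d, so the squared Frobenius norm is at most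
  d (L/d)^2 = L^2/d; this is where the decay in d originates.\<close>

lemma variance:
  "(\<integral>\<^sup>+g. ennreal (((N g)\<^sup>2 - \<tau>)\<^sup>2) \<partial>gauss_PiM {..<d}) \<le> ennreal ((8 + 2 * gauss_var TYPE('k)) * L\<^sup>2 / real d)"
proof -
  have "frob \<Sigma> d \<le> real d * (L / real d)\<^sup>2"
    using L by (intro frob_le[OF sa _ form_nonneg form_bounds(2)]) auto
  then have "frob \<Sigma> d \<le> L\<^sup>2 / real d" using d by (simp add: power2_eq_square field_simps)
  then have "(8 + 2 * gauss_var TYPE('k)) * frob \<Sigma> d \<le> (8 + 2 * gauss_var TYPE('k)) * (L\<^sup>2 / real d)"
    using gauss_var_nonneg[where 'k='k] by (intro mult_left_mono) auto
  then show ?thesis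
    unfolding N_square using quad_variance[OF sa order_refl] by (auto elim!: order_trans intro: ennreal_leI)
qed

text \<open>The lower bound 1/d on the form gives |S g|^2 \<ge> |g|^2 / d, the mean of the |g_i|^2.
  By \<open>inverse_vec_norm_le\<close> the integrand is then at most the average of |g_i|^(-1/2)
  over i; all d terms have the same expectation, so the bound is free of d.\<close>

lemma neg_moment:
  "(\<integral>\<^sup>+g. inverse (ennreal (N g powr (1/2))) \<partial>gauss_PiM {..<d}) \<le> gauss_neg_moment TYPE('k)"
proof -
  have "(\<integral>\<^sup>+g. inverse (ennreal (N g powr (1/2))) \<partial>gauss_PiM {..<d}) \<le>
      (\<integral>\<^sup>+g. (\<Sum>i<d. ennreal (1 / real d) * inverse (ennreal (norm (g i :: 'k) powr (1/2)))) \<partial>gauss_PiM {..<d})"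
  proof (rule nn_integral_mono)
    fix g :: "nat \<Rightarrow> 'k"
    have "(vec_norm (vec d g))\<^sup>2 / real d \<le> (N g)\<^sup>2"
      unfolding N_square quad_eq_rip[OF carrier] using form_bounds(1)[of "vec d g"] by simp
    from inverse_vec_norm_le[OF d _ this]
    show "inverse (ennreal (N g powr (1/2))) \<le>
        (\<Sum>i<d. ennreal (1 / real d) * inverse (ennreal (norm (g i) powr (1/2))))" by simp
  qed
  also have "\<dots> = (\<Sum>i<d. \<integral>\<^sup>+g. ennreal (1 / real d) * inverse (ennreal (norm (g i :: 'k) powr (1/2))) \<partial>gauss_PiM {..<d})"
  proof (rule nn_integral_sum)
    fix i assume "i \<in> {..<d}"
    then have [measurable]: "(\<lambda>g. g i) \<in> borel_measurable (gauss_PiM {..<d} :: (nat \<Rightarrow> 'k) measure)"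
      by (rule gauss_PiM_component_measurable)
    show "(\<lambda>g. ennreal (1 / real d) * inverse (ennreal (norm (g i) powr (1/2)))) \<in>
        borel_measurable (gauss_PiM {..<d} :: (nat \<Rightarrow> 'k) measure)" by measurable
  qed
  also have "\<dots> = (\<Sum>i<d. ennreal (1 / real d) * gauss_neg_moment TYPE('k))"
  proof (intro sum.cong refl)
    fix i assume i: "i \<in> {..<d}"
    have [measurable]: "(\<lambda>g. g i) \<in> borel_measurable (gauss_PiM {..<d} :: (nat \<Rightarrow> 'k) measure)"
      using i by (rule gauss_PiM_component_measurable)
    have "gauss_neg_moment TYPE('k) =
        (\<integral>\<^sup>+x. inverse (ennreal (norm x powr (1/2))) \<partial>distr (gauss_PiM {..<d}) borel (\<lambda>g. g i :: 'k))"
      unfolding gauss_neg_moment_def distr_gauss_PiM_component[OF i] ..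
    also have "\<dots> = (\<integral>\<^sup>+g. inverse (ennreal (norm (g i :: 'k) powr (1/2))) \<partial>gauss_PiM {..<d})"
    proof -
      have "(\<lambda>x. inverse (ennreal (norm (x :: 'k) powr (1/2)))) \<in> borel_measurable borel" by measurable
      then show ?thesis by (subst nn_integral_distr) auto
    qed
    finally show "(\<integral>\<^sup>+g. ennreal (1 / real d) * inverse (ennreal (norm (g i :: 'k) powr (1/2))) \<partial>gauss_PiM {..<d}) =
        ennreal (1 / real d) * gauss_neg_moment TYPE('k)"
      by (simp add: nn_integral_cmult)
  qed
  also have "\<dots> = ennreal (real d) * ennreal (1 / real d) * gauss_neg_moment TYPE('k)"
    by (simp add: mult.assoc ennreal_of_nat_eq_real_of_nat)
  also have "ennreal (real d) * ennreal (1 / real d) = 1"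
    using d by (simp flip: ennreal_mult)
  finally show ?thesis by simp
qed

lemma neg_moment_finite: "(\<integral>\<^sup>+g. inverse (ennreal (N g powr (1/2))) \<partial>gauss_PiM {..<d}) < \<infinity>"
  using neg_moment gauss_neg_moment_finite by (rule le_less_trans)

lemma pos_moment_finite: "(\<integral>\<^sup>+g. ennreal (N g powr (1/2)) \<partial>gauss_PiM {..<d}) < \<infinity>"
proof -
  interpret prob_space "gauss_PiM {..<d} :: (nat \<Rightarrow> 'k) measure" by (rule prob_space_gauss_PiM)
  note [measurable] = N_measurable
  \<comment> \<open>A bound by quantities already integrated: x^(1/2) \<le> 1 + x^2 at x = N g, then
    y \<le> 1 + y^2 at y = (N g)^2 - \<tau>.\<close>
  have "N g powr (1/2) \<le> (2 + \<tau>) + ((N g)\<^sup>2 - \<tau>)\<^sup>2" for g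
  proof -
    have 1: "x powr (1/2) \<le> 1 + x\<^sup>2" if "x \<ge> 0" for x :: real
    proof (cases "x \<le> 1")
      case True
      then have "x powr (1/2) \<le> 1 powr (1/2)" using that by (intro powr_mono2) auto
      then show ?thesis by (simp add: add_increasing2)
    next
      case False
      then have "x powr (1/2) \<le> x powr 2" by (intro powr_mono) auto
      then show ?thesis using False by simp
    qed
    have 2: "y \<le> 1 + y\<^sup>2" for y :: real
      using zero_le_power2[of "y - 1/2"] by (simp add: power2_eq_square algebra_simps)
    from 1[of "N g"] 2[of "(N g)\<^sup>2 - \<tau>"] show ?thesis by simp
  qed
  then have "(\<integral>\<^sup>+g. ennreal (N g powr (1/2)) \<partial>gauss_PiM {..<d}) \<le>
      (\<integral>\<^sup>+g. ennreal (2 + \<tau>) + ennreal (((N g)\<^sup>2 - \<tau>)\<^sup>2) \<partial>gauss_PiM {..<d})"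
    using trace_bounds by (intro nn_integral_mono) (simp flip: ennreal_plus add: ennreal_leI)
  also have "\<dots> = ennreal (2 + \<tau>) + (\<integral>\<^sup>+g. ennreal (((N g)\<^sup>2 - \<tau>)\<^sup>2) \<partial>gauss_PiM {..<d})"
    by (subst nn_integral_add) (auto simp: emeasure_space_1)
  also have "\<dots> < \<infinity>"
    using le_less_trans[OF variance ennreal_less_top] by simp
  finally show ?thesis .
qed

text \<open>The bound on \<open>ln\<close> is integrated at z = |S g|^2 / \<tau>. Since \<tau> \<ge>
  1, the deviation of z from 1 is controlled by the variance of |S g|^2; since \<tau> \<le> L, the
  singular term costs only a factor L^(1/4).\<close>

lemma log_norm_estimate:
  assumes \<eta>: "0 < \<eta>" and C: "0 \<le> C"
    and ln: "\<And>z. 0 < z \<Longrightarrow> \<bar>ln z\<bar> \<le> \<eta> + C * (z - 1)\<^sup>2 + \<eta> * z powr (-1/4)"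
  shows "\<bar>2 * (\<integral>g. ln (N g) \<partial>gauss_PiM {..<d}) - ln \<tau>\<bar> \<le>
    \<eta> + C * ((8 + 2 * gauss_var TYPE('k)) * L\<^sup>2 / real d) + \<eta> * L powr (1/4) * enn2real (gauss_neg_moment TYPE('k))"
proof -
  let ?Q = "gauss_PiM {..<d} :: (nat \<Rightarrow> 'k) measure"
  let ?K = "enn2real (gauss_neg_moment TYPE('k))"
  let ?V = "(8 + 2 * gauss_var TYPE('k)) * L\<^sup>2 / real d"
  interpret prob_space ?Q by (rule prob_space_gauss_PiM)
  note [measurable] = N_measurable
  note lm = log_moment_bounds[OF prob_space_axioms N_measurable vec_norm_nonneg pos_moment_finite neg_moment_finite]
  have \<tau>: "1 \<le> \<tau>" "\<tau> \<le> L" by (rule trace_bounds)+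
  have K: "gauss_neg_moment TYPE('k) = ennreal ?K"
    using gauss_neg_moment_finite[where 'k='k] by (simp add: less_top)
  have V: "?V \<ge> 0" using gauss_var_nonneg[where 'k='k] by simp
  have nn: "0 \<le> C * ?V" "0 \<le> \<eta> * L powr (1/4) * ?K"
    using mult_nonneg_nonneg[OF C V] \<eta> by auto
  have i: "integrable ?Q (\<lambda>g. 2 * ln (N g) - ln \<tau>)"
    using lm(1) by (intro Bochner_Integration.integrable_diff integrable_mult_right) auto
  have e: "(\<integral>g. 2 * ln (N g) - ln \<tau> \<partial>?Q) = 2 * (\<integral>g. ln (N g) \<partial>?Q) - ln \<tau>"
    using lm(1) by (simp add: prob_space)
  have "ennreal \<bar>2 * (\<integral>g. ln (N g) \<partial>?Q) - ln \<tau>\<bar> \<le> (\<integral>\<^sup>+g. ennreal \<bar>2 * ln (N g) - ln \<tau>\<bar> \<partial>?Q)"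
    using integral_norm_bound_ennreal[OF i] by (simp add: e)
  also have "\<dots> \<le> (\<integral>\<^sup>+g. ennreal \<eta> + ennreal C * ennreal (((N g)\<^sup>2 - \<tau>)\<^sup>2) +
      ennreal (\<eta> * L powr (1/4)) * inverse (ennreal (N g powr (1/2))) \<partial>?Q)"
  proof (rule nn_integral_mono_AE, use lm(2) in eventually_elim)
    case (elim g)
    define z where "z = (N g)\<^sup>2 / \<tau>"
    have z: "z > 0" using elim \<tau> by (simp add: z_def)
    have "ln z = 2 * ln (N g) - ln \<tau>"
      using elim \<tau> by (simp add: z_def ln_div ln_realpow)
    moreover have "(z - 1)\<^sup>2 \<le> ((N g)\<^sup>2 - \<tau>)\<^sup>2"
    proof -
      have "(z - 1)\<^sup>2 = ((N g)\<^sup>2 - \<tau>)\<^sup>2 / \<tau>\<^sup>2"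
        using \<tau> by (simp add: z_def power_divide[symmetric] diff_divide_distrib)
      also have "\<dots> \<le> ((N g)\<^sup>2 - \<tau>)\<^sup>2 / 1" using \<tau> by (intro divide_left_mono) auto
      finally show ?thesis by simp
    qed
    moreover have "z powr (-1/4) \<le> L powr (1/4) * N g powr (-1/2)"
    proof -
      have "z powr (-1/4) = \<tau> powr (1/4) * ((N g)\<^sup>2) powr (-1/4)"
        using elim \<tau> by (simp add: z_def powr_divide powr_minus field_simps)
      also have "((N g)\<^sup>2) powr (-1/4) = N g powr (-1/2)"
        using elim by (simp add: powr_powr flip: powr_numeral)
      also have "\<tau> powr (1/4) * N g powr (-1/2) \<le> L powr (1/4) * N g powr (-1/2)"
        using \<tau> by (intro mult_right_mono powr_mono2) auto
      finally show ?thesis .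
    qed
    ultimately have "\<bar>2 * ln (N g) - ln \<tau>\<bar> \<le> \<eta> + C * ((N g)\<^sup>2 - \<tau>)\<^sup>2 + \<eta> * (L powr (1/4) * N g powr (-1/2))"
      using ln[OF z] C \<eta> by (smt (verit) mult_left_mono)
    then have "ennreal \<bar>2 * ln (N g) - ln \<tau>\<bar> \<le>
        ennreal (\<eta> + C * ((N g)\<^sup>2 - \<tau>)\<^sup>2 + \<eta> * (L powr (1/4) * N g powr (-1/2)))"
      by (rule ennreal_leI)
    also have "\<dots> = ennreal \<eta> + ennreal C * ennreal (((N g)\<^sup>2 - \<tau>)\<^sup>2) +
      ennreal (\<eta> * L powr (1/4)) * inverse (ennreal (N g powr (1/2)))"
      using \<eta> C elim by (simp add: inverse_ennreal powr_minus ennreal_mult ennreal_plus[symmetric] mult.assoc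
          del: ennreal_plus) (simp add: ennreal_mult[symmetric] ennreal_plus[symmetric] del: ennreal_plus)
    finally show ?case .
  qed
  also have "\<dots> = ennreal \<eta> + ennreal C * (\<integral>\<^sup>+g. ennreal (((N g)\<^sup>2 - \<tau>)\<^sup>2) \<partial>?Q) +
      ennreal (\<eta> * L powr (1/4)) * (\<integral>\<^sup>+g. inverse (ennreal (N g powr (1/2))) \<partial>?Q)"
    by (simp add: nn_integral_add nn_integral_cmult emeasure_space_1)
  also have "\<dots> \<le> ennreal \<eta> + ennreal C * ennreal ?V + ennreal (\<eta> * L powr (1/4)) * ennreal ?K"
    unfolding K[symmetric] by (intro add_mono mult_left_mono variance neg_moment) auto
  also have "\<dots> = ennreal (\<eta> + C * ?V + \<eta> * L powr (1/4) * ?K)"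
  proof -
    have "ennreal C * ennreal ?V = ennreal (C * ?V)"
      "ennreal (\<eta> * L powr (1/4)) * ennreal ?K = ennreal (\<eta> * L powr (1/4) * ?K)"
      using \<eta> C V by (intro ennreal_mult[symmetric]; simp)+
    then show ?thesis using \<eta> nn by (simp only: ennreal_plus less_imp_le add_nonneg_nonneg)
  qed
  finally show ?thesis
    by (rule ennreal_le_iff[THEN iffD1, rotated]) (intro add_nonneg_nonneg nn less_imp_le[OF \<eta>])
qed

end

text \<open>The argument is uniform in the scalar type: \<beta> affects the error only through the
  constants \<open>gauss_var\<close> and \<open>gauss_neg_moment\<close>. In the error bound \<eta>
  is fixed before C, and C before d, so that the term C W / d can be made small last.\<close>

lemma lyapunov_exponent_limit:
  fixes M :: "nat \<Rightarrow> 'w measure" and \<theta> :: "nat \<Rightarrow> nat \<Rightarrow> real" and L lam :: real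
    and \<Sigma> :: "nat \<Rightarrow> 'k::gaussian_scalar mat" and A :: "nat \<Rightarrow> nat \<Rightarrow> 'w \<Rightarrow> 'k mat"
  assumes prob: "\<And>d. d \<ge> 1 \<Longrightarrow> prob_space (M d)"
    and bounds: "\<And>d i. d \<ge> 1 \<Longrightarrow> i \<in> {1..d} \<Longrightarrow> 1 \<le> \<theta> d i \<and> \<theta> d i \<le> L"
    and cov: "\<forall>d\<ge>1. pos_def_self_adjoint d (\<Sigma> d) \<and>
          eigenvalues_are d (\<Sigma> d) (\<lambda>i. \<theta> d i / real d) \<and>
          iid_gaussian_matrices (M d) d (\<Sigma> d) (A d)"
    and trace: "(\<lambda>d. mat_trace (\<Sigma> d)) \<longlonglongrightarrow> of_real lam"
  shows "(\<lambda>d. largest_lyapunov (M d) d (A d)) \<longlonglongrightarrow> (1 / 2) * ln lam"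
proof -
  define mu where "mu d = largest_lyapunov (M d) d (A d)" for d
  define \<tau> where "\<tau> d = re_trace (\<Sigma> d) d" for d
  have bc: "bounded_covariance d (\<Sigma> d) (\<theta> d) L" if "d \<ge> 1" for d
    using that cov bounds by unfold_locales auto
  have \<tau>1: "1 \<le> \<tau> d" if "d \<ge> 1" for d
    using bounded_covariance.trace_bounds(1)[OF bc[OF that]] by (simp add: \<tau>_def)
  have mu: "mu d = (\<integral>g. ln (vec_norm (mat_sqrt d (\<Sigma> d) *\<^sub>v vec d g)) \<partial>gauss_PiM {..<d})" if d: "d \<ge> 1" for d
  proof -
    interpret b: bounded_covariance d "\<Sigma> d" "\<theta> d" L by (rule bc[OF d])
    interpret prob_space "M d" using d by (rule prob)
    interpret g: gaussian_product "M d" d "\<Sigma> d" "A d"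
      by unfold_locales (use d cov b.S in auto)
    show ?thesis unfolding mu_def
      by (rule g.largest_lyapunov_eq[OF b.pos_moment_finite b.neg_moment_finite])
  qed
  have \<tau>_lim: "\<tau> \<longlonglongrightarrow> lam"
  proof -
    \<comment> \<open>The trace converges as a scalar; its real part is \<open>re_trace\<close>, the
      mean of |S g|^2.\<close>
    have "(\<lambda>d. inner 1 (mat_trace (\<Sigma> d))) \<longlonglongrightarrow> inner 1 (of_real lam :: 'k)"
      by (intro tendsto_inner tendsto_const trace)
    moreover have "eventually (\<lambda>d. inner 1 (mat_trace (\<Sigma> d)) = \<tau> d) sequentially"
      using eventually_ge_at_top[of 1]
    proof eventually_elim
      case (elim d)
      then have "\<Sigma> d \<in> carrier_mat d d" using cov by (auto simp: pos_def_self_adjoint_def)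
      then show ?case by (simp add: mat_trace_def \<tau>_def re_trace_def inner_sum_right)
    qed
    ultimately show ?thesis by (simp add: tendsto_cong)
  qed
  \<comment> \<open>Inherited from \<tau> \<ge> 1 in the limit; it keeps \<open>lam\<close> away
    from the singularity of \<open>ln\<close>.\<close>
  have lam: "1 \<le> lam"
    using \<tau>1 by (intro tendsto_lowerbound[OF \<tau>_lim]) (auto intro: eventually_sequentiallyI[of 1])
  let ?K = "enn2real (gauss_neg_moment TYPE('k))"
  let ?W = "(8 + 2 * gauss_var TYPE('k)) * L\<^sup>2"
  have "(\<lambda>d. 2 * mu d - ln (\<tau> d)) \<longlonglongrightarrow> 0"
  proof (rule tendstoI)
    fix e :: real assume e: "0 < e"
    \<comment> \<open>G collects everything that \<eta> multiplies in the estimate, so \<eta> = e/(2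
      G) makes these terms equal to e/2.\<close>
    define G where "G = 1 + L powr (1/4) * ?K"
    have G: "G > 0" by (simp add: G_def add_pos_nonneg)
    define \<eta> where "\<eta> = e / (2 * G)"
    have \<eta>: "\<eta> > 0" using e G by (simp add: \<eta>_def)
    have \<eta>e: "\<eta> + \<eta> * L powr (1/4) * ?K = e / 2"
    proof -
      have "\<eta> + \<eta> * L powr (1/4) * ?K = \<eta> * G" by (simp add: G_def algebra_simps)
      then show ?thesis using G by (simp add: \<eta>_def)
    qed
    obtain C where C: "C \<ge> 0" "\<And>z. 0 < z \<Longrightarrow> \<bar>ln z\<bar> \<le> \<eta> + C * (z - 1)\<^sup>2 + \<eta> * z powr (-1/4)"
      using abs_ln_le_eta[OF \<eta>] by blast
    have "(\<lambda>d. C * ?W / real d) \<longlonglongrightarrow> 0" by (rule lim_const_over_n)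
    then have "eventually (\<lambda>d. C * ?W / real d < e / 2) sequentially"
      using e by (intro order_tendstoD) auto
    with eventually_ge_at_top[of 1]
    show "eventually (\<lambda>d. dist (2 * mu d - ln (\<tau> d)) 0 < e) sequentially"
    proof eventually_elim
      case (elim d)
      have "\<bar>2 * mu d - ln (\<tau> d)\<bar> \<le> \<eta> + C * (?W / real d) + \<eta> * L powr (1/4) * ?K"
        unfolding mu[OF elim(1)] \<tau>_def
        by (rule bounded_covariance.log_norm_estimate[OF bc[OF elim(1)] \<eta> C])
      also have "\<dots> = e / 2 + C * ?W / real d" using \<eta>e by simp
      also have "\<dots> < e" using elim(2) by linarith
      finally show ?case by (simp add: dist_real_def)
    qed
  qed
  moreover have "(\<lambda>d. ln (\<tau> d)) \<longlonglongrightarrow> ln lam"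
    using lam by (intro tendsto_ln \<tau>_lim) auto
  ultimately have "(\<lambda>d. 1 / 2 * ((2 * mu d - ln (\<tau> d)) + ln (\<tau> d))) \<longlonglongrightarrow> 1 / 2 * (0 + ln lam)"
    by (intro tendsto_mult tendsto_add tendsto_const)
  then show ?thesis by (simp add: mu_def)
qed

theorem theorem1p2:
  fixes M :: "nat \<Rightarrow> 'w measure"
    and \<theta> :: "nat \<Rightarrow> nat \<Rightarrow> real"
    and L lam :: real
    and \<Sigma>1 :: "nat \<Rightarrow> real mat" and A1 :: "nat \<Rightarrow> nat \<Rightarrow> 'w \<Rightarrow> real mat"
    and \<Sigma>2 :: "nat \<Rightarrow> complex mat" and A2 :: "nat \<Rightarrow> nat \<Rightarrow> 'w \<Rightarrow> complex mat"
    and \<Sigma>4 :: "nat \<Rightarrow> quat mat" and A4 :: "nat \<Rightarrow> nat \<Rightarrow> 'w \<Rightarrow> quat mat"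
  assumes prob: "\<And>d. d \<ge> 1 \<Longrightarrow> prob_space (M d)"
    and bounds: "\<And>d i. d \<ge> 1 \<Longrightarrow> i \<in> {1..d} \<Longrightarrow> 1 \<le> \<theta> d i \<and> \<theta> d i \<le> L"
    and average: "(\<lambda>d. (1 / real d) * (\<Sum>i=1..d. \<theta> d i)) \<longlonglongrightarrow> lam"
  shows
    "((\<forall>d\<ge>1. pos_def_self_adjoint d (\<Sigma>1 d) \<and>
          eigenvalues_are d (\<Sigma>1 d) (\<lambda>i. \<theta> d i / real d) \<and>
          iid_gaussian_matrices (M d) d (\<Sigma>1 d) (A1 d)) \<and>
      (\<lambda>d. mat_trace (\<Sigma>1 d)) \<longlonglongrightarrow> of_real lam \<longrightarrow>
      (\<lambda>d. largest_lyapunov (M d) d (A1 d)) \<longlonglongrightarrow> (1 / 2) * ln lam) \<and>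
     ((\<forall>d\<ge>1. pos_def_self_adjoint d (\<Sigma>2 d) \<and>
          eigenvalues_are d (\<Sigma>2 d) (\<lambda>i. \<theta> d i / real d) \<and>
          iid_gaussian_matrices (M d) d (\<Sigma>2 d) (A2 d)) \<and>
      (\<lambda>d. mat_trace (\<Sigma>2 d)) \<longlonglongrightarrow> of_real lam \<longrightarrow>
      (\<lambda>d. largest_lyapunov (M d) d (A2 d)) \<longlonglongrightarrow> (1 / 2) * ln lam) \<and>
     ((\<forall>d\<ge>1. pos_def_self_adjoint d (\<Sigma>4 d) \<and>
          eigenvalues_are d (\<Sigma>4 d) (\<lambda>i. \<theta> d i / real d) \<and>
          iid_gaussian_matrices (M d) d (\<Sigma>4 d) (A4 d)) \<and>
      (\<lambda>d. mat_trace (\<Sigma>4 d)) \<longlonglongrightarrow> of_real lam \<longrightarrow>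
      (\<lambda>d. largest_lyapunov (M d) d (A4 d)) \<longlonglongrightarrow> (1 / 2) * ln lam)"
proof (intro conjI impI; elim conjE)
  assume h: "\<forall>d\<ge>1. pos_def_self_adjoint d (\<Sigma>1 d) \<and>
      eigenvalues_are d (\<Sigma>1 d) (\<lambda>i. \<theta> d i / real d) \<and> iid_gaussian_matrices (M d) d (\<Sigma>1 d) (A1 d)"
    and tr: "(\<lambda>d. mat_trace (\<Sigma>1 d)) \<longlonglongrightarrow> of_real lam"
  show "(\<lambda>d. largest_lyapunov (M d) d (A1 d)) \<longlonglongrightarrow> (1 / 2) * ln lam"
    by (rule lyapunov_exponent_limit[OF prob bounds h tr])
next
  assume h: "\<forall>d\<ge>1. pos_def_self_adjoint d (\<Sigma>2 d) \<and>
      eigenvalues_are d (\<Sigma>2 d) (\<lambda>i. \<theta> d i / real d) \<and> iid_gaussian_matrices (M d) d (\<Sigma>2 d) (A2 d)"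
    and tr: "(\<lambda>d. mat_trace (\<Sigma>2 d)) \<longlonglongrightarrow> of_real lam"
  show "(\<lambda>d. largest_lyapunov (M d) d (A2 d)) \<longlonglongrightarrow> (1 / 2) * ln lam"
    by (rule lyapunov_exponent_limit[OF prob bounds h tr])
next
  assume h: "\<forall>d\<ge>1. pos_def_self_adjoint d (\<Sigma>4 d) \<and>
      eigenvalues_are d (\<Sigma>4 d) (\<lambda>i. \<theta> d i / real d) \<and> iid_gaussian_matrices (M d) d (\<Sigma>4 d) (A4 d)"
    and tr: "(\<lambda>d. mat_trace (\<Sigma>4 d)) \<longlonglongrightarrow> of_real lam"
  show "(\<lambda>d. largest_lyapunov (M d) d (A4 d)) \<longlonglongrightarrow> (1 / 2) * ln lam"
    by (rule lyapunov_exponent_limit[OF prob bounds h tr])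
qed

end
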